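(* Let $g\colon\mathbb C\to\widehat{\mathbb C}$ be a transcendental meromorphic map with $|S_g|\le 3$, where $S_g$ is its set of singular values. Then the parameter space $\mathrm{Par}(g)$ contains infinitely many pairwise (topologically or conformally) non-conjugate postsingularly finite maps with four postsingular values.
   Context: For a meromorphic map $g\colon\mathbb C\to\widehat{\mathbb C}$, the singular set $S_g\subset\widehat{\mathbb C}$ is the set of points $q$ having no open neighborhood $V$ such that $g$ maps each component of $g^{-1}(V)$ homeomorphically onto $V$. The postsingular set $P_g\subset\widehat{\mathbb C}$ is the union of the forward orbits of all singular values, where an orbit stops if it reaches the essential singularity $\infty$ (so $\infty\in P_g$ if $\infty$ is a singular value or lies on the orbit of one). $g$ is postsingularly finite if $P_g$ is finite; elements of $P_g$ are its postsingular values. For a non-constant meromorphic map $g\colon\mathbb C\to\widehat{\mathbb C}$ with finitely many singular values, its parameter space is $$\mathrm{Par}(g)=\{\varphi\circ g\circ\psi\colon\mathbb C\to\widehat{\mathbb C}\ \text{holomorphic, for some } \varphi\in\mathrm{Homeo}^+(\widehat{\mathbb C}),\ \psi\in\mathrm{Homeo}^+(\mathbb C)\},$$ where $\mathrm{Homeo}^+$ denotes the group of orientation-preserving self-homeomorphisms (holomorphic as a map to $\widehat{\mathbb C}$, i.e. meromorphic). *)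

theory Defs
  imports "HOL-Complex_Analysis.Complex_Analysis" "HOL-Homology.Homology"
begin

text \<open>The Riemann sphere is the one-point compactification of the complex plane; the point
  \<open>None\<close> is \<open>\<infinity>\<close>, and \<open>map_option h\<close> is the extension of \<open>h :: complex \<Rightarrow> complex\<close> that
  fixes \<open>\<infinity>\<close>.\<close>

definition riemann_sphere :: "complex option topology" where
  "riemann_sphere = Alexandroff_compactification euclidean"

text \<open>The library's nicely meromorphic functions are complex-valued and take the value 0 at poles;
  here the poles are sent to \<open>\<infinity>\<close> instead. The constant map \<open>\<infinity>\<close> is not
  meromorphic.\<close>

definition meromorphic_map :: "(complex \<Rightarrow> complex option) \<Rightarrow> bool" where
  "meromorphic_map g \<longleftrightarrow>
     (\<exists>f. f nicely_meromorphic_on UNIV \<and> (\<forall>z. g z = (if is_pole f z then None else Some (f z))))"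

text \<open>Transcendental means that \<open>\<infinity>\<close> is an essential singularity: there is no limit at
  \<open>\<infinity>\<close>, finite or infinite. Poles are allowed to accumulate at \<open>\<infinity>\<close>.\<close>

definition transcendental_meromorphic :: "(complex \<Rightarrow> complex option) \<Rightarrow> bool" where
  "transcendental_meromorphic g \<longleftrightarrow>
     meromorphic_map g \<and> \<not> (\<exists>l. limitin riemann_sphere g l at_infinity)"

definition singular_set :: "(complex \<Rightarrow> complex option) \<Rightarrow> complex option set" where
  "singular_set g =
     {q. \<not> (\<exists>V. openin riemann_sphere V \<and> q \<in> V \<and>
            (\<forall>C \<in> components (g -` V).
               homeomorphic_map (top_of_set C) (subtopology riemann_sphere V) g))}"

text \<open>Orbits start at the singular values themselves and stop on reaching \<open>\<infinity>\<close>.\<close>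

inductive_set postsingular_set :: "(complex \<Rightarrow> complex option) \<Rightarrow> complex option set"
  for g where
  singular: "q \<in> singular_set g \<Longrightarrow> q \<in> postsingular_set g"
| step: "Some z \<in> postsingular_set g \<Longrightarrow> g z \<in> postsingular_set g"

definition postsingularly_finite :: "(complex \<Rightarrow> complex option) \<Rightarrow> bool" where
  "postsingularly_finite g \<longleftrightarrow> finite (postsingular_set g)"

text \<open>A self-homeomorphism of the sphere preserves orientation if it has degree 1. The library's
  degree is for self-maps of the unit sphere \<open>nsphere 2\<close>, so \<open>\<phi>\<close> is transported along a
  homeomorphism \<open>h\<close>; by multiplicativity of the degree the value does not depend on \<open>h\<close>.\<close>

definition Homeo_plus_sphere :: "(complex option \<Rightarrow> complex option) set" where
  "Homeo_plus_sphere =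
     {\<phi>. homeomorphic_map riemann_sphere riemann_sphere \<phi> \<and>
         (\<exists>h k. homeomorphic_maps riemann_sphere (nsphere 2) h k \<and>
                Brouwer_degree2 2 (h \<circ> \<phi> \<circ> k) = 1)}"

text \<open>A self-homeomorphism of the plane preserves orientation iff its extension to the sphere
  does.\<close>

definition Homeo_plus_plane :: "(complex \<Rightarrow> complex) set" where
  "Homeo_plus_plane =
     {\<psi>. homeomorphic_map euclidean euclidean \<psi> \<and> map_option \<psi> \<in> Homeo_plus_sphere}"

definition Par :: "(complex \<Rightarrow> complex option) \<Rightarrow> (complex \<Rightarrow> complex option) set" where
  "Par g = {\<phi> \<circ> g \<circ> \<psi> | \<phi> \<psi>.
     \<phi> \<in> Homeo_plus_sphere \<and> \<psi> \<in> Homeo_plus_plane \<and> meromorphic_map (\<phi> \<circ> g \<circ> \<psi>)}"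

text \<open>A conjugacy between maps defined on the plane must respect the common domain, so it is a
  self-map of the plane, extended by \<open>\<infinity> \<mapsto> \<infinity>\<close> on the side of the values.
  Topological conjugacies are allowed to reverse orientation.\<close>

definition topologically_conjugate ::
    "(complex \<Rightarrow> complex option) \<Rightarrow> (complex \<Rightarrow> complex option) \<Rightarrow> bool" where
  "topologically_conjugate f g \<longleftrightarrow>
     (\<exists>h. homeomorphic_map euclidean euclidean h \<and> map_option h \<circ> f = g \<circ> h)"

definition conformally_conjugate ::
    "(complex \<Rightarrow> complex option) \<Rightarrow> (complex \<Rightarrow> complex option) \<Rightarrow> bool" where
  "conformally_conjugate f g \<longleftrightarrow>
     (\<exists>h k. h holomorphic_on UNIV \<and> k holomorphic_on UNIV \<and> k \<circ> h = id \<and> h \<circ> k = id \<and>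
            map_option h \<circ> f = g \<circ> h)"

end

theory Submission
  imports Defs
begin

text \<open>After a Moebius change of coordinates in the range, the singular values of \<open>g\<close> lie in
  \<open>{0, 1, \<infinity>}\<close>, both 0 and \<open>\<infinity>\<close> are singular, and by Picard's theorem 1 has infinitely many
  preimages. Fix a preimage \<open>p\<close> of 1. For all but finitely many other preimages \<open>s\<close> of 1, Picard's
  theorem for \<open>(z - p) g(z)\<close> yields \<open>q\<close> with \<open>(q - p) g(q) = s - p\<close>. The map \<open>p + (q - p) g\<close> then
  sends \<open>p\<close> to \<open>q\<close>, \<open>q\<close> to \<open>s\<close> and \<open>s\<close> to \<open>q\<close>, so its postsingular set is \<open>{p, q, s, \<infinity>}\<close>.

  A topological conjugacy \<open>h\<close> between two such maps fixes \<open>p\<close>, maps the one \<open>s\<close> to the other, and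
  satisfies \<open>g \<circ> h = \<eta> \<circ> g\<close> for a homeomorphism \<open>\<eta>\<close> of the plane fixing 0 and 1. If \<open>\<eta>\<close> preserves
  the orientation, it is homotopic to the identity off 0 and 1; lifting the homotopy through the
  covering \<open>g\<close> turns \<open>h\<close> into a deck transformation with the same values at the preimages of 1.
  There are only finitely many deck transformations fixing \<open>p\<close>, so each \<open>s\<close> is equivalent to only
  finitely many others, and infinitely many conjugacy classes remain.\<close>

section \<open>The Riemann sphere and the degree of Moebius transformations\<close>

text \<open>The obstacle is that a topological conjugacy is merely continuous, so no conformal
  rigidity applies and \<open>\<eta>\<close> ranges over a huge set. What is tracked instead is
  discrete: the preimages of 1, where a homotopy of \<open>\<eta>\<close> through maps that fix 1
  has no effect after lifting. That \<open>\<eta>\<close> can be unwound at all reflects the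
  triviality of the pure mapping class group of the sphere with the three marked points 0, 1 and
  \<infinity>. It is done by hand: one homotopy avoids 1 outside the unit disc, another one inside
  it, and only their lifts are compared, over the unit circle. An orientation-reversing symmetry is
  composed with the inverse of a fixed one, which leads back to the orientation-preserving case.

  The value 1 need not be singular: the orbit of the singular value \<open>p\<close> reaches
  \<open>q\<close> and \<open>s\<close> in any case, which treats two and three singular values
  alike. Since \<open>s\<close> is a preimage of 1, its image is \<open>q\<close> automatically, and
  a single equation for \<open>q\<close> remains.\<close>

lemma openin_riemann_sphere:
  "openin riemann_sphere U \<longleftrightarrow> open (Some -` U) \<and> (None \<in> U \<longrightarrow> eventually (\<lambda>z. Some z \<in> U) at_infinity)"
proof
  assume "openin riemann_sphere U"
  then consider V where "open V" "U = Some ` V" | C where "compact C" "closed C" "U = insert None (Some ` (- C))"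
    unfolding riemann_sphere_def openin_Alexandroff_compactification by (auto simp: Compl_eq_Diff_UNIV)
  then show "open (Some -` U) \<and> (None \<in> U \<longrightarrow> eventually (\<lambda>z. Some z \<in> U) at_infinity)"
  proof cases
    case 1
    then have "Some -` U = V" by auto
    then show ?thesis using 1 by auto
  next
    case 2
    then have "Some -` U = - C" by auto
    moreover obtain B where "\<forall>x\<in>C. norm x \<le> B" using compact_imp_bounded[OF 2(1)] by (auto simp: bounded_iff)
    then have "eventually (\<lambda>z. Some z \<in> U) at_infinity"
      unfolding eventually_at_infinity using 2 by (intro exI[of _ "B + 1"]) (force simp: image_iff)
    ultimately show ?thesis using 2 by (simp add: open_Compl)
  qed
next
  assume U: "open (Some -` U) \<and> (None \<in> U \<longrightarrow> eventually (\<lambda>z. Some z \<in> U) at_infinity)"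
  show "openin riemann_sphere U"
  proof (cases "None \<in> U")
    case False
    then have "U = Some ` (Some -` U)" by (auto simp: image_iff) (metis option.exhaust)
    then show ?thesis using U unfolding riemann_sphere_def openin_Alexandroff_compactification
      by (intro disjI1 exI[of _ "Some -` U"]) auto
  next
    case True
    \<comment> \<open>By Heine-Borel this closed set is compact as soon as it misses all large
      points.\<close>
    define C where "C = - (Some -` U)"
    obtain B where "\<And>z. norm z \<ge> B \<Longrightarrow> Some z \<in> U" using U True by (auto simp: eventually_at_infinity)
    then have "C \<subseteq> cball 0 B" unfolding C_def by (auto simp: subset_iff) (metis linear)
    then have "bounded C" using bounded_cball bounded_subset by blast
    then have "compact C" "closed C" using U by (auto simp: C_def compact_eq_bounded_closed closed_Compl)
    moreover have "U = insert None (Some ` (UNIV - C))"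
      using True by (auto simp: C_def image_iff)
    ultimately show ?thesis unfolding riemann_sphere_def openin_Alexandroff_compactification
      by (intro disjI2 exI[of _ C]) auto
  qed
qed

lemma topspace_riemann_sphere [simp]: "topspace riemann_sphere = UNIV"
  by (simp add: riemann_sphere_def flip: UNIV_option_conv)

lemma compact_riemann_sphere: "compact_space riemann_sphere"
  by (simp add: riemann_sphere_def)

lemma limitin_Some:
  assumes "(f \<longlongrightarrow> l) F"
  shows "limitin riemann_sphere (\<lambda>x. Some (f x)) (Some l) F"
  unfolding limitin_def openin_riemann_sphere
proof (intro conjI allI impI)
  fix U assume U: "(open (Some -` U) \<and> (None \<in> U \<longrightarrow> (\<forall>\<^sub>F z in at_infinity. Some z \<in> U))) \<and> Some l \<in> U"
  then have "eventually (\<lambda>x. f x \<in> Some -` U) F"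
    by (intro topological_tendstoD[OF assms]) auto
  then show "eventually (\<lambda>x. Some (f x) \<in> U) F" by simp
qed simp

lemma limitin_None:
  assumes "filterlim f at_infinity F"
  shows "limitin riemann_sphere (\<lambda>x. Some (f x)) None F"
  unfolding limitin_def openin_riemann_sphere
  using assms by (auto simp: filterlim_iff)

lemma limitin_cong_eventually:
  assumes "eventually (\<lambda>x. f x = g x) F" "limitin X g l F"
  shows "limitin X f l F"
  unfolding limitin_def
proof (intro conjI allI impI)
  show "l \<in> topspace X" using assms(2) by (simp add: limitin_def)
  fix U assume "openin X U \<and> l \<in> U"
  then have "eventually (\<lambda>x. g x \<in> U) F" using assms(2) by (simp add: limitin_def)
  with assms(1) show "eventually (\<lambda>x. f x \<in> U) F" by eventually_elim simp
qed

lemma limitin_SomeD: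
  assumes "limitin riemann_sphere (\<lambda>x. Some (f x)) (Some l) F"
  shows "(f \<longlongrightarrow> l) F"
proof (rule topological_tendstoI)
  fix S assume "open S" "l \<in> S"
  then have "openin riemann_sphere (Some ` S)" by (simp add: riemann_sphere_def)
  then have "eventually (\<lambda>x. Some (f x) \<in> Some ` S) F" using assms \<open>l \<in> S\<close> unfolding limitin_def by blast
  then show "eventually (\<lambda>x. f x \<in> S) F" by (rule eventually_mono) auto
qed

section \<open>Continuous maps and homeomorphisms of the sphere\<close>

lemma continuous_map_from_sphere:
  assumes c: "continuous_map euclidean Y (\<lambda>z. F (Some z))" and l: "limitin Y (\<lambda>z. F (Some z)) (F None) at_infinity"
  shows "continuous_map riemann_sphere Y F"
  unfolding continuous_map_def
proof (intro conjI allI impI)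
  have "F x \<in> topspace Y" for x
    using c l by (cases x) (auto simp: limitin_def continuous_map_def)
  then show "F \<in> topspace riemann_sphere \<rightarrow> topspace Y" by auto
  fix U assume U: "openin Y U"
  have "open {z. F (Some z) \<in> U}" using openin_continuous_map_preimage[OF c U] by simp
  then show "openin riemann_sphere {x \<in> topspace riemann_sphere. F x \<in> U}"
    using l U unfolding openin_riemann_sphere by (auto simp: vimage_def limitin_def)
qed

lemma continuous_map_euclidean_limitin:
  fixes F :: "'a::topological_space \<Rightarrow> 'b"
  shows "continuous_map euclidean Y F \<longleftrightarrow> (\<forall>z. limitin Y F (F z) (at z))"
proof -
  have "atin euclidean z = at z" for z :: 'a
    by (auto simp: filter_eq_iff eventually_atin eventually_at_topological)
  then show ?thesis by (simp add: continuous_map_atin)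
qed

text \<open>A homeomorphism is proper: the points that \<open>h\<close> sends into a closed ball
  form the image of this ball under \<open>h'\<close>, which is compact and hence bounded.\<close>

lemma filterlim_homeomorphism_at_infinity:
  fixes h :: "complex \<Rightarrow> complex"
  assumes "homeomorphism UNIV UNIV h h'"
  shows "filterlim h at_infinity at_infinity"
  unfolding filterlim_at_infinity[of 0, simplified]
proof (intro allI impI)
  fix r :: real
  have c: "continuous_on UNIV h'" and inv: "\<And>z. h' (h z) = z" using assms by (auto simp: homeomorphism_def)
  have "compact (h' ` cball 0 r)"
    by (intro compact_continuous_image continuous_on_subset[OF c]) auto
  then obtain B where B: "\<And>z. norm z \<le> r \<Longrightarrow> norm (h' z) \<le> B"
    using compact_imp_bounded bounded_iff by (metis image_eqI mem_cball_0)
  show "eventually (\<lambda>x. r \<le> norm (h x)) at_infinity"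
    unfolding eventually_at_infinity
  proof (intro exI[of _ "B + 1"] allI impI)
    fix x :: complex assume "B + 1 \<le> norm x"
    then show "r \<le> norm (h x)" using B[of "h x"] inv[of x] by force
  qed
qed

lemma homeomorphic_map_sphereI:
  assumes "continuous_map riemann_sphere riemann_sphere F" "continuous_map riemann_sphere riemann_sphere G"
    "\<And>x. G (F x) = x" "\<And>x. F (G x) = x"
  shows "homeomorphic_map riemann_sphere riemann_sphere F"
  using assms by (auto simp: homeomorphic_map_maps homeomorphic_maps_def)

lemma continuous_map_map_option:
  fixes h :: "complex \<Rightarrow> complex"
  assumes "homeomorphism UNIV UNIV h h'"
  shows "continuous_map riemann_sphere riemann_sphere (map_option h)"
proof (rule continuous_map_from_sphere)
  show "continuous_map euclidean riemann_sphere (\<lambda>z. map_option h (Some z))"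
    unfolding continuous_map_euclidean_limitin
    using assms by (auto intro!: limitin_Some simp: homeomorphism_def continuous_on_def)
  show "limitin riemann_sphere (\<lambda>z. map_option h (Some z)) (map_option h None) at_infinity"
    using filterlim_homeomorphism_at_infinity[OF assms] by (auto intro: limitin_None)
qed

lemma homeomorphic_map_option:
  fixes h :: "complex \<Rightarrow> complex"
  assumes "homeomorphism UNIV UNIV h h'"
  shows "homeomorphic_map riemann_sphere riemann_sphere (map_option h)"
proof (rule homeomorphic_map_sphereI)
  show "continuous_map riemann_sphere riemann_sphere (map_option h')"
    by (rule continuous_map_map_option[OF homeomorphism_symD[OF assms]])
qed (use assms continuous_map_map_option[OF assms] in \<open>auto simp: homeomorphism_def option.map_comp o_def option.map_ident\<close>)

definition sphere_inv :: "complex option \<Rightarrow> complex option" where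
  "sphere_inv x = (case x of None \<Rightarrow> Some 0 | Some z \<Rightarrow> if z = 0 then None else Some (inverse z))"

lemma sphere_inv_simps [simp]: "sphere_inv None = Some 0" "sphere_inv (Some 0) = None"
  "z \<noteq> 0 \<Longrightarrow> sphere_inv (Some z) = Some (inverse z)"
  by (auto simp: sphere_inv_def)

lemma sphere_inv_inv [simp]: "sphere_inv (sphere_inv x) = x"
  by (auto simp: sphere_inv_def split: option.splits)

lemma homeomorphic_map_sphere_inv: "homeomorphic_map riemann_sphere riemann_sphere sphere_inv"
proof -
  have "continuous_map riemann_sphere riemann_sphere sphere_inv"
  proof (rule continuous_map_from_sphere)
    show "continuous_map euclidean riemann_sphere (\<lambda>z. sphere_inv (Some z))"
      unfolding continuous_map_euclidean_limitin
    proof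
      fix z :: complex
      have ev: "eventually (\<lambda>x. x \<noteq> 0) (at z)" by (rule eventually_neq_at_within)
      then have ev: "eventually (\<lambda>x. sphere_inv (Some x) = Some (inverse x)) (at z)"
        by eventually_elim simp
      show "limitin riemann_sphere (\<lambda>z. sphere_inv (Some z)) (sphere_inv (Some z)) (at z)"
      proof (cases "z = 0")
        case True
        then show ?thesis using limitin_cong_eventually[OF ev limitin_None] filterlim_inverse_at_infinity by simp
      next
        case False
        then show ?thesis using limitin_cong_eventually[OF ev limitin_Some[of inverse "inverse z"]]
          by (simp add: tendsto_inverse)
      qed
    qed
    have ev: "eventually (\<lambda>x. sphere_inv (Some x) = Some (inverse x)) at_infinity"
      unfolding eventually_at_infinity
      by (intro exI[of _ 1]) (metis norm_zero not_one_le_zero sphere_inv_simps(3))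
    show "limitin riemann_sphere (\<lambda>z. sphere_inv (Some z)) (sphere_inv None) at_infinity"
      using limitin_cong_eventually[OF ev limitin_Some[OF tendsto_inverse_0]] by simp
  qed
  then show ?thesis by (intro homeomorphic_map_sphereI) auto
qed

text \<open>Inverse stereographic projection.\<close>

definition stereo :: "complex option \<Rightarrow> nat \<Rightarrow> real" where
  "stereo x = (\<lambda>i. case x of None \<Rightarrow> (if i = 2 then 1 else 0)
     | Some z \<Rightarrow> (if i = 0 then 2 * Re z / (1 + (norm z)\<^sup>2) else if i = 1 then 2 * Im z / (1 + (norm z)\<^sup>2)
         else if i = 2 then ((norm z)\<^sup>2 - 1) / (1 + (norm z)\<^sup>2) else 0))"

text \<open>A continuous bijection from a compact space onto a Hausdorff space is a homeomorphism,
  so the continuity of the inverse never has to be checked.\<close>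

lemma homeomorphic_map_stereo: "homeomorphic_map riemann_sphere (nsphere 2) stereo"
proof (rule continuous_imp_homeomorphic_map)
  have pos: "1 + (norm z)\<^sup>2 > 0" for z :: complex by (simp add: add_pos_nonneg)
  have nz: "1 + (norm z)\<^sup>2 \<noteq> 0" for z :: complex using pos[of z] by linarith
  have top: "topspace (nsphere 2) = {x. x 0 ^ 2 + x 1 ^ 2 + x 2 ^ 2 = 1 \<and> (\<forall>i>2. x i = 0)}"
    by (simp add: nsphere numeral_2_eq_2 add.assoc)
  have im: "stereo x \<in> topspace (nsphere 2)" for x
  proof (cases x)
    case (Some z)
    have "(2 * Re z)^2 + (2 * Im z)^2 + ((norm z)\<^sup>2 - 1)^2 = (1 + (norm z)\<^sup>2)^2"
      unfolding cmod_power2 by (simp add: power2_eq_square algebra_simps)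
    then show ?thesis unfolding top using nz[of z]
      by (simp add: stereo_def Some power_divide flip: add_divide_distrib)
  qed (simp add: top stereo_def)
  show "compact_space riemann_sphere" by (rule compact_riemann_sphere)
  show "Hausdorff_space (nsphere 2)"
    by (simp add: nsphere Hausdorff_space_subtopology Hausdorff_space_product_topology Hausdorff_space_euclidean)
  have comp: "continuous_map riemann_sphere euclideanreal (\<lambda>x. stereo x k)" for k
  proof (rule continuous_map_from_sphere)
    have "continuous_on UNIV (\<lambda>z. stereo (Some z) k)"
      using nz unfolding stereo_def by (cases "k = 0"; cases "k = 1"; cases "k = 2") (auto intro!: continuous_intros)
    then show "continuous_map euclidean euclideanreal (\<lambda>z. stereo (Some z) k)" by simp
    have n: "filterlim (\<lambda>z::complex. norm z) at_top at_infinity" by (rule filterlim_norm_at_top)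
    have 1: "((\<lambda>z::complex. 2 * norm z / (1 + (norm z)\<^sup>2)) \<longlongrightarrow> 0) at_infinity"
    proof -
      have "((\<lambda>x::real. 2 * x / (1 + x\<^sup>2)) \<longlongrightarrow> 0) at_top" by real_asymp
      then show ?thesis using n by (rule filterlim_compose)
    qed
    have 2: "((\<lambda>z::complex. ((norm z)\<^sup>2 - 1) / (1 + (norm z)\<^sup>2)) \<longlongrightarrow> 1) at_infinity"
    proof -
      have "((\<lambda>x::real. (x\<^sup>2 - 1) / (1 + x\<^sup>2)) \<longlongrightarrow> 1) at_top" by real_asymp
      then show ?thesis using n by (rule filterlim_compose)
    qed
    have 3: "((\<lambda>z. 2 * Re z / (1 + (norm z)\<^sup>2)) \<longlongrightarrow> 0) at_infinity"
      by (rule Lim_null_comparison[OF _ 1])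
        (use pos in \<open>auto intro!: always_eventually divide_right_mono simp: abs_mult abs_Re_le_cmod less_imp_le\<close>)
    have 4: "((\<lambda>z. 2 * Im z / (1 + (norm z)\<^sup>2)) \<longlongrightarrow> 0) at_infinity"
      by (rule Lim_null_comparison[OF _ 1])
        (use pos in \<open>auto intro!: always_eventually divide_right_mono simp: abs_mult abs_Im_le_cmod less_imp_le\<close>)
    show "limitin euclideanreal (\<lambda>z. stereo (Some z) k) (stereo None k) at_infinity"
      using 2 3 4 by (cases "k = 0"; cases "k = 1"; cases "k = 2") (auto simp: stereo_def)
  qed
  show "continuous_map riemann_sphere (nsphere 2) stereo"
    unfolding nsphere continuous_map_in_subtopology continuous_map_componentwise_UNIV
    using comp im[unfolded nsphere] by auto
  have inj: "x = y" if "stereo x = stereo y" for x y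
  proof -
    \<comment> \<open>The pole \<open>stereo None\<close> is the only point with last coordinate 1;
      elsewhere the projection from this pole divides by \<open>1 - stereo x 2\<close>.\<close>
    have recover: "x = (if stereo x 2 = 1 then None else Some (Complex (stereo x 0 / (1 - stereo x 2)) (stereo x 1 / (1 - stereo x 2))))" for x
    proof (cases x)
      case (Some z)
      have "1 - stereo x 2 = 2 / (1 + (norm z)\<^sup>2)" using nz[of z] by (simp add: stereo_def Some field_simps)
      moreover from this have "stereo x 2 \<noteq> 1" using nz[of z] by auto
      ultimately show ?thesis using nz[of z] by (simp add: stereo_def Some)
    qed (simp add: stereo_def)
    show ?thesis by (rule trans[OF recover[of x, unfolded that] recover[of y, symmetric]])
  qed
  then show "inj_on stereo (topspace riemann_sphere)" by (auto simp: inj_on_def)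
  have "x \<in> range stereo" if x: "x \<in> topspace (nsphere 2)" for x
  proof (cases "x 2 = 1")
    case True
    then have "x 0 = 0" "x 1 = 0" using x by (auto simp: top add_nonneg_eq_0_iff)
    then have "x i = stereo None i" for i
      using x True by (cases "i = 0"; cases "i = 1"; cases "i = 2") (auto simp: stereo_def top)
    then show ?thesis by (metis ext rangeI)
  next
    case False
    define z where "z = Complex (x 0 / (1 - x 2)) (x 1 / (1 - x 2))"
    have n: "(norm z)\<^sup>2 = (1 + x 2) / (1 - x 2)"
    proof -
      have "(norm z)\<^sup>2 = (x 0 ^ 2 + x 1 ^ 2) / (1 - x 2)^2"
        by (simp add: z_def cmod_power2 power_divide add_divide_distrib)
      also have "x 0 ^ 2 + x 1 ^ 2 = (1 + x 2) * (1 - x 2)" using x by (simp add: top power2_eq_square algebra_simps)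
      finally show ?thesis using False by (simp add: power2_eq_square)
    qed
    then have n1: "1 + (norm z)\<^sup>2 = 2 / (1 - x 2)" "(norm z)\<^sup>2 - 1 = 2 * x 2 / (1 - x 2)"
      using False by (simp_all add: field_simps)
    have "x i = stereo (Some z) i" for i
      using x False n1 by (cases "i = 0"; cases "i = 1"; cases "i = 2") (auto simp: stereo_def top z_def)
    then show ?thesis by (metis ext rangeI)
  qed
  then show "stereo ` topspace riemann_sphere = topspace (nsphere 2)" using im by auto
qed

section \<open>Degrees of homeomorphisms of the sphere\<close>

definition sphere_degree :: "(complex option \<Rightarrow> complex option) \<Rightarrow> int" where
  "sphere_degree \<phi> = Brouwer_degree2 2 (stereo \<circ> \<phi> \<circ> inv_into UNIV stereo)"

text \<open>Off the unit sphere \<open>inv_into\<close> is arbitrary, but on it it coincides with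
  the inverse supplied by the homeomorphism, and only these values enter the degree.\<close>

lemma stereo_maps: "homeomorphic_maps riemann_sphere (nsphere 2) stereo (inv_into UNIV stereo)"
proof -
  have "inj stereo" using homeomorphic_map_stereo homeomorphic_imp_injective_map by fastforce
  obtain k where k: "homeomorphic_maps riemann_sphere (nsphere 2) stereo k"
    using homeomorphic_map_stereo homeomorphic_map_maps by blast
  then have "k y = inv_into UNIV stereo y" if "y \<in> topspace (nsphere 2)" for y
    using that \<open>inj stereo\<close> unfolding homeomorphic_maps_def by (metis inv_f_f)
  then show ?thesis using homeomorphic_maps_eq[OF k] by auto
qed

lemma inv_stereo [simp]: "inv_into UNIV stereo (stereo x) = x"
  using stereo_maps by (simp add: homeomorphic_maps_def)

lemma Homeo_plus_sphereI:
  assumes "homeomorphic_map riemann_sphere riemann_sphere \<phi>" "sphere_degree \<phi> = 1"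
  shows "\<phi> \<in> Homeo_plus_sphere"
  using assms stereo_maps unfolding Homeo_plus_sphere_def sphere_degree_def by blast

lemma sphere_degree_id: "sphere_degree id = 1"
proof -
  have "Brouwer_degree2 2 (stereo \<circ> id \<circ> inv_into UNIV stereo) = Brouwer_degree2 2 id"
    by (rule Brouwer_degree2_eq) (use stereo_maps in \<open>auto simp: homeomorphic_maps_def\<close>)
  then show ?thesis by (simp add: sphere_degree_def)
qed

lemma sphere_degree_homeo:
  assumes "homeomorphic_map riemann_sphere riemann_sphere \<phi>"
  shows "homeomorphic_map (nsphere 2) (nsphere 2) (stereo \<circ> \<phi> \<circ> inv_into UNIV stereo)"
  using assms stereo_maps homeomorphic_map_compose homeomorphic_map_maps homeomorphic_maps_sym by metis

lemma sphere_degree_comp: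
  assumes "homeomorphic_map riemann_sphere riemann_sphere \<phi>" "homeomorphic_map riemann_sphere riemann_sphere \<psi>"
  shows "sphere_degree (\<phi> \<circ> \<psi>) = sphere_degree \<phi> * sphere_degree \<psi>"
proof -
  have eq: "stereo \<circ> (\<phi> \<circ> \<psi>) \<circ> inv_into UNIV stereo = (stereo \<circ> \<phi> \<circ> inv_into UNIV stereo) \<circ> (stereo \<circ> \<psi> \<circ> inv_into UNIV stereo)"
    by (auto simp: fun_eq_iff)
  show ?thesis
    unfolding sphere_degree_def eq
    by (rule Brouwer_degree2_compose) (use sphere_degree_homeo assms homeomorphic_imp_continuous_map in blast)+
qed

lemma sphere_degree_square:
  assumes "homeomorphic_map riemann_sphere riemann_sphere \<phi>"
  shows "sphere_degree \<phi> * sphere_degree \<phi> = 1"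
proof -
  have "\<bar>sphere_degree \<phi>\<bar> = 1"
    unfolding sphere_degree_def by (rule Brouwer_degree2_homeomorphic_map[OF sphere_degree_homeo[OF assms]])
  then show ?thesis by (auto simp: abs_if split: if_splits)
qed

definition affine_map :: "complex \<Rightarrow> complex \<Rightarrow> complex option \<Rightarrow> complex option" where
  "affine_map a b = map_option (\<lambda>z. a * z + b)"

lemma homeomorphism_affine:
  assumes "a \<noteq> 0" shows "homeomorphism UNIV UNIV (\<lambda>z::complex. a * z + b) (\<lambda>z. (z - b) / a)"
proof (rule homeomorphismI)
  show "continuous_on UNIV (\<lambda>z. (z - b) / a)" using assms by (intro continuous_intros) auto
qed (use assms in \<open>auto intro!: continuous_intros\<close>)

lemma homeomorphic_affine_map: "a \<noteq> 0 \<Longrightarrow> homeomorphic_map riemann_sphere riemann_sphere (affine_map a b)"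
  unfolding affine_map_def by (rule homeomorphic_map_option[OF homeomorphism_affine])

text \<open>A homeomorphism has degree 1 or -1, so a composition square has degree 1. Scaling by
  \<open>a\<close> is the square of scaling by a root of \<open>a\<close>, and translation by
  \<open>b\<close> is the square of translation by \<open>b/2\<close>; no homotopy to the identity
  is needed.\<close>

lemma sphere_degree_affine:
  assumes "a \<noteq> 0" shows "sphere_degree (affine_map a b) = 1"
proof -
  have sq: "sphere_degree (\<phi> \<circ> \<phi>) = 1" if "homeomorphic_map riemann_sphere riemann_sphere \<phi>" for \<phi>
    using sphere_degree_comp[OF that that] sphere_degree_square[OF that] by simp
  have "affine_map a 0 = affine_map (csqrt a) 0 \<circ> affine_map (csqrt a) 0"
    by (rule ext, rename_tac x, case_tac x)
      (auto simp: affine_map_def mult.assoc[symmetric] simp flip: power2_eq_square)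
  then have 1: "sphere_degree (affine_map a 0) = 1" using sq[OF homeomorphic_affine_map] assms by simp
  have "affine_map 1 b = affine_map 1 (b/2) \<circ> affine_map 1 (b/2)"
    by (rule ext, rename_tac x, case_tac x) (auto simp: affine_map_def)
  then have 2: "sphere_degree (affine_map 1 b) = 1" using sq[OF homeomorphic_affine_map] by simp
  have "affine_map a b = affine_map 1 b \<circ> affine_map a 0"
    by (rule ext, rename_tac x, case_tac x) (auto simp: affine_map_def)
  then show ?thesis
    using sphere_degree_comp[OF homeomorphic_affine_map homeomorphic_affine_map, of 1 a b 0] 1 2 assms by simp
qed

text \<open>With \<open>\<iota> z = 1 / z\<close> and \<open>T z = z + 1\<close>, the map \<open>T \<circ> (\<iota> \<circ> T\<inverse> \<circ> \<iota>) \<circ> T\<close> is \<open>z \<mapsto> - 1 / z\<close>.\<close>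

lemma sphere_degree_inv: "sphere_degree sphere_inv = 1"
proof -
  let ?T = "affine_map 1 1" and ?T' = "affine_map 1 (-1)" and ?N = "affine_map (-1) 0"
  note h = homeomorphic_affine_map[of 1] homeomorphic_affine_map[of "-1"] homeomorphic_map_sphere_inv
  have eq: "sphere_inv = ?N \<circ> (?T \<circ> ((sphere_inv \<circ> (?T' \<circ> sphere_inv)) \<circ> ?T))"
  proof
    fix x show "sphere_inv x = (?N \<circ> (?T \<circ> ((sphere_inv \<circ> (?T' \<circ> sphere_inv)) \<circ> ?T))) x"
    proof (cases x)
      case None
      have "sphere_inv (Some (- 1)) = Some (- 1)" by simp
      then show ?thesis using None by (simp add: affine_map_def del: sphere_inv_simps(3))
    next
      case (Some z)
      consider "z = 0" | "z = -1" | "z \<noteq> 0" "z \<noteq> -1" by blast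
      then show ?thesis
      proof cases
        case 3
        then have nz: "z + 1 \<noteq> 0" by (metis add_eq_0_iff add.commute)
        have e: "inverse (z + 1) - 1 = - z / (z + 1)" using nz by (simp add: field_simps)
        have "inverse (z + 1) + - 1 \<noteq> 0" using e 3 nz by simp
        moreover have "- (inverse (inverse (z + 1) + - 1) + 1) = inverse z"
          using e 3 nz by (simp add: field_simps)
        ultimately show ?thesis using Some 3 nz by (simp add: affine_map_def)
      qed (auto simp: Some affine_map_def)
    qed
  qed
  \<comment> \<open>The inversion occurs twice in this conjugate, so its still unknown sign
    cancels.\<close>
  have 1: "sphere_degree (sphere_inv \<circ> (?T' \<circ> sphere_inv)) = 1"
    using sphere_degree_comp[OF h(3) homeomorphic_map_compose[OF h(3) h(1)]] sphere_degree_comp[OF h(1) h(3)]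
      sphere_degree_affine sphere_degree_square[OF h(3)] by simp
  have h4: "homeomorphic_map riemann_sphere riemann_sphere (sphere_inv \<circ> (?T' \<circ> sphere_inv))"
    using h homeomorphic_map_compose by (metis zero_neq_one)
  have 2: "sphere_degree ((sphere_inv \<circ> (?T' \<circ> sphere_inv)) \<circ> ?T) = 1"
    using sphere_degree_comp[OF h4 h(1)] 1 sphere_degree_affine by simp
  have h5: "homeomorphic_map riemann_sphere riemann_sphere ((sphere_inv \<circ> (?T' \<circ> sphere_inv)) \<circ> ?T)"
    by (rule homeomorphic_map_compose[OF h(1) h4]) simp
  have 3: "sphere_degree (?T \<circ> ((sphere_inv \<circ> (?T' \<circ> sphere_inv)) \<circ> ?T)) = 1"
    using sphere_degree_comp[OF h(1) h5] 2 sphere_degree_affine by simp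
  have h6: "homeomorphic_map riemann_sphere riemann_sphere (?T \<circ> ((sphere_inv \<circ> (?T' \<circ> sphere_inv)) \<circ> ?T))"
    by (rule homeomorphic_map_compose[OF h5 h(1)]) simp
  show ?thesis
    by (subst eq) (use sphere_degree_comp[OF h(2) h6] 3 sphere_degree_affine in simp)
qed

section \<open>Transcendental meromorphic maps and Picard's theorem\<close>

definition sphere_map :: "(complex \<Rightarrow> complex) \<Rightarrow> complex \<Rightarrow> complex option" where
  "sphere_map f z = (if is_pole f z then None else Some (f z))"

lemma meromorphic_map_iff: "meromorphic_map g \<longleftrightarrow> (\<exists>f. f nicely_meromorphic_on UNIV \<and> g = sphere_map f)"
  unfolding meromorphic_map_def sphere_map_def by (auto simp: fun_eq_iff)

lemma nicely_meromorphic_pole_0: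
  assumes "f nicely_meromorphic_on UNIV" "is_pole f z" shows "f z = 0"
proof (rule ccontr)
  assume "f z \<noteq> 0"
  then have "f \<midarrow>z\<rightarrow> f z" using assms(1) unfolding nicely_meromorphic_on_def by blast
  then show False using assms(2) not_tendsto_and_filterlim_at_infinity[of "at z"] unfolding is_pole_def by auto
qed

lemma nicely_meromorphic_tendsto:
  assumes "f nicely_meromorphic_on UNIV" "\<not> is_pole f z" shows "f \<midarrow>z\<rightarrow> f z"
  using assms unfolding nicely_meromorphic_on_def by blast

lemma eventually_not_pole:
  assumes "f nicely_meromorphic_on UNIV" shows "eventually (\<lambda>x. \<not> is_pole f x) (at z)"
proof -
  have "f meromorphic_on UNIV" using assms by (simp add: nicely_meromorphic_on_def)
  then show ?thesis
    by (rule eventually_cosparse_imp_eventually_at[OF meromorphic_on_imp_not_pole_cosparse]) simp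
qed

lemma continuous_map_sphere_map:
  assumes f: "f nicely_meromorphic_on UNIV"
  shows "continuous_map euclidean riemann_sphere (sphere_map f)"
  unfolding continuous_map_euclidean_limitin
proof
  fix z
  have ev: "eventually (\<lambda>x. sphere_map f x = Some (f x)) (at z)"
    using eventually_not_pole[OF f, of z] by eventually_elim (simp add: sphere_map_def)
  show "limitin riemann_sphere (sphere_map f) (sphere_map f z) (at z)"
  proof (cases "is_pole f z")
    case True
    then show ?thesis using limitin_cong_eventually[OF ev limitin_None[OF True[unfolded is_pole_def]]]
      by (simp add: sphere_map_def[of f z])
  next
    case False
    then show ?thesis using limitin_cong_eventually[OF ev limitin_Some[OF nicely_meromorphic_tendsto[OF f False]]]
      by (simp add: sphere_map_def[of f z])
  qed
qed

text \<open>A formula such as \<open>a * f z + b\<close> or \<open>inverse (f z)\<close> can have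
  wrong values at isolated points, for instance at poles of \<open>f\<close>, where \<open>f\<close>
  is 0. It suffices to know its limits: \<open>remove_sings\<close> corrects the values.\<close>

lemma meromorphic_mapI:
  assumes f: "f meromorphic_on UNIV"
    and g: "\<And>z. (is_pole f z \<and> g z = None) \<or> (\<exists>l. f \<midarrow>z\<rightarrow> l \<and> g z = Some l)"
  shows "meromorphic_map g"
proof -
  have "g = sphere_map (remove_sings f)"
  proof
    fix z
    have iso: "isolated_singularity_at f z" using f by (simp add: meromorphic_on_altdef)
    show "g z = sphere_map (remove_sings f) z"
      using g[of z]
    proof
      assume "is_pole f z \<and> g z = None"
      then show ?thesis using iso by (simp add: sphere_map_def is_pole_remove_sings_iff)
    next
      assume "\<exists>l. f \<midarrow>z\<rightarrow> l \<and> g z = Some l"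
      then obtain l where l: "f \<midarrow>z\<rightarrow> l" "g z = Some l" by blast
      then have "\<not> is_pole f z"
        using not_tendsto_and_filterlim_at_infinity[of "at z"] unfolding is_pole_def by auto
      then show ?thesis using iso l remove_sings_eqI[OF l(1)] by (simp add: sphere_map_def is_pole_remove_sings_iff)
    qed
  qed
  then show ?thesis using remove_sings_nicely_meromorphic[OF f] meromorphic_map_iff by blast
qed

lemma not_pole_of_bounded:
  fixes f :: "complex \<Rightarrow> complex"
  assumes "\<And>x. norm x > R \<Longrightarrow> norm (f x) \<le> C" "norm z > R"
  shows "\<not> is_pole f z"
proof
  assume "is_pole f z"
  then have "\<forall>r>0. eventually (\<lambda>x. r \<le> norm (f x)) (at z)"
    by (simp add: is_pole_def filterlim_at_infinity[of 0, simplified])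
  moreover have "\<bar>C\<bar> + 1 > 0" by simp
  ultimately have "eventually (\<lambda>x. \<bar>C\<bar> + 1 \<le> norm (f x)) (at z)" by blast
  moreover have "eventually (\<lambda>x. x \<in> {x. norm x > R}) (at z)"
    by (rule eventually_at_in_open') (use assms(2) in \<open>auto intro: open_Collect_less continuous_intros\<close>)
  ultimately have "eventually (\<lambda>x. False) (at z)"
    by eventually_elim (use assms(1) in force)
  then show False by simp
qed

text \<open>A finite limit bounds \<open>f\<close> far out, which leaves no room for poles there;
  hence \<open>sphere_map f\<close> is eventually \<open>Some\<close> of \<open>f\<close>.\<close>

lemma limitin_sphere_map_Some:
  assumes f: "f nicely_meromorphic_on UNIV" and l: "(f \<longlongrightarrow> l) at_infinity"
  shows "limitin riemann_sphere (sphere_map f) (Some l) at_infinity"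
proof (rule limitin_cong_eventually[OF _ limitin_Some[OF l]])
  have "eventually (\<lambda>z. dist (f z) l < 1) at_infinity" using l by (rule tendstoD) simp
  then obtain B where B: "\<And>z. norm z \<ge> B \<Longrightarrow> dist (f z) l < 1" by (auto simp: eventually_at_infinity)
  have "norm (f x) \<le> norm l + 1" if "norm x > B" for x
    using B[of x] that norm_triangle_ineq2[of "f x" l] by (simp add: dist_norm)
  then have "\<not> is_pole f z" if "norm z > B" for z using not_pole_of_bounded that by blast
  then show "eventually (\<lambda>x. sphere_map f x = Some (f x)) at_infinity"
    unfolding eventually_at_infinity sphere_map_def by (intro exI[of _ "B + 1"]) auto
qed

lemma limitin_sphere_map_None:
  assumes f: "f nicely_meromorphic_on UNIV" and l: "filterlim f at_infinity at_infinity"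
  shows "limitin riemann_sphere (sphere_map f) None at_infinity"
proof (rule limitin_cong_eventually[OF _ limitin_None[OF l]])
  \<comment> \<open>At a pole the value of \<open>f\<close> is 0, so this bound excludes
    poles.\<close>
  have "eventually (\<lambda>z. 1 \<le> norm (f z)) at_infinity"
    using l by (auto simp: filterlim_at_infinity[of 0, simplified])
  then show "eventually (\<lambda>x. sphere_map f x = Some (f x)) at_infinity"
    by eventually_elim (use nicely_meromorphic_pole_0[OF f] in \<open>force simp: sphere_map_def\<close>)
qed

lemma transcendental_iff:
  "transcendental_meromorphic g \<longleftrightarrow> meromorphic_map g \<and> (\<forall>l. \<not> limitin riemann_sphere g l at_infinity)"
  by (auto simp: transcendental_meromorphic_def)

lemma transcendental_sphere_mapE:
  assumes "transcendental_meromorphic g"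
  obtains f where "f nicely_meromorphic_on UNIV" "g = sphere_map f"
    "\<And>l. \<not> (f \<longlongrightarrow> l) at_infinity" "\<not> filterlim f at_infinity at_infinity"
proof -
  obtain f where f: "f nicely_meromorphic_on UNIV" "g = sphere_map f"
    using assms by (auto simp: transcendental_iff meromorphic_map_iff)
  then show thesis using that[OF f] assms limitin_sphere_map_Some[OF f(1)] limitin_sphere_map_None[OF f(1)]
    unfolding transcendental_iff by blast
qed

lemma transcendental_nonconstant:
  assumes "f nicely_meromorphic_on UNIV" "\<And>l. \<not> (f \<longlongrightarrow> l) at_infinity"
  shows "eventually (\<lambda>x. f x \<noteq> c) (at z)"
proof -
  have "\<not> (\<forall>x\<in>UNIV. f x = c)"
  proof
    assume "\<forall>x\<in>UNIV. f x = c"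
    then have "f = (\<lambda>_. c)" by auto
    then have "(f \<longlongrightarrow> c) at_infinity" by simp
    then show False using assms(2) by blast
  qed
  then have "\<forall>\<^sub>\<approx>x\<in>UNIV. f x \<noteq> c"
    using nicely_meromorphic_imp_constant_or_avoid[OF assms(1), of c] by auto
  then show ?thesis by (rule eventually_cosparse_imp_eventually_at) simp
qed

section \<open>Moebius transformations acting on transcendental maps\<close>

lemma transcendental_comp:
  assumes g: "transcendental_meromorphic g" and \<phi>: "homeomorphic_map riemann_sphere riemann_sphere \<phi>"
    and m: "meromorphic_map (\<phi> \<circ> g)"
  shows "transcendental_meromorphic (\<phi> \<circ> g)"
  unfolding transcendental_iff
proof (intro conjI allI notI)
  fix l assume l: "limitin riemann_sphere (\<phi> \<circ> g) l at_infinity"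
  obtain \<psi> where \<psi>: "continuous_map riemann_sphere riemann_sphere \<psi>" "\<And>x. \<psi> (\<phi> x) = x"
    using \<phi> by (auto simp: homeomorphic_map_maps homeomorphic_maps_def)
  have "limitin riemann_sphere (\<psi> \<circ> (\<phi> \<circ> g)) (\<psi> l) at_infinity"
    by (rule continuous_map_limit[OF \<psi>(1) l])
  moreover have "\<psi> \<circ> (\<phi> \<circ> g) = g" using \<psi>(2) by auto
  ultimately show False using g by (auto simp: transcendental_iff)
qed (rule m)

text \<open>All that is needed of Moebius transformations: they generate orientation-preserving sphere
  homeomorphisms that preserve transcendental meromorphic maps.\<close>

definition conformal_maps :: "(complex option \<Rightarrow> complex option) set" where
  "conformal_maps = {\<phi>. homeomorphic_map riemann_sphere riemann_sphere \<phi> \<and> sphere_degree \<phi> = 1 \<and>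
     (\<forall>g. transcendental_meromorphic g \<longrightarrow> transcendental_meromorphic (\<phi> \<circ> g))}"

lemma conformal_maps_comp:
  assumes "\<phi> \<in> conformal_maps" "\<psi> \<in> conformal_maps" shows "\<phi> \<circ> \<psi> \<in> conformal_maps"
  unfolding conformal_maps_def
proof (intro CollectI conjI allI impI)
  show "homeomorphic_map riemann_sphere riemann_sphere (\<phi> \<circ> \<psi>)"
    by (rule homeomorphic_map_compose) (use assms in \<open>auto simp: conformal_maps_def\<close>)
  show "sphere_degree (\<phi> \<circ> \<psi>) = 1"
    using assms by (subst sphere_degree_comp) (auto simp: conformal_maps_def)
  fix g assume "transcendental_meromorphic g"
  then have "transcendental_meromorphic (\<phi> \<circ> (\<psi> \<circ> g))" using assms by (auto simp: conformal_maps_def)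
  then show "transcendental_meromorphic (\<phi> \<circ> \<psi> \<circ> g)" by (simp add: comp_assoc)
qed

lemma affine_map_conformal:
  assumes a: "a \<noteq> 0" shows "affine_map a b \<in> conformal_maps"
  unfolding conformal_maps_def
proof (intro CollectI conjI allI impI)
  show h: "homeomorphic_map riemann_sphere riemann_sphere (affine_map a b)" by (rule homeomorphic_affine_map[OF a])
  show "sphere_degree (affine_map a b) = 1" by (rule sphere_degree_affine[OF a])
  fix g assume g: "transcendental_meromorphic g"
  then obtain f where f: "f nicely_meromorphic_on UNIV" "g = sphere_map f"
    by (auto simp: transcendental_iff meromorphic_map_iff)
  have "meromorphic_map (affine_map a b \<circ> g)"
  proof (rule meromorphic_mapI)
    show "(\<lambda>z. a * f z + b) meromorphic_on UNIV"
      using f(1) by (auto simp: nicely_meromorphic_on_def intro!: meromorphic_intros)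
    fix z
    show "(is_pole (\<lambda>z. a * f z + b) z \<and> (affine_map a b \<circ> g) z = None) \<or>
        (\<exists>l. (\<lambda>z. a * f z + b) \<midarrow>z\<rightarrow> l \<and> (affine_map a b \<circ> g) z = Some l)"
    proof (cases "is_pole f z")
      case True
      then have "is_pole (\<lambda>z. a * f z + b) z"
        unfolding is_pole_def using a
        by (intro tendsto_add_filterlim_at_infinity'[where c=b] tendsto_mult_filterlim_at_infinity[where c=a]) auto
      then show ?thesis using True f(2) by (simp add: sphere_map_def affine_map_def)
    next
      case False
      have "(\<lambda>z. a * f z + b) \<midarrow>z\<rightarrow> a * f z + b"
        by (intro tendsto_intros nicely_meromorphic_tendsto[OF f(1) False])
      then show ?thesis using False f(2) by (auto simp: sphere_map_def affine_map_def)
    qed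
  qed
  then show "transcendental_meromorphic (affine_map a b \<circ> g)" by (rule transcendental_comp[OF g h])
qed

lemma sphere_inv_conformal: "sphere_inv \<in> conformal_maps"
  unfolding conformal_maps_def
proof (intro CollectI conjI allI impI)
  show h: "homeomorphic_map riemann_sphere riemann_sphere sphere_inv" by (rule homeomorphic_map_sphere_inv)
  show "sphere_degree sphere_inv = 1" by (rule sphere_degree_inv)
  fix g assume g: "transcendental_meromorphic g"
  then obtain f where f: "f nicely_meromorphic_on UNIV" "g = sphere_map f" and nl: "\<And>l. \<not> (f \<longlongrightarrow> l) at_infinity"
    using transcendental_sphere_mapE[OF g] by metis
  have "meromorphic_map (sphere_inv \<circ> g)"
  proof (rule meromorphic_mapI)
    show "(\<lambda>z. inverse (f z)) meromorphic_on UNIV"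
      using f(1) by (auto simp: nicely_meromorphic_on_def intro!: meromorphic_intros)
    fix z
    show "(is_pole (\<lambda>z. inverse (f z)) z \<and> (sphere_inv \<circ> g) z = None) \<or>
        (\<exists>l. (\<lambda>z. inverse (f z)) \<midarrow>z\<rightarrow> l \<and> (sphere_inv \<circ> g) z = Some l)"
    proof (cases "is_pole f z")
      case True
      then have "(\<lambda>z. inverse (f z)) \<midarrow>z\<rightarrow> 0"
        unfolding is_pole_def by (rule filterlim_compose[OF tendsto_inverse_0])
      then show ?thesis using True f(2) by (auto simp: sphere_map_def)
    next
      case False
      note t = nicely_meromorphic_tendsto[OF f(1) False]
      show ?thesis
      proof (cases "f z = 0")
        case True
        \<comment> \<open>A zero of \<open>f\<close> becomes a pole, provided that it is isolated;
          this is where \<open>f\<close> has to be non-constant.\<close>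
        have "is_pole (\<lambda>z. inverse (f z)) z"
          unfolding is_pole_def
          by (rule filterlim_compose[OF filterlim_inverse_at_infinity])
            (use t True transcendental_nonconstant[OF f(1) nl, of 0 z] in \<open>auto simp: filterlim_at\<close>)
        then show ?thesis using True False f(2) by (simp add: sphere_map_def)
      next
        case nz: False
        have "(\<lambda>z. inverse (f z)) \<midarrow>z\<rightarrow> inverse (f z)" by (intro tendsto_inverse t nz)
        then show ?thesis using False nz f(2) by (auto simp: sphere_map_def)
      qed
    qed
  qed
  then show "transcendental_meromorphic (sphere_inv \<circ> g)" by (rule transcendental_comp[OF g h])
qed

text \<open>An inversion centred at \<open>c\<close> moves \<open>c\<close> to \<infinity>; affine
  maps fix \<infinity> and are transitive on ordered pairs of distinct finite points.\<close>

lemma conformal_map_triple: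
  assumes "a \<noteq> b" "a \<noteq> c" "b \<noteq> c"
  obtains \<phi> where "\<phi> \<in> conformal_maps" "\<phi> a = Some 1" "\<phi> b = Some 0" "\<phi> c = None"
proof -
  have fin: "\<exists>\<phi>\<in>conformal_maps. \<phi> (Some x) = Some 1 \<and> \<phi> (Some y) = Some 0 \<and> \<phi> None = None"
    if "x \<noteq> y" for x y :: complex
  proof (rule bexI[OF _ affine_map_conformal])
    show "affine_map (1 / (x - y)) (- y / (x - y)) (Some x) = Some 1 \<and>
        affine_map (1 / (x - y)) (- y / (x - y)) (Some y) = Some 0 \<and>
        affine_map (1 / (x - y)) (- y / (x - y)) None = None"
      using that by (auto simp: affine_map_def simp flip: diff_divide_distrib)
  qed (use that in auto)
  show thesis
  proof (cases c)
    case None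
    then obtain x y where "a = Some x" "b = Some y" using assms by (cases a; cases b) auto
    then show thesis using fin[of x y] that assms None by auto
  next
    case (Some w)
    define \<psi> where "\<psi> = sphere_inv \<circ> affine_map 1 (- w)"
    have \<psi>: "\<psi> \<in> conformal_maps"
      unfolding \<psi>_def by (intro conformal_maps_comp sphere_inv_conformal affine_map_conformal) simp
    then have inj: "\<psi> u = \<psi> v \<longleftrightarrow> u = v" for u v
      using homeomorphic_imp_injective_map[of riemann_sphere riemann_sphere \<psi>] by (auto simp: conformal_maps_def inj_on_def)
    have c: "\<psi> c = None" by (simp add: \<psi>_def Some affine_map_def)
    then obtain x y where xy: "\<psi> a = Some x" "\<psi> b = Some y" using assms inj by (metis option.exhaust)
    then have "x \<noteq> y" using inj assms by (metis)
    then obtain \<phi> where "\<phi> \<in> conformal_maps" "\<phi> (Some x) = Some 1" "\<phi> (Some y) = Some 0" "\<phi> None = None"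
      using fin by blast
    then show thesis using that[of "\<phi> \<circ> \<psi>"] conformal_maps_comp[OF _ \<psi>] xy c by simp
  qed
qed

section \<open>Picard's theorem for maps to the sphere\<close>

lemma eventually_at_infinity_inverse:
  "eventually (\<lambda>z::complex. P z) at_infinity \<longleftrightarrow> eventually (\<lambda>z. P (inverse z)) (at 0)"
  by (metis (no_types, lifting) at_to_infinity eventually_filtermap eventually_mono inverse_inverse_eq)

lemma filterlim_at_infinity_inverse:
  fixes f :: "complex \<Rightarrow> 'a"
  shows "filterlim f F at_infinity \<longleftrightarrow> filterlim (\<lambda>z. f (inverse z)) F (at 0)"
  unfolding filterlim_iff by (subst eventually_at_infinity_inverse) simp

text \<open>If all three fibres were finite, \<open>f\<close> would be holomorphic and omit 0 and 1
  outside some disc. In the coordinate \<open>1 / z\<close> the great Picard theorem yields a limit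
  of \<open>F\<close> or of its reciprocal, hence a limit of \<open>f\<close>, finite or infinite,
  at \<infinity>.\<close>

lemma transcendental_infinite_preimage_01:
  assumes g: "transcendental_meromorphic g"
  shows "infinite (g -` {None}) \<or> infinite (g -` {Some 0}) \<or> infinite (g -` {Some 1})"
proof (rule ccontr)
  assume "\<not> ?thesis"
  then have fin: "finite (g -` {None} \<union> g -` {Some 0} \<union> g -` {Some 1})" by simp
  obtain f where f: "f nicely_meromorphic_on UNIV" "g = sphere_map f"
    and nl: "\<And>l. \<not> (f \<longlongrightarrow> l) at_infinity" "\<not> filterlim f at_infinity at_infinity"
    using transcendental_sphere_mapE[OF g] by metis
  obtain B where B: "\<And>z. z \<in> g -` {None} \<union> g -` {Some 0} \<union> g -` {Some 1} \<Longrightarrow> norm z \<le> B"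
    using finite_imp_bounded[OF fin] bounded_iff by metis
  define R where "R = max B 1"
  have R: "R > 0" by (simp add: R_def)
  have out: "\<not> is_pole f z \<and> f z \<noteq> 0 \<and> f z \<noteq> 1" if "norm z > R" for z
  proof -
    have "\<not> norm z \<le> B" using that by (simp add: R_def)
    then have "z \<notin> g -` {None} \<union> g -` {Some 0} \<union> g -` {Some 1}" using B by blast
    then show ?thesis by (cases "is_pole f z") (auto simp: f(2) sphere_map_def)
  qed
  have nz: "norm (inverse w) > R" if "w \<in> ball 0 (1 / R) - {0}" for w :: complex
  proof -
    have "norm w > 0" "norm w < 1 / R" using that by auto
    then have "R < inverse (norm w)" using R by (simp add: field_simps)
    then show ?thesis by (simp add: norm_inverse)
  qed
  define F where "F = (\<lambda>w. f (inverse w))"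
  have "F analytic_on {w}" if "w \<in> ball 0 (1 / R) - {0}" for w
  proof -
    have "f analytic_on {inverse w}" using nicely_meromorphic_on_imp_analytic_at[OF f(1)] out[OF nz[OF that]] by simp
    moreover have "inverse analytic_on {w}" using that by (auto intro!: analytic_intros)
    ultimately have "f \<circ> inverse analytic_on {w}" by (intro analytic_on_compose) auto
    then show ?thesis by (simp add: F_def o_def)
  qed
  then have hol: "F holomorphic_on ball 0 (1 / R) - {0}"
    by (meson analytic_imp_holomorphic analytic_on_analytic_at)
  have ne: "F w \<noteq> 0 \<and> F w \<noteq> 1" if "w \<in> ball 0 (1 / R) - {0}" for w
    using out[OF nz[OF that]] by (simp add: F_def)
  obtain l where "(F \<longlongrightarrow> l) (at 0) \<or> ((inverse \<circ> F) \<longlongrightarrow> l) (at 0)"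
    by (rule great_Picard[of "ball 0 (1/R)" 0 0 1 F]) (use hol ne R in auto)
  then have 2: "((inverse \<circ> F) \<longlongrightarrow> l) (at 0)"
    using nl(1) by (auto simp: F_def filterlim_at_infinity_inverse)
  have evne: "eventually (\<lambda>w. F w \<noteq> 0) (at 0)"
    using eventually_at_in_open[of "ball 0 (1/R)" 0] R ne by (auto elim!: eventually_mono)
  show False
  proof (cases "l = 0")
    case False
    have "((\<lambda>w. inverse ((inverse \<circ> F) w)) \<longlongrightarrow> inverse l) (at 0)" by (intro tendsto_inverse 2 False)
    then show False using nl(1) by (auto simp: F_def filterlim_at_infinity_inverse o_def)
  next
    case True
    have "filterlim (\<lambda>w. inverse ((inverse \<circ> F) w)) at_infinity (at 0)"
      by (rule filterlim_compose[OF filterlim_inverse_at_infinity])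
        (use 2 True evne in \<open>auto simp: filterlim_at o_def\<close>)
    then show False using nl(2) by (auto simp: F_def filterlim_at_infinity_inverse o_def)
  qed
qed

lemma transcendental_infinite_preimage:
  assumes g: "transcendental_meromorphic g" and abc: "a \<noteq> b" "a \<noteq> c" "b \<noteq> c"
  shows "infinite (g -` {a}) \<or> infinite (g -` {b}) \<or> infinite (g -` {c})"
proof -
  obtain \<phi> where \<phi>: "\<phi> \<in> conformal_maps" "\<phi> a = Some 1" "\<phi> b = Some 0" "\<phi> c = None"
    using conformal_map_triple[OF abc] by metis
  then have "transcendental_meromorphic (\<phi> \<circ> g)" using g by (auto simp: conformal_maps_def)
  moreover have "inj \<phi>" using \<phi>(1) homeomorphic_imp_injective_map[of riemann_sphere riemann_sphere \<phi>]
    by (auto simp: conformal_maps_def)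
  then have "(\<phi> \<circ> g) -` {\<phi> x} = g -` {x}" for x by (auto simp: inj_def)
  ultimately show ?thesis
    using transcendental_infinite_preimage_01[of "\<phi> \<circ> g"] \<phi> by metis
qed

lemma finite_exceptional_values:
  assumes g: "transcendental_meromorphic g"
  shows "finite {v. finite (g -` {v})}"
proof (rule ccontr)
  assume "infinite {v. finite (g -` {v})}"
  then obtain T where T: "T \<subseteq> {v. finite (g -` {v})}" "card T = 3"
    using infinite_arbitrarily_large[of "{v. finite (g -` {v})}" 3] by blast
  then obtain a b c where "T = {a, b, c}" "a \<noteq> b" "a \<noteq> c" "b \<noteq> c" by (auto simp: card_3_iff)
  then show False using transcendental_infinite_preimage[OF g, of a b c] T(1) by auto
qed

text \<open>This makes Picard's theorem available for \<open>(z - p) * f z\<close>. A finite limit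
  of the product would force \<open>f\<close> to tend to 0. If the product tends to \<infinity>, its
  reciprocal is bounded near \<infinity>, hence meromorphic there, and then \<open>f\<close> has no
  essential singularity either. The point \<open>p\<close> itself is left out of the second claim
  because a pole of \<open>f\<close> at \<open>p\<close> may be cancelled.\<close>

lemma transcendental_mult_linear:
  assumes f: "f nicely_meromorphic_on UNIV" "transcendental_meromorphic (sphere_map f)"
  obtains h where "transcendental_meromorphic (sphere_map h)"
    "\<And>z v. z \<noteq> p \<Longrightarrow> sphere_map h z = Some v \<Longrightarrow> \<not> is_pole f z \<and> (z - p) * f z = v"
proof -
  have nl: "\<not> (f \<longlongrightarrow> l) at_infinity" "\<not> filterlim f at_infinity at_infinity" for l
    using f(2) limitin_sphere_map_Some[OF f(1)] limitin_sphere_map_None[OF f(1)]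
    unfolding transcendental_iff by blast+
  \<comment> \<open>If \<open>f\<close> has a simple pole at \<open>p\<close>, the factor removes
    it, and the value there has to be corrected.\<close>
  define h where "h = remove_sings (\<lambda>z. (z - p) * f z)"
  have mer: "(\<lambda>z. (z - p) * f z) meromorphic_on UNIV"
    using f(1) by (auto simp: nicely_meromorphic_on_def intro!: meromorphic_intros)
  then have h: "h nicely_meromorphic_on UNIV" unfolding h_def by (rule remove_sings_nicely_meromorphic)
  have pole: "is_pole h z \<longleftrightarrow> is_pole (\<lambda>z. (z - p) * f z) z" for z
    using mer unfolding h_def by (intro is_pole_remove_sings_iff) (simp add: meromorphic_on_altdef)
  have p1: "is_pole h z" if "is_pole f z" "z \<noteq> p" for z
    unfolding pole unfolding is_pole_def
  proof (rule tendsto_mult_filterlim_at_infinity)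
    show "((\<lambda>z. z - p) \<longlongrightarrow> z - p) (at z)" by (intro tendsto_intros)
  qed (use that in \<open>auto simp: is_pole_def\<close>)
  have p2: "\<not> is_pole h z \<and> h z = (z - p) * f z" if "\<not> is_pole f z" for z
  proof -
    have l: "((\<lambda>z. (z - p) * f z) \<longlongrightarrow> (z - p) * f z) (at z)"
      by (intro tendsto_intros nicely_meromorphic_tendsto[OF f(1) that])
    then have "\<not> is_pole h z"
      unfolding pole unfolding is_pole_def using not_tendsto_and_filterlim_at_infinity[of "at z"] by auto
    then show ?thesis using remove_sings_eqI[OF l] by (simp add: h_def)
  qed
  have h_eq: "h z = (z - p) * f z" if "z \<noteq> p" for z
  proof (cases "is_pole f z")
    case True
    then show ?thesis using nicely_meromorphic_pole_0[OF f(1)] nicely_meromorphic_pole_0[OF h p1] that by simp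
  qed (use p2 in simp)
  have evp: "eventually (\<lambda>z::complex. z \<noteq> p) at_infinity"
    unfolding eventually_at_infinity by (intro exI[of _ "norm p + 1"]) auto
  have "\<not> limitin riemann_sphere (sphere_map h) l at_infinity" for l
  proof
    assume l: "limitin riemann_sphere (sphere_map h) l at_infinity"
    show False
    proof (cases l)
      case (Some c)
      have "openin riemann_sphere (range Some)" by (simp add: riemann_sphere_def)
      then have "eventually (\<lambda>z. sphere_map h z \<in> range Some) at_infinity"
        using l Some unfolding limitin_def by blast
      then have "eventually (\<lambda>z. Some (h z) = sphere_map h z) at_infinity"
        by (rule eventually_mono) (auto simp: sphere_map_def split: if_splits)
      then have "limitin riemann_sphere (\<lambda>z. Some (h z)) (Some c) at_infinity"
        using limitin_cong_eventually[OF _ l[unfolded Some]] by simp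
      then have hc: "(h \<longlongrightarrow> c) at_infinity" by (rule limitin_SomeD)
      have "filterlim (\<lambda>z. z - p) at_infinity at_infinity"
        using tendsto_add_filterlim_at_infinity'[OF filterlim_ident tendsto_const, of "-p"] by simp
      then have "((\<lambda>z. h z / (z - p)) \<longlongrightarrow> 0) at_infinity" by (rule tendsto_divide_0[OF hc])
      moreover have "eventually (\<lambda>z. h z / (z - p) = f z) at_infinity"
        using evp by eventually_elim (simp add: h_eq)
      ultimately have "(f \<longlongrightarrow> 0) at_infinity" by (rule Lim_transform_eventually)
      then show False using nl by blast
    next
      case None
      \<comment> \<open>A priori poles of \<open>h\<close> may accumulate at \<infinity>. The
        reciprocal is harmless: at a pole \<open>h\<close> has the value 0, and so has its
        inverse.\<close>
      have small: "eventually (\<lambda>z. norm (inverse (h z)) < e) at_infinity" if "e > 0" for e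
      proof -
        have "openin riemann_sphere (- (Some ` cball 0 (1/e)))"
          unfolding openin_riemann_sphere
        proof
          have "Some -` (- (Some ` cball 0 (1/e))) = - cball (0::complex) (1/e)" by auto
          then show "open (Some -` (- (Some ` cball (0::complex) (1/e))))" by (simp only: open_Compl closed_cball)
          show "None \<in> - (Some ` cball 0 (1/e)) \<longrightarrow> eventually (\<lambda>z. Some z \<in> - (Some ` cball (0::complex) (1/e))) at_infinity"
            unfolding eventually_at_infinity by (intro impI exI[of _ "1/e + 1"]) auto
        qed
        then have "eventually (\<lambda>z. sphere_map h z \<in> - (Some ` cball 0 (1/e))) at_infinity"
          using l None unfolding limitin_def by blast
        then show ?thesis
        proof eventually_elim
          case (elim z)
          show ?case
          proof (cases "is_pole h z")
            case True then show ?thesis using nicely_meromorphic_pole_0[OF h True] that by simp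
          next
            case False
            then have "1 / e < norm (h z)" using elim by (auto simp: sphere_map_def image_iff)
            then have "inverse (norm (h z)) < inverse (1 / e)" using that by (intro less_imp_inverse_less) auto
            then show ?thesis by (simp add: norm_inverse)
          qed
        qed
      qed
      define \<kappa> where "\<kappa> = (\<lambda>w. inverse (h (inverse w)))"
      have "((\<lambda>z. inverse (h z)) \<longlongrightarrow> 0) at_infinity" using small by (simp add: tendsto_iff)
      then have k0: "\<kappa> \<midarrow>0\<rightarrow> 0" by (simp add: filterlim_at_infinity_inverse \<kappa>_def)
      obtain B where B: "\<And>z. norm z \<ge> B \<Longrightarrow> norm (inverse (h z)) < 1"
        using small[of 1] by (auto simp: eventually_at_infinity)
      define R where "R = max B 1"
      have R: "R > 0" by (simp add: R_def)
      have np: "\<not> is_pole (\<lambda>z. inverse (h z)) z" if "norm z > R" for z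
      proof (rule not_pole_of_bounded[OF _ that])
        show "norm (inverse (h x)) \<le> 1" if "norm x > R" for x
          using B[of x] that by (simp add: R_def)
      qed
      have an: "\<kappa> analytic_on {w}" if w: "w \<in> ball 0 (1 / R) - {0}" for w
      proof -
        have "norm w > 0" "norm w < 1 / R" using w by auto
        then have "R < inverse (norm w)" using R by (simp add: field_simps)
        then have "norm (inverse w) > R" by (simp add: norm_inverse)
        then have "(\<lambda>z. inverse (h z)) analytic_on {inverse w}"
          using nicely_meromorphic_on_imp_analytic_at[OF nicely_meromorphic_on_inverse[OF h]] np by simp
        moreover have "inverse analytic_on {w}" using w by (auto intro!: analytic_intros)
        ultimately have "(\<lambda>z. inverse (h z)) \<circ> inverse analytic_on {w}" by (intro analytic_on_compose) auto
        then show ?thesis by (simp add: \<kappa>_def o_def)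
      qed
      then have "\<kappa> analytic_on ball 0 (1 / R) - {0}" by (subst analytic_on_analytic_at) auto
      then have "isolated_singularity_at \<kappa> 0" unfolding isolated_singularity_at_def
        using R by (intro exI[of _ "1 / R"]) auto
      then have "\<kappa> meromorphic_on {0}" using k0 by (auto simp: meromorphic_at_iff not_essential_def)
      then have m: "(\<lambda>w. inverse (\<kappa> w) / (inverse w - p)) meromorphic_on {0}"
        by (intro meromorphic_intros)
      have "eventually (\<lambda>z. h z / (z - p) = f z) at_infinity"
        using evp by eventually_elim (simp add: h_eq)
      then have eq: "eventually (\<lambda>w. inverse (\<kappa> w) / (inverse w - p) = f (inverse w)) (at 0)"
        by (simp add: eventually_at_infinity_inverse \<kappa>_def)
      have "not_essential (\<lambda>w. f (inverse w)) 0"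
        using m not_essential_cong[OF eq refl] by (simp add: meromorphic_at_iff)
      then show False using nl
        by (auto simp: not_essential_def is_pole_def filterlim_at_infinity_inverse)
    qed
  qed
  then have "transcendental_meromorphic (sphere_map h)"
    using h by (auto simp: transcendental_iff meromorphic_map_iff)
  moreover have "\<not> is_pole f z \<and> (z - p) * f z = v" if "z \<noteq> p" "sphere_map h z = Some v" for z v
    using p1[of z] h_eq[of z] that by (auto simp: sphere_map_def split: if_splits)
  ultimately show thesis using that by blast
qed

section \<open>Straightening homeomorphisms of the twice punctured plane\<close>

text \<open>The possible values are multiples of \<open>2 * pi * \<i>\<close>, a discrete set.
  Applied to differences, this says that two continuous logarithms of one function on a connected
  set differ by a constant.\<close>

lemma const_of_exp_eq_1:
  fixes f :: "'a::real_normed_vector \<Rightarrow> complex"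
  assumes "continuous_on S f" "connected S" "\<And>x. x \<in> S \<Longrightarrow> exp (f x) = 1" "x \<in> S" "y \<in> S"
  shows "f x = f y"
proof -
  have "f constant_on S"
  proof (rule continuous_discrete_range_constant[OF assms(2,1)])
    fix x assume x: "x \<in> S"
    show "\<exists>e>0. \<forall>y. y \<in> S \<and> f y \<noteq> f x \<longrightarrow> e \<le> norm (f y - f x)"
    proof (intro exI[of _ "2*pi"] conjI allI impI)
      fix y assume y: "y \<in> S \<and> f y \<noteq> f x"
      have "exp (f y) = exp (f x)" using assms(3) x y by simp
      then obtain n :: int where n: "f y = f x + (of_int (2 * n) * pi) * \<i>"
        by (auto simp: exp_eq)
      with y have "n \<noteq> 0" by auto
      then have "1 \<le> \<bar>real_of_int n\<bar>" by linarith
      have "norm (f y - f x) = \<bar>real_of_int n\<bar> * (2*pi)"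
        using n by (simp add: norm_mult)
      also have "\<dots> \<ge> 1 * (2*pi)"
        by (rule mult_right_mono) (use \<open>1 \<le> \<bar>real_of_int n\<bar>\<close> in auto)
      finally show "2*pi \<le> norm (f y - f x)" by simp
    qed simp
  qed
  then show ?thesis using assms(4,5) by (auto simp: constant_on_def)
qed

text \<open>A function with period \<open>2 * pi * \<i>\<close> descends along \<open>exp\<close> to
  the punctured plane. The cut of \<open>Ln\<close> does no harm: near \<open>w\<close> periodicity
  allows the continuous branch \<open>Ln (z/w) + Ln w\<close> instead.\<close>

lemma continuous_of_exp:
  fixes v :: "complex \<Rightarrow> complex"
  assumes v: "continuous_on UNIV v" and per: "\<And>x. v (x + 2*pi*\<i>) = v x"
  shows "continuous_on (-{0}) (\<lambda>w. v (Ln w))" "\<And>x. v (Ln (exp x)) = v x"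
proof -
  have pern: "v (x + (2 * of_nat n * pi) * \<i>) = v x" for x and n :: nat
  proof (induction n)
    case (Suc n)
    have "v (x + (2 * of_nat (Suc n) * pi) * \<i>) = v ((x + (2 * of_nat n * pi) * \<i>) + 2*pi*\<i>)"
      by (simp add: algebra_simps)
    then show ?case using per Suc by simp
  qed simp
  have peri: "v (x + (2 * of_int n * pi) * \<i>) = v x" for x and n :: int
  proof (cases n rule: int_cases2)
    case (nonneg k) then show ?thesis using pern[of x k] by simp
  next
    case (nonpos k)
    then show ?thesis using pern[of "x - (2 * of_nat k * pi) * \<i>" k] by (simp add: algebra_simps)
  qed
  have eq: "v x = v y" if "exp x = exp y" for x y
    using that peri by (fastforce simp: exp_eq)
  then show "v (Ln (exp x)) = v x" for x by (intro eq) simp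
  show "continuous_on (-{0}) (\<lambda>w. v (Ln w))"
  proof (rule continuous_at_imp_continuous_on, intro ballI)
    fix w :: complex assume "w \<in> -{0}"
    then have w: "w \<noteq> 0" by simp
    have iv: "isCont v x" for x using v by (simp add: continuous_on_eq_continuous_at)
    have 1: "isCont (\<lambda>z. Ln (z/w) + Ln w) w"
      using w by (intro continuous_intros) auto
    have "isCont (\<lambda>z. v (Ln (z/w) + Ln w)) w"
      by (rule isCont_o2[OF 1 iv])
    moreover have "eventually (\<lambda>z. v (Ln (z/w) + Ln w) = v (Ln z)) (nhds w)"
    proof -
      have "eventually (\<lambda>z. z \<in> -{0}) (nhds w)"
        by (rule eventually_nhds_in_open) (use w in auto)
      then show ?thesis
        by eventually_elim (use w in \<open>auto intro!: eq simp: exp_add\<close>)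
    qed
    ultimately show "isCont (\<lambda>w. v (Ln w)) w"
      by (simp add: isCont_cong)
  qed
qed

text \<open>Lifting \<open>\<eta>\<close> and its inverse through \<open>exp\<close> gives
  \<open>L\<close> and \<open>L'\<close>, which turn a shift by one period into a shift by
  \<open>m\<close> and \<open>m'\<close> periods. Since \<open>L'\<close> after \<open>L\<close> is
  a translation, \<open>m' * m = 1\<close>, so \<open>m\<close> is 1 or -1; this sign is the
  orientation. Subtracting \<open>x\<close> or \<open>cnj x\<close> from \<open>L x\<close> then
  leaves a periodic function, the logarithm \<open>u\<close>.\<close>

lemma plane_homeomorphism_log:
  fixes \<eta> :: "complex \<Rightarrow> complex"
  assumes hom: "homeomorphism UNIV UNIV \<eta> \<eta>'" and "\<eta> 0 = 0" "\<eta> 1 = 1"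
  obtains u where "continuous_on (-{0}) u" "u 1 = 0"
     "(\<forall>w. w \<noteq> 0 \<longrightarrow> \<eta> w = w * exp (u w)) \<or> (\<forall>w. w \<noteq> 0 \<longrightarrow> \<eta> w = cnj w * exp (u w))"
proof -
  have inv: "\<eta>' (\<eta> x) = x" "\<eta> (\<eta>' x) = x" and c: "continuous_on UNIV \<eta>" "continuous_on UNIV \<eta>'" for x
    using hom by (auto simp: homeomorphism_def)
  have z': "\<eta>' 0 = 0" using inv(1)[of 0] assms by simp
  have nz: "\<eta> x \<noteq> 0" "\<eta>' x \<noteq> 0" if "x \<noteq> 0" for x
    using inv[of x] that assms z' by metis+
  let ?T = "complex_of_real (2*pi) * \<i>"
  have logex: "\<exists>L m. continuous_on UNIV L \<and> (\<forall>x. exp (L x) = f (exp x)) \<and> (\<forall>x. L (x + ?T) = L x + of_int m * ?T)"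
    if f: "continuous_on UNIV f" "\<And>x. x \<noteq> 0 \<Longrightarrow> f x \<noteq> 0" for f :: "complex \<Rightarrow> complex"
  proof -
    have cf: "continuous_on UNIV (\<lambda>x. f (exp x))"
      by (intro continuous_on_compose2[OF f(1)] continuous_intros) auto
    obtain L where L: "continuous_on UNIV L" "\<And>x. f (exp x) = exp (L x)"
      using continuous_logarithm_on_contractible[OF cf contractible_UNIV] f(2) by auto
    have eT: "exp ?T = 1" by (simp add: exp_eq_1)
    have e1: "exp (L (x + ?T) - L x) = 1" for x
      using f(2)[of "exp x"] by (simp add: exp_diff exp_add eT flip: L(2))
    have k: "L (x + ?T) - L x = L (0 + ?T) - L 0" for x
      by (rule const_of_exp_eq_1[where S=UNIV])
        (use e1 in \<open>auto intro!: continuous_intros continuous_on_compose2[OF L(1)]\<close>)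
    have "exp (L (0 + ?T)) = exp (L 0)" using e1[of 0] by (simp add: exp_diff)
    then obtain m :: int where "L (0 + ?T) = L 0 + (of_int (2 * m) * pi) * \<i>"
      by (auto simp: exp_eq)
    then have "L (0 + ?T) - L 0 = of_int m * ?T" by simp
    then have "L (x + ?T) = L x + of_int m * ?T" for x using k[of x] by (simp add: algebra_simps)
    then show ?thesis using L by (intro exI[of _ L] exI[of _ m]) auto
  qed
  obtain L m where L: "continuous_on UNIV L" "\<And>x. exp (L x) = \<eta> (exp x)" "\<And>x. L (x + ?T) = L x + of_int m * ?T"
    using logex[OF c(1) nz(1)] by blast
  obtain L' m' where L': "continuous_on UNIV L'" "\<And>x. exp (L' x) = \<eta>' (exp x)" "\<And>x. L' (x + ?T) = L' x + of_int m' * ?T"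
    using logex[OF c(2) nz(2)] by blast
  have L'i: "L' (x + of_int n * ?T) = L' x + of_int (m' * n) * ?T" for x and n :: int
  proof -
    have nat: "L' (x + of_nat n * ?T) = L' x + of_int m' * of_nat n * ?T" for x n
    proof (induction n)
      case (Suc n)
      have e: "x + of_nat (Suc n) * ?T = (x + of_nat n * ?T) + ?T"
        by (simp add: algebra_simps)
      show ?case unfolding e L'(3) Suc by (simp add: algebra_simps)
    qed simp
    show ?thesis
    proof (cases n rule: int_cases2)
      case (nonneg k) then show ?thesis using nat[of x k] by simp
    next
      case (nonpos k)
      then show ?thesis using nat[of "x - of_nat k * ?T" k] by simp
    qed
  qed
  have e1: "exp (L' (L x) - x) = 1" for x
    by (simp add: exp_diff L'(2) L(2) inv)
  have k: "L' (L x) - x = L' (L 0) - 0" for x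
    by (rule const_of_exp_eq_1[where S=UNIV])
      (use e1 in \<open>auto intro!: continuous_intros continuous_on_compose2[OF L(1)] continuous_on_compose2[OF L'(1)]\<close>)
  have "L' (L ?T) - ?T = L' (L 0)" using k[of ?T] by simp
  moreover have "L' (L ?T) = L' (L 0) + of_int (m' * m) * ?T"
    using L(3)[of 0] L'i[of "L 0" m] by simp
  ultimately have "of_int (m' * m) * ?T = ?T" by (metis add_diff_cancel_left' add_diff_eq diff_add_cancel diff_eq_eq)
  then have "(of_int (m' * m) :: complex) = 1"
    by (subst (asm) mult_cancel_right2) simp
  then have "m' * m = 1" by (simp only: of_int_eq_1_iff)
  then have m: "m = 1 \<or> m = -1" by (metis mult.commute zmult_eq_1_iff)
  have e0: "exp (L 0) = 1" using L(2)[of 0] assms by simp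
  show thesis
    using m
  proof
    assume m: "m = 1"
    \<comment> \<open>As \<open>exp (L 0) = 1\<close>, subtracting \<open>L 0\<close> changes no
      exponential and achieves \<open>u 1 = 0\<close>.\<close>
    define v where "v = (\<lambda>x. L x - L 0 - x)"
    have v: "continuous_on UNIV v" "\<And>x. v (x + ?T) = v x"
      unfolding v_def using L m by (auto intro!: continuous_intros)
    show thesis
    proof (rule that[of "\<lambda>w. v (Ln w)"])
      show "continuous_on (-{0}) (\<lambda>w. v (Ln w))" by (rule continuous_of_exp(1)[OF v])
      show "v (Ln 1) = 0" by (simp add: v_def)
      show "(\<forall>w. w \<noteq> 0 \<longrightarrow> \<eta> w = w * exp (v (Ln w))) \<or> (\<forall>w. w \<noteq> 0 \<longrightarrow> \<eta> w = cnj w * exp (v (Ln w)))"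
        by (auto simp: v_def exp_diff L assms)
    qed
  next
    assume m: "m = -1"
    define v where "v = (\<lambda>x. L x - L 0 - cnj x)"
    have v: "continuous_on UNIV v" "\<And>x. v (x + ?T) = v x"
      unfolding v_def using L m by (auto intro!: continuous_intros)
    show thesis
    proof (rule that[of "\<lambda>w. v (Ln w)"])
      show "continuous_on (-{0}) (\<lambda>w. v (Ln w))" by (rule continuous_of_exp(1)[OF v])
      show "v (Ln 1) = 0" by (simp add: v_def)
      show "(\<forall>w. w \<noteq> 0 \<longrightarrow> \<eta> w = w * exp (v (Ln w))) \<or> (\<forall>w. w \<noteq> 0 \<longrightarrow> \<eta> w = cnj w * exp (v (Ln w)))"
        by (auto simp: v_def exp_diff L assms exp_cnj[symmetric])
    qed
  qed
qed

text \<open>All the maps \<open>w \<mapsto> \<eta> (z * w) / \<eta> z\<close> fix 0 and 1. Moving \<open>z\<close> along the unit circle to the point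
  where \<open>norm (\<eta> z)\<close> is least produces a map that sends the exterior of the unit disc into
  itself. There the straight homotopy to the identity in logarithmic coordinates works, once the
  summand \<open>norm (w - 1)\<close> pushes it away from 1.\<close>

lemma unwinding_homotopy:
  fixes \<eta> :: "complex \<Rightarrow> complex"
  assumes hom: "homeomorphism (-{0}) (-{0}) \<eta> \<eta>'"
    and small: "\<And>c. c > 0 \<Longrightarrow> \<exists>w. w \<noteq> 0 \<and> norm w < 1 \<and> norm (\<eta> w) < c"
    and u: "continuous_on (-{0}) u" "u 1 = 0" "\<And>w. w \<noteq> 0 \<Longrightarrow> \<eta> w = w * exp (u w)"
  obtains V :: "real \<times> complex \<Rightarrow> complex" where
    "continuous_on ({0..1} \<times> (-{0})) V" "\<And>w. V (0, w) = u w" "\<And>w. V (1, w) = 0"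
    "\<And>r. r \<in> {0..1} \<Longrightarrow> V (r, 1) = 0"
    "\<And>r w. r \<in> {0..1} \<Longrightarrow> norm w \<ge> 1 \<Longrightarrow> w \<noteq> 1 \<Longrightarrow> w * exp (V (r, w)) \<noteq> 1"
proof -
  have inv: "x \<noteq> 0 \<Longrightarrow> \<eta>' (\<eta> x) = x" "x \<noteq> 0 \<Longrightarrow> \<eta> (\<eta>' x) = x"
    and c: "continuous_on (-{0}) \<eta>" "continuous_on (-{0}) \<eta>'"
    and nz: "x \<noteq> 0 \<Longrightarrow> \<eta> x \<noteq> 0" "x \<noteq> 0 \<Longrightarrow> \<eta>' x \<noteq> 0" for x
    using hom by (auto simp: homeomorphism_def)
  have "\<exists>z\<in>sphere 0 1. \<forall>y\<in>sphere 0 1. norm (\<eta> z) \<le> norm (\<eta> y)"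
    by (rule continuous_attains_inf) (auto intro!: continuous_intros continuous_on_subset[OF c(1)])
  then obtain z0 where z0: "norm z0 = 1" and zmin: "\<And>y. norm y = 1 \<Longrightarrow> norm (\<eta> z0) \<le> norm (\<eta> y)"
    by auto
  have [simp]: "z0 \<noteq> 0" using z0 by auto
  \<comment> \<open>Otherwise the preimage of the punctured ball of radius
    \<open>norm (\<eta> z0)\<close> is a connected set that contains \<open>y\<close> as well as a
    point of the open unit disc supplied by \<open>small\<close>. It meets the unit circle, at a
    point where \<open>norm (\<eta> x)\<close> is below the minimum.\<close>
  have out: "norm (\<eta> z0) \<le> norm (\<eta> y)" if y: "norm y \<ge> 1" for y
  proof (rule ccontr)
    assume "\<not> norm (\<eta> z0) \<le> norm (\<eta> y)"
    then have yl: "norm (\<eta> y) < norm (\<eta> z0)" by simp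
    have [simp]: "y \<noteq> 0" using y by auto
    obtain w where w: "w \<noteq> 0" "norm w < 1" "norm (\<eta> w) < norm (\<eta> z0)"
      using small[of "norm (\<eta> z0)"] nz(1)[of z0] by auto
    define B where "B = ball (0::complex) (norm (\<eta> z0)) - {0}"
    have "connected B"
      unfolding B_def by (intro connected_punctured_ball) simp
    then have cB: "connected (\<eta>' ` B)"
      by (rule connected_continuous_image[rotated]) (auto simp: B_def intro!: continuous_on_subset[OF c(2)])
    have "y \<in> \<eta>' ` B" "w \<in> \<eta>' ` B"
      using inv(1)[of y] inv(1)[of w] yl w nz(1)[of y] nz(1)[of w]
      by (auto simp: B_def intro!: image_eqI[of y \<eta>' "\<eta> y"] image_eqI[of w \<eta>' "\<eta> w"])
    then have "\<exists>x \<in> \<eta>' ` B. norm x = 1"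
    proof -
      have cn: "connected (norm ` \<eta>' ` B)" by (intro connected_continuous_image cB continuous_intros)
      have "1 \<in> norm ` \<eta>' ` B"
        by (rule connectedD_interval[OF cn imageI[OF \<open>w \<in> \<eta>' ` B\<close>] imageI[OF \<open>y \<in> \<eta>' ` B\<close>]]) (use w y in auto)
      then show ?thesis by (smt (verit) imageE)
    qed
    then obtain b where b: "b \<in> B" "norm (\<eta>' b) = 1" by auto
    then have "norm (\<eta> z0) \<le> norm (\<eta> (\<eta>' b))" using zmin by auto
    then show False using b by (auto simp: B_def inv)
  qed
  obtain \<tau> where \<tau>: "z0 = cis \<tau>" using z0 by (metis complex_norm_eq_1_exp cis_conv_exp)
  \<comment> \<open>Up to time 1/2 the point \<open>e r\<close> walks along the circle from 1 to
    \<open>z0\<close> while \<open>b r\<close> stays 0; afterwards \<open>e r\<close> rests and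
    \<open>b r\<close> grows from 0 to 1. The factor \<open>b r * (1 - b r)\<close> switches the
    push off at both ends of the second phase, and \<open>u (e r)\<close> is subtracted to keep 1
    fixed.\<close>
  define e where "e r = cis (\<tau> * min 1 (2*r))" for r :: real
  define b where "b r = max 0 (2*r - 1)" for r :: real
  define V where "V = (\<lambda>(r, w). of_real (1 - b r) * (u (e r * w) - u (e r)) + of_real (b r * (1 - b r) * norm (w - 1)))"
  have e: "e r \<noteq> 0" "norm (e r) = 1" for r by (auto simp: e_def)
  show thesis
  proof (rule that[of V])
    show "continuous_on ({0..1} \<times> (-{0})) V"
      unfolding V_def case_prod_unfold b_def e_def
      by (intro continuous_intros continuous_on_compose2[OF u(1)]) auto
    show "V (0, w) = u w" for w by (simp add: V_def b_def e_def u)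
    show "V (1, w) = 0" for w by (simp add: V_def b_def)
    show "V (r, 1) = 0" for r by (simp add: V_def)
    fix r :: real and w :: complex assume r: "r \<in> {0..1}" and w: "norm w \<ge> 1" "w \<noteq> 1"
    then have [simp]: "w \<noteq> 0" by auto
    have eq: "\<eta> (e r * w) / \<eta> (e r) = w * exp (u (e r * w) - u (e r))"
      using u(3)[of "e r * w"] u(3)[of "e r"] e[of r] by (simp add: exp_diff)
    show "w * exp (V (r, w)) \<noteq> 1"
    proof (cases "b r = 0")
      case True
      have "e r * w \<noteq> e r" using w e by auto
      then have "\<eta> (e r * w) \<noteq> \<eta> (e r)"
        using inv(1)[of "e r * w"] inv(1)[of "e r"] e[of r] by auto
      then show ?thesis using True eq nz(1)[of "e r"] e[of r] by (auto simp: V_def)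
    next
      case False
      then have r2: "r > 1/2" and b0: "b r > 0" "b r \<le> 1" using r by (auto simp: b_def)
      then have er: "e r = z0" by (simp add: e_def \<tau>)
      show ?thesis
      proof (cases "b r = 1")
        case True then show ?thesis using w by (simp add: V_def)
      next
        case False
        define x where "x = Re (u (z0 * w) - u z0)"
        have "norm w * exp x = norm (\<eta> (z0 * w)) / norm (\<eta> z0)"
          using arg_cong[OF eq, of norm] by (simp add: er norm_mult norm_divide x_def)
        also have "\<dots> \<ge> 1"
          using out[of "z0 * w"] w z0 nz(1)[of z0] by (auto simp: norm_mult field_simps)
        finally have "exp (ln (norm w) + x) \<ge> 1" by (simp add: exp_add)
        then have 1: "ln (norm w) + x \<ge> 0" by simp
        have 2: "ln (norm w) \<ge> 0" using w by simp
        \<comment> \<open>The logarithm of the modulus is a weighted mean of two nonnegative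
          numbers, belonging to the identity and to the rotated map, plus the strictly positive
          push.\<close>
        have "ln (norm w) + Re (V (r, w)) =
           b r * ln (norm w) + (1 - b r) * (ln (norm w) + x) + b r * (1 - b r) * norm (w - 1)"
          by (simp add: V_def er x_def algebra_simps)
        moreover have "b r * (1 - b r) * norm (w - 1) > 0" using b0 False w by simp
        moreover have "b r * ln (norm w) \<ge> 0" "(1 - b r) * (ln (norm w) + x) \<ge> 0"
          using b0 1 2 by auto
        ultimately have "exp (ln (norm w) + Re (V (r, w))) > 1" by (simp only: one_less_exp_iff)
        then have "norm (w * exp (V (r, w))) > 1" by (simp add: norm_mult exp_add)
        then show ?thesis by auto
      qed
    qed
  qed
qed

text \<open>The same for the interior of the disc, by conjugation with \<open>w \<mapsto> 1 / w\<close>.\<close>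

lemma unwinding_homotopy_inner:
  fixes \<eta> :: "complex \<Rightarrow> complex"
  assumes hom: "homeomorphism (-{0}) (-{0}) \<eta> \<eta>'"
    and large: "\<And>c. \<exists>w. norm w > 1 \<and> norm (\<eta> w) > c"
    and u: "continuous_on (-{0}) u" "u 1 = 0" "\<And>w. w \<noteq> 0 \<Longrightarrow> \<eta> w = w * exp (u w)"
  obtains V :: "real \<times> complex \<Rightarrow> complex" where
    "continuous_on ({0..1} \<times> (-{0})) V" "\<And>w. V (0, w) = u w" "\<And>w. V (1, w) = 0"
    "\<And>r. r \<in> {0..1} \<Longrightarrow> V (r, 1) = 0"
    "\<And>r w. r \<in> {0..1} \<Longrightarrow> w \<noteq> 0 \<Longrightarrow> norm w \<le> 1 \<Longrightarrow> w \<noteq> 1 \<Longrightarrow> w * exp (V (r, w)) \<noteq> 1"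
proof -
  have inv: "x \<noteq> 0 \<Longrightarrow> \<eta>' (\<eta> x) = x" "x \<noteq> 0 \<Longrightarrow> \<eta> (\<eta>' x) = x"
    and c: "continuous_on (-{0}) \<eta>" "continuous_on (-{0}) \<eta>'"
    and nz: "x \<noteq> 0 \<Longrightarrow> \<eta> x \<noteq> 0" "x \<noteq> 0 \<Longrightarrow> \<eta>' x \<noteq> 0" for x
    using hom by (auto simp: homeomorphism_def)
  have nzi: "\<eta> (inverse w) = 0 \<Longrightarrow> w = 0" "\<eta>' (inverse w) = 0 \<Longrightarrow> w = 0" for w
    using nz[of "inverse w"] by auto
  have "homeomorphism (-{0}) (-{0}) (\<lambda>w. inverse (\<eta> (inverse w))) (\<lambda>w. inverse (\<eta>' (inverse w)))"
  proof (rule homeomorphismI)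
    show "continuous_on (-{0}) (\<lambda>w. inverse (\<eta> (inverse w)))"
      by (intro continuous_on_inverse continuous_on_compose2[OF c(1)] continuous_on_id) (auto dest: nzi)
    show "continuous_on (-{0}) (\<lambda>w. inverse (\<eta>' (inverse w)))"
      by (intro continuous_on_inverse continuous_on_compose2[OF c(2)] continuous_on_id) (auto dest: nzi)
  qed (auto dest: nzi simp: inv(1)[OF nonzero_imp_inverse_nonzero] inv(2)[OF nonzero_imp_inverse_nonzero])
  moreover have "\<exists>w. w \<noteq> 0 \<and> norm w < 1 \<and> norm (inverse (\<eta> (inverse w))) < c" if "c > 0" for c
  proof -
    obtain w where w: "norm w > 1" "norm (\<eta> w) > inverse c" using large[of "inverse c"] by blast
    then have "w \<noteq> 0" by auto
    have "norm (inverse (\<eta> w)) < c"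
      using less_imp_inverse_less[OF w(2)] that by (simp add: norm_inverse)
    then show ?thesis
      using w \<open>w \<noteq> 0\<close> by (intro exI[of _ "inverse w"]) (auto simp: norm_inverse inverse_less_1_iff)
  qed
  moreover have "continuous_on (-{0}) (\<lambda>w. - u (inverse w))"
    by (intro continuous_intros continuous_on_compose2[OF u(1)]) auto
  moreover have "inverse (\<eta> (inverse w)) = w * exp (- u (inverse w))" if "w \<noteq> 0" for w
    using u(3)[of "inverse w"] that by (simp add: exp_minus)
  ultimately obtain V :: "real \<times> complex \<Rightarrow> complex" where V:
    "continuous_on ({0..1} \<times> (-{0})) V" "\<And>w. V (0, w) = - u (inverse w)" "\<And>w. V (1, w) = 0"
    "\<And>r. r \<in> {0..1} \<Longrightarrow> V (r, 1) = 0"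
    "\<And>r w. r \<in> {0..1} \<Longrightarrow> norm w \<ge> 1 \<Longrightarrow> w \<noteq> 1 \<Longrightarrow> w * exp (V (r, w)) \<noteq> 1"
    using u(2) by (elim unwinding_homotopy[where u = "\<lambda>w. - u (inverse w)"]) auto
  show thesis
  proof (rule that[of "\<lambda>(r, w). - V (r, inverse w)"])
    show "continuous_on ({0..1} \<times> (-{0})) (\<lambda>(r, w). - V (r, inverse w))"
      unfolding case_prod_unfold by (intro continuous_intros continuous_on_compose2[OF V(1)]) auto
    fix r :: real and w :: complex assume r: "r \<in> {0..1}" and w: "w \<noteq> 0" "norm w \<le> 1" "w \<noteq> 1"
    have "inverse w * exp (V (r, inverse w)) \<noteq> 1"
      using w by (intro V(5)[OF r]) (auto simp: norm_inverse one_le_inverse_iff inverse_eq_1_iff)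
    then show "w * exp (case (r, w) of (r, w) \<Rightarrow> - V (r, inverse w)) \<noteq> 1"
      using w by (auto simp: exp_minus field_simps)
  qed (use V in auto)
qed

section \<open>Comparing the two homotopies over the unit circle\<close>

lemma cis_neq_1_if:
  assumes "\<theta> \<in> {0<..<2*pi}" shows "cis \<theta> \<noteq> 1"
proof
  assume "cis \<theta> = 1"
  then have "cos \<theta> = 1" by (metis cis.sel(1) one_complex.sel(1))
  then obtain n :: int where n: "\<theta> = n * 2 * pi" by (auto simp: cos_one_2pi_int)
  then have "0 < n" "n < 1" using assms pi_gt_zero by (auto simp: zero_less_mult_iff)
  then show False by simp
qed

text \<open>In the logarithmic plane the two homotopies form, for each angle \<open>\<theta>\<close>, a loop that avoids 0.
  For \<open>\<theta>\<close> near \<open>2 * pi\<close> it is close to \<open>2 * pi * \<i>\<close>, so it does not wind around 0. Hence neither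
  does it for small \<open>\<theta>\<close>, where it lies close to 0 and is therefore contractible.\<close>

lemma homotopic_paths_near_puncture:
  fixes V1 V2 :: "real \<times> complex \<Rightarrow> complex"
  assumes c: "continuous_on ({0..1} \<times> (-{0})) V1" "continuous_on ({0..1} \<times> (-{0})) V2"
    and start: "\<And>w. V1 (0, w) = V2 (0, w)" and fin: "\<And>w. V1 (1, w) = V2 (1, w)"
    and fix1: "\<And>r. r \<in> {0..1} \<Longrightarrow> V1 (r, 1) = 0" "\<And>r. r \<in> {0..1} \<Longrightarrow> V2 (r, 1) = 0"
    and ne: "\<And>r w. r \<in> {0..1} \<Longrightarrow> norm w = 1 \<Longrightarrow> w \<noteq> 1 \<Longrightarrow> w * exp (V1 (r, w)) \<noteq> 1"
            "\<And>r w. r \<in> {0..1} \<Longrightarrow> norm w = 1 \<Longrightarrow> w \<noteq> 1 \<Longrightarrow> w * exp (V2 (r, w)) \<noteq> 1"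
  obtains \<theta> where "\<theta> \<in> {0<..<2*pi}" "homotopic_paths (-{0,1})
    (\<lambda>r. cis \<theta> * exp (V1 (r, cis \<theta>))) (\<lambda>r. cis \<theta> * exp (V2 (r, cis \<theta>)))"
proof -
  have cis1: "cis \<theta> \<noteq> 1" if "\<theta> \<in> {0<..<2*pi}" for \<theta> :: real
    using cis_neq_1_if that by blast
  \<comment> \<open>A logarithm of \<open>w * exp (V (r, w))\<close> at
    \<open>w = cis \<theta>\<close>. Using the angle as the imaginary part instead of a branch of
    \<open>Ln\<close> makes it continuous up to both ends of the interval, where it is 0 and
    \<open>2 * pi * \<i>\<close>.\<close>
  define P where "P V = (\<lambda>x. \<i> * of_real (snd x) + V (fst x, cis (snd x)))" for V :: "real \<times> complex \<Rightarrow> complex"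
  have expP: "exp (P V (r, \<theta>)) = cis \<theta> * exp (V (r, cis \<theta>))" for V r \<theta>
    by (simp add: P_def exp_add cis_conv_exp)
  define Q where "Q = {0..1::real} \<times> {0<..<2*pi}"
  have Q: "convex Q" unfolding Q_def by (intro convex_Times) auto
  \<comment> \<open>Since \<open>w * exp (V (r, w))\<close> is never 1 on \<open>Q\<close>, its
    logarithm \<open>P V\<close> has no zero there and itself has a logarithm \<open>a\<close> on
    this convex set. The number \<open>\<delta>\<close> comes from uniform continuity, as
    \<open>P V\<close> does not depend on \<open>r\<close> at the angles 0 and
    \<open>2 * pi\<close>.\<close>
  have *: "\<exists>a. continuous_on Q a \<and> (\<forall>x\<in>Q. exp (a x) = P V x) \<and>
      (\<exists>\<delta>>0. \<forall>r\<in>{0..1}. \<forall>\<theta>\<in>{0..2*pi}. (\<theta> < \<delta> \<longrightarrow> norm (P V (r, \<theta>)) < 1) \<and>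
         (\<theta> > 2*pi - \<delta> \<longrightarrow> norm (P V (r, \<theta>) - 2*pi*\<i>) < 1))"
    if V: "continuous_on ({0..1} \<times> (-{0})) V" "\<And>r. r \<in> {0..1} \<Longrightarrow> V (r, 1) = 0"
      "\<And>r w. r \<in> {0..1} \<Longrightarrow> norm w = 1 \<Longrightarrow> w \<noteq> 1 \<Longrightarrow> w * exp (V (r, w)) \<noteq> 1" for V
  proof -
    have cP: "continuous_on ({0..1} \<times> {0..2*pi}) (P V)"
      unfolding P_def by (intro continuous_intros continuous_on_compose2[OF V(1)]) auto
    have nzP: "P V x \<noteq> 0" if "x \<in> Q" for x
    proof
      assume "P V x = 0"
      then have "exp (P V (fst x, snd x)) = 1" by simp
      then show False using V(3)[of "fst x" "cis (snd x)"] that cis1[of "snd x"]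
        by (auto simp: expP Q_def)
    qed
    have cQ: "continuous_on Q (P V)"
      by (rule continuous_on_subset[OF cP]) (auto simp: Q_def)
    obtain a where a: "continuous_on Q a" "\<And>x. x \<in> Q \<Longrightarrow> P V x = exp (a x)"
      using continuous_logarithm_on_contractible[OF cQ convex_imp_contractible[OF Q] nzP] by auto
    have "compact ({0..1::real} \<times> {0..2*pi})" by (intro compact_Times) auto
    then have "uniformly_continuous_on ({0..1} \<times> {0..2*pi}) (P V)"
      using cP compact_uniformly_continuous by blast
    then obtain \<delta> where \<delta>: "\<delta> > 0" and uc:
      "\<And>x y. x \<in> {0..1} \<times> {0..2*pi} \<Longrightarrow> y \<in> {0..1} \<times> {0..2*pi} \<Longrightarrow> dist y x < \<delta> \<Longrightarrow> dist (P V y) (P V x) < 1"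
      unfolding uniformly_continuous_on_def by (metis zero_less_one)
    have "norm (P V (r, \<theta>)) < 1" if "r \<in> {0..1}" "\<theta> \<in> {0..2*pi}" "\<theta> < \<delta>" for r \<theta>
      using uc[of "(r, 0)" "(r, \<theta>)"] that V(2) by (auto simp: P_def dist_Pair_Pair dist_norm)
    moreover have "norm (P V (r, \<theta>) - 2*pi*\<i>) < 1" if "r \<in> {0..1}" "\<theta> \<in> {0..2*pi}" "\<theta> > 2*pi - \<delta>" for r \<theta>
    proof -
      have "P V (r, 2*pi) = 2*pi*\<i>" using V(2)[OF that(1)] by (simp add: P_def cis_2pi)
      then show ?thesis using uc[of "(r, 2*pi)" "(r, \<theta>)"] that by (simp add: dist_Pair_Pair dist_norm)
    qed
    ultimately show ?thesis using a \<delta> by (intro exI[of _ a] conjI exI[of _ \<delta>]) auto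
  qed
  obtain a1 \<delta>1 where a1: "continuous_on Q a1" "\<And>x. x \<in> Q \<Longrightarrow> exp (a1 x) = P V1 x" "\<delta>1 > 0"
    and d1: "\<And>r \<theta>. r\<in>{0..1} \<Longrightarrow> \<theta>\<in>{0..2*pi} \<Longrightarrow> \<theta> < \<delta>1 \<Longrightarrow> norm (P V1 (r, \<theta>)) < 1"
      "\<And>r \<theta>. r\<in>{0..1} \<Longrightarrow> \<theta>\<in>{0..2*pi} \<Longrightarrow> \<theta> > 2*pi - \<delta>1 \<Longrightarrow> norm (P V1 (r, \<theta>) - 2*pi*\<i>) < 1"
    using *[OF c(1) fix1(1) ne(1)] by blast
  obtain a2 \<delta>2 where a2: "continuous_on Q a2" "\<And>x. x \<in> Q \<Longrightarrow> exp (a2 x) = P V2 x" "\<delta>2 > 0"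
    and d2: "\<And>r \<theta>. r\<in>{0..1} \<Longrightarrow> \<theta>\<in>{0..2*pi} \<Longrightarrow> \<theta> < \<delta>2 \<Longrightarrow> norm (P V2 (r, \<theta>)) < 1"
      "\<And>r \<theta>. r\<in>{0..1} \<Longrightarrow> \<theta>\<in>{0..2*pi} \<Longrightarrow> \<theta> > 2*pi - \<delta>2 \<Longrightarrow> norm (P V2 (r, \<theta>) - 2*pi*\<i>) < 1"
    using *[OF c(2) fix1(2) ne(2)] by blast
  have Peq: "P V1 (0, \<theta>) = P V2 (0, \<theta>)" "P V1 (1, \<theta>) = P V2 (1, \<theta>)" for \<theta>
    using start fin by (auto simp: P_def)
  \<comment> \<open>At both ends in \<open>r\<close> the functions \<open>P V1\<close> and
    \<open>P V2\<close> coincide. The constancy in \<open>\<theta>\<close> carries the comparison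
    from an angle near \<open>2 * pi\<close> to an angle near 0.\<close>
  have const: "a1 (j, \<theta>) - a2 (j, \<theta>) = a1 (j, \<theta>') - a2 (j, \<theta>')"
    if "\<theta> \<in> {0<..<2*pi}" "\<theta>' \<in> {0<..<2*pi}" "j = 0 \<or> j = 1" for j \<theta> \<theta>'
  proof (rule const_of_exp_eq_1[where S="{0<..<2*pi}"])
    show "continuous_on {0<..<2*pi} (\<lambda>\<theta>. a1 (j, \<theta>) - a2 (j, \<theta>))"
      using that(3) by (intro continuous_intros continuous_on_compose2[OF a1(1)] continuous_on_compose2[OF a2(1)])
        (auto simp: Q_def)
    show "exp (a1 (j, x) - a2 (j, x)) = 1" if "x \<in> {0<..<2*pi}" for x
    proof -
      have "(j, x) \<in> Q" using that \<open>j = 0 \<or> j = 1\<close> by (auto simp: Q_def)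
      moreover have "P V1 (j, x) = P V2 (j, x)" using Peq \<open>j = 0 \<or> j = 1\<close> by auto
      ultimately show ?thesis using a1(2)[of "(j, x)"] a2(2)[of "(j, x)"] by (simp add: exp_diff) (metis divide_self exp_not_eq_zero)
    qed
  qed (use that in auto)
  \<comment> \<open>Half the smaller \<open>\<delta>\<close> brings the angle within reach of both
    estimates; the bound \<open>pi\<close> keeps it inside the open interval.\<close>
  define \<theta>2 where "\<theta>2 = 2*pi - min pi (min \<delta>1 \<delta>2) / 2"
  have \<theta>2: "\<theta>2 \<in> {0<..<2*pi}" "\<theta>2 \<in> {0..2*pi}" "\<theta>2 > 2*pi - \<delta>1" "\<theta>2 > 2*pi - \<delta>2"
    using a1(3) a2(3) pi_gt_zero unfolding \<theta>2_def greaterThanLessThan_iff atLeastAtMost_iff by (auto simp: min_def)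
  define \<theta>1 where "\<theta>1 = min pi (min \<delta>1 \<delta>2) / 2"
  have \<theta>1: "\<theta>1 \<in> {0<..<2*pi}" "\<theta>1 \<in> {0..2*pi}" "\<theta>1 < \<delta>1" "\<theta>1 < \<delta>2"
    using a1(3) a2(3) pi_gt_zero unfolding \<theta>1_def greaterThanLessThan_iff atLeastAtMost_iff by (auto simp: min_def)
  \<comment> \<open>Close to \<open>2 * pi * \<i>\<close> the values of \<open>P V\<close> lie in
    the upper half plane, where \<open>Ln\<close> is continuous. The increment of \<open>a\<close>
    along \<open>r\<close> is therefore that of \<open>Ln\<close>, which depends only on the end
    values, and these are common to \<open>V1\<close> and \<open>V2\<close>.\<close>
  have Lnconst: "a (0, \<theta>2) - Ln (P V (0, \<theta>2)) = a (1, \<theta>2) - Ln (P V (1, \<theta>2))"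
    if a: "continuous_on Q a" "\<And>x. x \<in> Q \<Longrightarrow> exp (a x) = P V x"
      and n: "\<And>r. r \<in> {0..1} \<Longrightarrow> norm (P V (r, \<theta>2) - 2*pi*\<i>) < 1" for a V
  proof -
    have im: "Im (P V (r, \<theta>2)) > 0" if "r \<in> {0..1}" for r
    proof -
      have "\<bar>Im (P V (r, \<theta>2) - 2*pi*\<i>)\<bar> < 1"
        using n[OF that] abs_Im_le_cmod le_less_trans by blast
      then show ?thesis using pi_gt3 by simp
    qed
    have ec: "continuous_on {0..1} (\<lambda>r. a (r, \<theta>2))"
      using \<theta>2 by (intro continuous_on_compose2[OF a(1)] continuous_intros) (auto simp: Q_def)
    have eq: "exp (a (r, \<theta>2)) = P V (r, \<theta>2)" if "r \<in> {0..1}" for r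
      using a(2)[of "(r, \<theta>2)"] \<theta>2 that by (auto simp: Q_def)
    have "continuous_on {0..1} (\<lambda>r. exp (a (r, \<theta>2)))" by (intro continuous_intros ec)
    then have "continuous_on {0..1} (\<lambda>r. P V (r, \<theta>2))" by (rule continuous_on_eq) (use eq in auto)
    then have "continuous_on {0..1} (\<lambda>r. a (r, \<theta>2) - Ln (P V (r, \<theta>2)))"
      by (intro continuous_on_diff ec continuous_on_compose2[OF continuous_on_Ln[of "{z. 0 < Im z}"]])
        (use im in \<open>auto simp: complex_nonpos_Reals_iff\<close>)
    moreover have "exp (a (r, \<theta>2) - Ln (P V (r, \<theta>2))) = 1" if "r \<in> {0..1}" for r
    proof -
      have "P V (r, \<theta>2) \<noteq> 0" using im[OF that] by auto
      then show ?thesis using eq[OF that] by (simp add: exp_diff)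
    qed
    ultimately show ?thesis
      by (intro const_of_exp_eq_1[where S="{0..1}" and f="\<lambda>r. a (r, \<theta>2) - Ln (P V (r, \<theta>2))"]) auto
  qed
  have d01: "a1 (0, \<theta>2) - a2 (0, \<theta>2) = a1 (1, \<theta>2) - a2 (1, \<theta>2)"
  proof -
    have "a - b = a' - b'" if "a - l = a' - l'" "b - l = b' - l'" for a b l a' b' l' :: complex
    proof -
      have "a - b = (a - l) - (b - l)" by simp
      also have "\<dots> = a' - b'" unfolding that by simp
      finally show ?thesis .
    qed
    from this[OF Lnconst[OF a1(1,2) d1(2)[OF _ \<theta>2(2,3)], unfolded Peq] Lnconst[OF a2(1,2) d2(2)[OF _ \<theta>2(2,4)]]]
    show ?thesis by simp
  qed
  define d where "d = a1 (0, \<theta>1) - a2 (0, \<theta>1)"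
  have d: "a1 (0, \<theta>1) = a2 (0, \<theta>1) + d" "a1 (1, \<theta>1) = a2 (1, \<theta>1) + d"
  proof -
    have "a1 (1, \<theta>1) - a2 (1, \<theta>1) = a1 (0, \<theta>1) - a2 (0, \<theta>1)"
      using d01 const[OF \<theta>1(1) \<theta>2(1), of 0] const[OF \<theta>1(1) \<theta>2(1), of 1] by simp
    then show "a1 (0, \<theta>1) = a2 (0, \<theta>1) + d" "a1 (1, \<theta>1) = a2 (1, \<theta>1) + d"
      by (auto simp: d_def algebra_simps)
  qed
  have inQ: "(r, \<theta>1) \<in> Q" if "r \<in> {0..1}" for r using that \<theta>1 by (auto simp: Q_def)
  have ed: "exp d = 1"
  proof -
    have "exp (a1 (0, \<theta>1)) = exp (a2 (0, \<theta>1))"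
      using a1(2)[OF inQ, of 0] a2(2)[OF inQ, of 0] Peq[of \<theta>1] by simp
    then show ?thesis by (simp add: d_def exp_diff)
  qed
  \<comment> \<open>Straight homotopy between the double logarithms, with the shift
    \<open>d\<close>, a period of \<open>exp\<close>, aligning the endpoints. Near the angle 0 both
    have negative real part, so the inner exponential has modulus strictly between 0 and 1; it is
    then no multiple of \<open>2 * pi * \<i>\<close>, and the outer exponential is not 1.\<close>
  define H where "H = (\<lambda>(t, r). exp (exp (of_real (1 - t) * a1 (r, \<theta>1) + of_real t * (a2 (r, \<theta>1) + d))))"
  have "homotopic_paths (-{0,1}) (\<lambda>r. exp (P V1 (r, \<theta>1))) (\<lambda>r. exp (P V2 (r, \<theta>1)))"
    unfolding homotopic_paths
  proof (intro exI[of _ H] conjI ballI)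
    show "continuous_on ({0..1} \<times> {0..1}) H"
      unfolding H_def case_prod_unfold
      by (intro continuous_intros continuous_on_compose2[OF a1(1)] continuous_on_compose2[OF a2(1)])
        (use \<theta>1 in \<open>auto simp: Q_def\<close>)
    show "H \<in> {0..1} \<times> {0..1} \<rightarrow> -{0,1}"
    proof -
      have "H (t, r) \<in> - {0, 1}" if t: "t \<in> {0..1}" "r \<in> {0..1}" for t r
      proof -
        define z where "z = of_real (1 - t) * a1 (r, \<theta>1) + of_real t * (a2 (r, \<theta>1) + d)"
        have "exp (Re (a1 (r, \<theta>1))) < 1" "exp (Re (a2 (r, \<theta>1))) < 1"
          using a1(2)[OF inQ[OF t(2)]] a2(2)[OF inQ[OF t(2)]] d1(1)[OF t(2) \<theta>1(2,3)] d2(1)[OF t(2) \<theta>1(2,4)]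
          by (metis norm_exp_eq_Re)+
        then have 1: "Re (a1 (r, \<theta>1)) < 0" "Re (a2 (r, \<theta>1)) < 0" by simp_all
        have 2: "Re d = 0" using ed by (metis exp_eq_1)
        have "Re z = (1 - t) * Re (a1 (r, \<theta>1)) + t * Re (a2 (r, \<theta>1))"
          by (simp add: z_def 2)
        also have "\<dots> < 0"
        proof (cases "t = 0")
          case False
          then have "t * Re (a2 (r, \<theta>1)) < 0" "(1 - t) * Re (a1 (r, \<theta>1)) \<le> 0"
            using 1 t by (auto simp: mult_less_0_iff mult_le_0_iff)
          then show ?thesis by linarith
        qed (use 1 in simp)
        finally have n: "norm (exp z) < 1" by simp
        have "exp (exp z) \<noteq> 1"
        proof
          assume "exp (exp z) = 1"
          then obtain n :: int where n1: "Re (exp z) = 0" "Im (exp z) = of_int (2 * n) * pi"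
            by (auto simp: exp_eq_1)
          have "\<bar>Im (exp z)\<bar> < 1" using n abs_Im_le_cmod le_less_trans by blast
          have "n = 0"
          proof (rule ccontr)
            assume "n \<noteq> 0"
            then have "\<bar>real_of_int n\<bar> \<ge> 1" by linarith
            then have "\<bar>of_int (2 * n) * pi\<bar> \<ge> 2 * pi" by (simp add: abs_mult)
            then show False using \<open>\<bar>Im (exp z)\<bar> < 1\<close> n1 pi_gt3 by linarith
          qed
          then have "exp z = 0" using n1 by (simp add: complex_eq_iff)
          then show False by simp
        qed
        then show "H (t, r) \<in> - {0, 1}" by (simp add: H_def z_def)
      qed
      then show ?thesis by auto
    qed
    show "H (0, x) = exp (P V1 (x, \<theta>1))" if "x \<in> {0..1}" for x
      using a1(2)[OF inQ[OF that]] by (simp add: H_def)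
    show "H (1, x) = exp (P V2 (x, \<theta>1))" if "x \<in> {0..1}" for x
      using a2(2)[OF inQ[OF that]] by (simp add: H_def exp_add ed)
    show "pathstart (H \<circ> Pair t) = pathstart (\<lambda>r. exp (P V1 (r, \<theta>1)))"
         "pathfinish (H \<circ> Pair t) = pathfinish (\<lambda>r. exp (P V1 (r, \<theta>1)))" for t
      using a1(2)[OF inQ, of 0] a1(2)[OF inQ, of 1] d by (simp_all add: pathstart_def pathfinish_def H_def algebra_simps)
  qed
  then show thesis using that[OF \<theta>1(1)] by (simp add: expP)
qed

text \<open>A self-homeomorphism of the plane fixing 0 and 1 is, up to orientation, homotopic to the
  identity off these points; lifting the homotopy replaces a symmetry over \<open>\<eta>\<close> by a deck
  transformation.\<close>

lemma deck_map_of_lift: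
  fixes \<gamma> :: "complex \<Rightarrow> complex"
  assumes cov: "covering_space Y \<gamma> (-{0,1})"
    and hom: "homeomorphism UNIV UNIV \<eta> \<eta>'" "\<eta> 0 = 0" "\<eta> 1 = 1"
    and u: "continuous_on (-{0}) u" "u 1 = 0" "\<And>w. w \<noteq> 0 \<Longrightarrow> \<eta> w = w * exp (u w)"
    and h: "continuous_on Y h" "h \<in> Y \<rightarrow> Y" "\<And>z. z \<in> Y \<Longrightarrow> \<gamma> (h z) = \<eta> (\<gamma> z)"
  obtains k where "continuous_on Y k" "k \<in> Y \<rightarrow> Y" "\<And>z. z \<in> Y \<Longrightarrow> \<gamma> (k z) = \<gamma> z"
    "\<And>\<rho>. \<rho> > 0 \<Longrightarrow> \<exists>\<delta>>0. \<forall>z\<in>Y. norm (\<gamma> z - 1) < \<delta> \<longrightarrow>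
       (\<exists>c. path c \<and> (\<forall>t\<in>{0..1}. norm (\<gamma> (c t) - 1) < \<rho>) \<and> pathstart c = h z \<and> pathfinish c = k z)"
proof -
  have c\<gamma>: "continuous_on Y \<gamma>" and \<gamma>Y: "\<And>z. z \<in> Y \<Longrightarrow> \<gamma> z \<noteq> 0 \<and> \<gamma> z \<noteq> 1"
    using cov by (auto simp: covering_space_def)
  have inv: "\<eta>' (\<eta> x) = x" "\<eta> (\<eta>' x) = x" and ce: "continuous_on UNIV \<eta>" "continuous_on UNIV \<eta>'" for x
    using hom by (auto simp: homeomorphism_def)
  have z': "\<eta>' 0 = 0" using inv(1)[of 0] hom by simp
  have nz: "\<eta> x \<noteq> 0" "\<eta>' x \<noteq> 0" if "x \<noteq> 0" for x
    using inv[of x] that hom z' by metis+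
  have nz': "\<eta> x = 0 \<Longrightarrow> x = 0" "\<eta>' x = 0 \<Longrightarrow> x = 0" for x using nz by blast+
  have homC: "homeomorphism (-{0}) (-{0}) \<eta> \<eta>'"
    by (rule homeomorphismI) (use nz inv in \<open>auto dest: nz' intro: continuous_on_subset[OF ce(1)] continuous_on_subset[OF ce(2)]\<close>)
  have small: "\<exists>w. w \<noteq> 0 \<and> norm w < 1 \<and> norm (\<eta> w) < c" if "c > 0" for c
  proof -
    have "isCont \<eta> 0" using ce(1) by (simp add: continuous_on_eq_continuous_at)
    then have "\<exists>d>0. \<forall>w. norm w < d \<longrightarrow> norm (\<eta> w) < c"
      using that hom(2) unfolding continuous_at_eps_delta by (simp add: dist_norm)
    then obtain d where d: "d > 0" "\<And>w. norm w < d \<Longrightarrow> norm (\<eta> w) < c" by auto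
    define w where "w = complex_of_real (min d 1 / 2)"
    have w: "norm w = min d 1 / 2" using d by (simp add: w_def)
    have "norm w > 0" unfolding w using d by simp
    moreover have "norm w < d" "norm w < 1" unfolding w using d by linarith+
    ultimately show ?thesis using d(2)[of w] by auto
  qed
  have large: "\<exists>w. norm w > 1 \<and> norm (\<eta> w) > c" for c
  proof -
    have "compact (\<eta> ` cball 0 1)"
      by (intro compact_continuous_image continuous_on_subset[OF ce(1)]) auto
    then obtain B where B: "\<And>w. norm w \<le> 1 \<Longrightarrow> norm (\<eta> w) \<le> B"
      using compact_imp_bounded bounded_iff by (metis image_eqI mem_cball_0)
    define v where "v = complex_of_real (\<bar>B\<bar> + \<bar>c\<bar> + 1)"
    have v: "norm v = \<bar>B\<bar> + \<bar>c\<bar> + 1" by (simp only: v_def norm_of_real)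
    have "norm (\<eta>' v) > 1" using B[of "\<eta>' v"] v inv(2)[of v] by force
    then show ?thesis using v inv(2)[of v] by (intro exI[of _ "\<eta>' v"]) auto
  qed
  obtain V1 :: "real \<times> complex \<Rightarrow> complex" where V1:
    "continuous_on ({0..1} \<times> (-{0})) V1" "\<And>w. V1 (0, w) = u w" "\<And>w. V1 (1, w) = 0"
    "\<And>r. r \<in> {0..1} \<Longrightarrow> V1 (r, 1) = 0"
    "\<And>r w. r \<in> {0..1} \<Longrightarrow> norm w \<ge> 1 \<Longrightarrow> w \<noteq> 1 \<Longrightarrow> w * exp (V1 (r, w)) \<noteq> 1"
    using unwinding_homotopy[OF homC small u] by blast
  obtain V2 :: "real \<times> complex \<Rightarrow> complex" where V2:
    "continuous_on ({0..1} \<times> (-{0})) V2" "\<And>w. V2 (0, w) = u w" "\<And>w. V2 (1, w) = 0"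
    "\<And>r. r \<in> {0..1} \<Longrightarrow> V2 (r, 1) = 0"
    "\<And>r w. r \<in> {0..1} \<Longrightarrow> w \<noteq> 0 \<Longrightarrow> norm w \<le> 1 \<Longrightarrow> w \<noteq> 1 \<Longrightarrow> w * exp (V2 (r, w)) \<noteq> 1"
    using unwinding_homotopy_inner[OF homC large u] by blast
  \<comment> \<open>Each homotopy avoids 1 on one side of the circle only, so each is lifted on its
    own half of the covering; the unit circle belongs to both halves.\<close>
  define Y1 where "Y1 = {z \<in> Y. norm (\<gamma> z) \<ge> 1}"
  define Y2 where "Y2 = {z \<in> Y. norm (\<gamma> z) \<le> 1}"
  have lift: "\<exists>K. continuous_on ({0..1} \<times> Z) K \<and> K \<in> {0..1} \<times> Z \<rightarrow> Y \<and>
      (\<forall>z\<in>Z. K (0, z) = h z) \<and> (\<forall>r\<in>{0..1}. \<forall>z\<in>Z. \<gamma> (K (r, z)) = \<gamma> z * exp (V (r, \<gamma> z))) \<and>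
      (\<forall>\<rho>>0. \<exists>\<delta>>0. \<forall>z\<in>Z. norm (\<gamma> z - 1) < \<delta> \<longrightarrow> (\<forall>r\<in>{0..1}. norm (\<gamma> (K (r, z)) - 1) < \<rho>))"
    if V: "continuous_on ({0..1} \<times> (-{0})) V" "\<And>w. V (0, w) = u w" "\<And>r. r \<in> {0..1} \<Longrightarrow> V (r, 1) = 0"
      and Z: "Z \<subseteq> Y" "\<And>r z. r \<in> {0..1} \<Longrightarrow> z \<in> Z \<Longrightarrow> \<gamma> z * exp (V (r, \<gamma> z)) \<noteq> 1"
    for Z and V :: "real \<times> complex \<Rightarrow> complex"
  proof -
    define M where "M = (\<lambda>x :: real \<times> complex. snd x * exp (V x))"
    have cM: "continuous_on ({0..1} \<times> (-{0})) M"
      unfolding M_def by (intro continuous_intros V(1))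
    obtain K where K: "continuous_on ({0..1} \<times> Z) K" "K \<in> {0..1} \<times> Z \<rightarrow> Y"
        "\<And>z. z \<in> Z \<Longrightarrow> K (0, z) = h z" "\<And>x. x \<in> {0..1} \<times> Z \<Longrightarrow> M (fst x, \<gamma> (snd x)) = \<gamma> (K x)"
    proof (rule covering_space_lift_homotopy[OF cov, of Z "\<lambda>x. M (fst x, \<gamma> (snd x))" h])
      show "continuous_on ({0..1} \<times> Z) (\<lambda>x. M (fst x, \<gamma> (snd x)))"
        by (intro continuous_on_compose2[OF cM] continuous_intros continuous_on_compose2[OF c\<gamma>])
          (use Z \<gamma>Y in auto)
      show "(\<lambda>x. M (fst x, \<gamma> (snd x))) \<in> {0..1} \<times> Z \<rightarrow> - {0, 1}"
        using Z \<gamma>Y by (auto simp: M_def)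
      show "M (fst (0, y), \<gamma> (snd (0, y))) = \<gamma> (h y)" if "y \<in> Z" for y
        using V(2) u(3)[of "\<gamma> y"] h(3)[of y] that Z \<gamma>Y[of y] by (auto simp: M_def)
      show "continuous_on Z h" using Z h continuous_on_subset by blast
      show "h \<in> Z \<rightarrow> Y" using Z h by auto
    qed blast
    have "\<exists>\<delta>>0. \<forall>z\<in>Z. norm (\<gamma> z - 1) < \<delta> \<longrightarrow> (\<forall>r\<in>{0..1}. norm (\<gamma> (K (r, z)) - 1) < \<rho>)" if "\<rho> > 0" for \<rho>
    proof -
      \<comment> \<open>The radius 1/2 keeps the ball away from 0. On it uniform continuity compares
        \<open>M (r, w)\<close> with \<open>M (r, 1) = 1\<close>, for all \<open>r\<close> at
        once.\<close>
      let ?C = "{0..1::real} \<times> cball (1::complex) (1/2)"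
      have c0: "0 \<notin> cball (1::complex) (1/2)" by auto
      have "compact ?C" by (intro compact_Times) auto
      moreover have "continuous_on ?C M" by (rule continuous_on_subset[OF cM]) (use c0 in auto)
      ultimately have "uniformly_continuous_on ?C M" by (intro compact_uniformly_continuous)
      then obtain d where d: "d > 0" "\<And>x y. x \<in> ?C \<Longrightarrow> y \<in> ?C \<Longrightarrow> dist y x < d \<Longrightarrow> dist (M y) (M x) < \<rho>"
        unfolding uniformly_continuous_on_def using \<open>\<rho> > 0\<close> by metis
      show ?thesis
      proof (intro exI[of _ "min d (1/2)"] conjI ballI impI)
        fix z r assume z: "z \<in> Z" "norm (\<gamma> z - 1) < min d (1/2)" and r: "r \<in> {0..1::real}"
        have "dist (M (r, \<gamma> z)) (M (r, 1)) < \<rho>"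
          by (rule d(2)) (use z r in \<open>auto simp: dist_Pair_Pair dist_norm norm_minus_commute\<close>)
        moreover have "M (r, 1) = 1" using V(3)[OF r] by (simp add: M_def)
        ultimately show "norm (\<gamma> (K (r, z)) - 1) < \<rho>"
          using K(4)[of "(r, z)"] z r by (simp add: dist_norm)
      qed (use d in auto)
    qed
    then show ?thesis using K by (intro exI[of _ K] conjI) (auto simp: M_def)
  qed
  obtain K1 where K1: "continuous_on ({0..1} \<times> Y1) K1" "K1 \<in> {0..1} \<times> Y1 \<rightarrow> Y"
      "\<And>z. z\<in>Y1 \<Longrightarrow> K1 (0, z) = h z" "\<And>r z. r\<in>{0..1} \<Longrightarrow> z\<in>Y1 \<Longrightarrow> \<gamma> (K1 (r, z)) = \<gamma> z * exp (V1 (r, \<gamma> z))"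
      "\<And>\<rho>. \<rho>>0 \<Longrightarrow> \<exists>\<delta>>0. \<forall>z\<in>Y1. norm (\<gamma> z - 1) < \<delta> \<longrightarrow> (\<forall>r\<in>{0..1}. norm (\<gamma> (K1 (r, z)) - 1) < \<rho>)"
    using lift[of V1 Y1] V1 \<gamma>Y by (auto simp: Y1_def)
  obtain K2 where K2: "continuous_on ({0..1} \<times> Y2) K2" "K2 \<in> {0..1} \<times> Y2 \<rightarrow> Y"
      "\<And>z. z\<in>Y2 \<Longrightarrow> K2 (0, z) = h z" "\<And>r z. r\<in>{0..1} \<Longrightarrow> z\<in>Y2 \<Longrightarrow> \<gamma> (K2 (r, z)) = \<gamma> z * exp (V2 (r, \<gamma> z))"
      "\<And>\<rho>. \<rho>>0 \<Longrightarrow> \<exists>\<delta>>0. \<forall>z\<in>Y2. norm (\<gamma> z - 1) < \<delta> \<longrightarrow> (\<forall>r\<in>{0..1}. norm (\<gamma> (K2 (r, z)) - 1) < \<rho>)"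
    using lift[of V2 Y2] V2 \<gamma>Y by (auto simp: Y2_def)
  \<comment> \<open>The arc \<open>cis t\<close> lifts to an arc \<open>\<zeta>\<close> through
    \<open>z0\<close>. Along it both final maps are lifts of the same arc, so one common value is
    enough, and monodromy supplies it at the angle \<open>\<theta>\<close> where the two tracks are
    homotopic.\<close>
  have agree: "K1 (1, z0) = K2 (1, z0)" if z0: "z0 \<in> Y" "norm (\<gamma> z0) = 1" for z0
  proof -
    obtain \<theta>0 where t0: "0 \<le> \<theta>0" "\<theta>0 < 2*pi" "\<gamma> z0 = cis \<theta>0"
      using complex_unimodular_polar[OF z0(2)] by (metis cis.ctr complex_eq_iff cis.sel)
    have "\<theta>0 \<noteq> 0" using t0 \<gamma>Y[OF z0(1)] by auto
    then have t0': "\<theta>0 \<in> {0<..<2*pi}" using t0 by auto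
    have cis1: "cis \<theta> \<noteq> 1" if "\<theta> \<in> {0<..<2*pi}" for \<theta> :: real
      using cis_neq_1_if that by blast
    obtain \<theta> where \<theta>: "\<theta> \<in> {0<..<2*pi}" and hp: "homotopic_paths (-{0,1})
        (\<lambda>r. cis \<theta> * exp (V1 (r, cis \<theta>))) (\<lambda>r. cis \<theta> * exp (V2 (r, cis \<theta>)))"
      using homotopic_paths_near_puncture[OF V1(1) V2(1)] V1 V2 by (smt (verit) norm_zero)
    obtain \<zeta> where \<zeta>: "continuous_on {0<..<2*pi} \<zeta>" "\<zeta> \<in> {0<..<2*pi} \<rightarrow> Y" "\<zeta> \<theta>0 = z0"
        "\<And>t. t \<in> {0<..<2*pi} \<Longrightarrow> \<gamma> (\<zeta> t) = cis t"
    proof (rule covering_space_lift_strong[OF cov z0(1) t0', of cis])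
      show "simply_connected {0<..<2*pi}" by (intro convex_imp_simply_connected) auto
      show "locally path_connected {0<..<2*pi}" by (intro convex_imp_locally_path_connected) auto
    qed (use cis1 t0 in \<open>auto intro!: continuous_intros\<close>)
    have \<zeta>Y: "\<zeta> t \<in> Y1" "\<zeta> t \<in> Y2" if "t \<in> {0<..<2*pi}" for t
      using \<zeta>(2,4) that by (auto simp: Y1_def Y2_def)
    have pK: "path (\<lambda>r. K (r, \<zeta> \<theta>))" if "continuous_on ({0..1} \<times> Z) K" "\<zeta> \<theta> \<in> Z" for K and Z
      using that unfolding path_def by (intro continuous_on_compose2[OF that(1)] continuous_intros) auto
    have "pathfinish (\<lambda>r. K1 (r, \<zeta> \<theta>)) = pathfinish (\<lambda>r. K2 (r, \<zeta> \<theta>))"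
    proof (rule covering_space_monodromy[OF cov _ _ _ _ hp])
      show "path_image (\<lambda>r. K1 (r, \<zeta> \<theta>)) \<subseteq> Y" "path_image (\<lambda>r. K2 (r, \<zeta> \<theta>)) \<subseteq> Y"
        using K1(2) K2(2) \<zeta>Y[OF \<theta>] by (auto simp: path_image_def)
      show "pathstart (\<lambda>r. K1 (r, \<zeta> \<theta>)) = pathstart (\<lambda>r. K2 (r, \<zeta> \<theta>))"
        using K1(3) K2(3) \<zeta>Y[OF \<theta>] by (simp add: pathstart_def)
    qed (use homotopic_paths_imp_path[OF hp] homotopic_paths_imp_subset[OF hp] K1(4) K2(4) \<zeta>Y[OF \<theta>] \<zeta>(4)[OF \<theta>]
          pK[OF K1(1)] pK[OF K2(1)] in auto)
    then have eq\<theta>: "K1 (1, \<zeta> \<theta>) = K2 (1, \<zeta> \<theta>)" by (simp add: pathfinish_def)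
    have "K1 (1, \<zeta> \<theta>0) = K2 (1, \<zeta> \<theta>0)"
    proof (rule covering_space_lift_unique[OF cov, where T="{0<..<2*pi}" and f=cis and a=\<theta>])
      show "continuous_on {0<..<2*pi} (\<lambda>t. K1 (1, \<zeta> t))"
        by (intro continuous_on_compose2[OF K1(1)] continuous_intros \<zeta>(1)) (use \<zeta>Y in auto)
      show "continuous_on {0<..<2*pi} (\<lambda>t. K2 (1, \<zeta> t))"
        by (intro continuous_on_compose2[OF K2(1)] continuous_intros \<zeta>(1)) (use \<zeta>Y in auto)
      show "(\<lambda>t. K1 (1, \<zeta> t)) \<in> {0<..<2*pi} \<rightarrow> Y" using K1(2) \<zeta>Y by fastforce
      show "(\<lambda>t. K2 (1, \<zeta> t)) \<in> {0<..<2*pi} \<rightarrow> Y" using K2(2) \<zeta>Y by fastforce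
      show "cis t = \<gamma> (K1 (1, \<zeta> t))" "cis t = \<gamma> (K2 (1, \<zeta> t))" if "t \<in> {0<..<2*pi}" for t
        using K1(4)[of 1 "\<zeta> t"] K2(4)[of 1 "\<zeta> t"] \<zeta>Y[OF that] \<zeta>(4)[OF that] V1(3) V2(3) by auto
    qed (use eq\<theta> \<theta> t0' cis1 in \<open>auto intro!: continuous_intros\<close>)
    then show ?thesis by (simp add: \<zeta>)
  qed
  define k where "k z = (if norm (\<gamma> z) \<ge> 1 then K1 (1, z) else K2 (1, z))" for z
  show thesis
  proof
    have "continuous_on (Y1 \<union> Y2) (\<lambda>z. if norm (\<gamma> z) \<ge> 1 then K1 (1, z) else K2 (1, z))"
    proof (rule continuous_on_cases_local)
      have Y: "Y1 \<union> Y2 = Y" by (auto simp: Y1_def Y2_def)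
      have "closedin (top_of_set Y) (Y \<inter> (\<lambda>z. norm (\<gamma> z)) -` {1..})"
        by (intro continuous_closedin_preimage continuous_intros c\<gamma>)
      also have "Y \<inter> (\<lambda>z. norm (\<gamma> z)) -` {1..} = Y1" by (auto simp: Y1_def)
      finally show "closedin (top_of_set (Y1 \<union> Y2)) Y1" unfolding Y .
      have "closedin (top_of_set Y) (Y \<inter> (\<lambda>z. norm (\<gamma> z)) -` {..1})"
        by (intro continuous_closedin_preimage continuous_intros c\<gamma>)
      also have "Y \<inter> (\<lambda>z. norm (\<gamma> z)) -` {..1} = Y2" by (auto simp: Y2_def)
      finally show "closedin (top_of_set (Y1 \<union> Y2)) Y2" unfolding Y .
      show "continuous_on Y1 (\<lambda>z. K1 (1, z))"
        by (intro continuous_on_compose2[OF K1(1)] continuous_intros) auto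
      show "continuous_on Y2 (\<lambda>z. K2 (1, z))"
        by (intro continuous_on_compose2[OF K2(1)] continuous_intros) auto
      show "K1 (1, z) = K2 (1, z)"
        if "z \<in> Y1 \<and> \<not> norm (\<gamma> z) \<ge> 1 \<or> z \<in> Y2 \<and> norm (\<gamma> z) \<ge> 1" for z
        using that by (intro agree) (auto simp: Y1_def Y2_def)
    qed
    moreover have "Y1 \<union> Y2 = Y" by (auto simp: Y1_def Y2_def)
    ultimately show "continuous_on Y k" unfolding k_def by simp
    show "k \<in> Y \<rightarrow> Y" using K1(2) K2(2) by (fastforce simp: k_def Y1_def Y2_def)
    show "\<gamma> (k z) = \<gamma> z" if "z \<in> Y" for z
      using K1(4)[of 1 z] K2(4)[of 1 z] V1(3) V2(3) that by (auto simp: k_def Y1_def Y2_def)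
    fix \<rho> :: real assume \<rho>: "\<rho> > 0"
    obtain \<delta>1 where \<delta>1: "\<delta>1 > 0" "\<And>z r. z\<in>Y1 \<Longrightarrow> norm (\<gamma> z - 1) < \<delta>1 \<Longrightarrow> r\<in>{0..1} \<Longrightarrow> norm (\<gamma> (K1 (r, z)) - 1) < \<rho>"
      using K1(5)[OF \<rho>] by blast
    obtain \<delta>2 where \<delta>2: "\<delta>2 > 0" "\<And>z r. z\<in>Y2 \<Longrightarrow> norm (\<gamma> z - 1) < \<delta>2 \<Longrightarrow> r\<in>{0..1} \<Longrightarrow> norm (\<gamma> (K2 (r, z)) - 1) < \<rho>"
      using K2(5)[OF \<rho>] by blast
    show "\<exists>\<delta>>0. \<forall>z\<in>Y. norm (\<gamma> z - 1) < \<delta> \<longrightarrow>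
       (\<exists>c. path c \<and> (\<forall>t\<in>{0..1}. norm (\<gamma> (c t) - 1) < \<rho>) \<and> pathstart c = h z \<and> pathfinish c = k z)"
    proof (intro exI[of _ "min \<delta>1 \<delta>2"] conjI ballI impI)
      fix z assume z: "z \<in> Y" "norm (\<gamma> z - 1) < min \<delta>1 \<delta>2"
      show "\<exists>c. path c \<and> (\<forall>t\<in>{0..1}. norm (\<gamma> (c t) - 1) < \<rho>) \<and> pathstart c = h z \<and> pathfinish c = k z"
      proof (cases "norm (\<gamma> z) \<ge> 1")
        case True
        then have "z \<in> Y1" using z by (simp add: Y1_def)
        moreover from this have "path (\<lambda>r. K1 (r, z))"
          unfolding path_def by (intro continuous_on_compose2[OF K1(1)] continuous_intros) auto
        ultimately show ?thesis using True K1(3) \<delta>1(2) z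
          by (intro exI[of _ "\<lambda>r. K1 (r, z)"]) (auto simp: k_def pathstart_def pathfinish_def)
      next
        case False
        then have "z \<in> Y2" using z by (simp add: Y2_def)
        moreover from this have "path (\<lambda>r. K2 (r, z))"
          unfolding path_def by (intro continuous_on_compose2[OF K2(1)] continuous_intros) auto
        ultimately show ?thesis using False K2(3) \<delta>2(2) z
          by (intro exI[of _ "\<lambda>r. K2 (r, z)"]) (auto simp: k_def pathstart_def pathfinish_def)
      qed
    qed (use \<delta>1 \<delta>2 in auto)
  qed
qed

section \<open>Symmetries of a covering of the twice punctured plane\<close>

text \<open>Near \<open>\<xi>\<close> the difference \<open>f w - f \<xi>\<close> is the
  \<open>n\<close>-th power of a locally injective function, where \<open>n\<close> is the local
  degree. Hence each value has at most as many preimages there as a number has \<open>n\<close>-th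
  roots.\<close>

lemma local_valence_bound:
  assumes f: "f holomorphic_on S" and S: "open S" "connected S" "\<xi> \<in> S" "\<phi> \<in> S" "f \<phi> \<noteq> f \<xi>"
  obtains n r where "r > 0" "\<And>w. finite {z \<in> ball \<xi> r. f z = w}" "\<And>w. card {z \<in> ball \<xi> r. f z = w} \<le> n"
proof -
  define n where "n = (LEAST n. 0 < n \<and> (deriv ^^ n) f \<xi> \<noteq> 0)"
  have ex: "\<exists>n. 0 < n \<and> (deriv ^^ n) f \<xi> \<noteq> 0"
    using holomorphic_fun_eq_const_on_connected[OF f S(1,2) _ S(3,4)] S(5) by blast
  have n: "0 < n" "(deriv ^^ n) f \<xi> \<noteq> 0" "\<And>i. 0 < i \<Longrightarrow> i < n \<Longrightarrow> (deriv ^^ i) f \<xi> = 0"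
    using LeastI_ex[OF ex] not_less_Least unfolding n_def by blast+
  obtain g r where r: "0 < r" and g: "g holomorphic_on ball \<xi> r"
      "\<And>w. w \<in> ball \<xi> r \<Longrightarrow> f w - f \<xi> = ((w - \<xi>) * g w) ^ n" "\<And>w. w \<in> ball \<xi> r \<Longrightarrow> g w \<noteq> 0"
    by (rule holomorphic_factor_order_of_zero_strong[OF f S(1,3) n(1,2)], rule n(3), assumption+, rule that, assumption+)
  define \<psi> where "\<psi> = (\<lambda>w. (w - \<xi>) * g w)"
  have h\<psi>: "\<psi> holomorphic_on ball \<xi> r"
    unfolding \<psi>_def by (intro holomorphic_intros g(1))
  have "(g has_field_derivative deriv g \<xi>) (at \<xi>)"
    using g(1) r by (intro holomorphic_derivI[where S="ball \<xi> r"]) auto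
  then have "(\<psi> has_field_derivative g \<xi>) (at \<xi>)"
    unfolding \<psi>_def by (auto intro!: derivative_eq_intros)
  then have "deriv \<psi> \<xi> \<noteq> 0" using g(3)[of \<xi>] r by (simp add: DERIV_imp_deriv)
  then obtain r' where r': "r' > 0" "ball \<xi> r' \<subseteq> ball \<xi> r" "inj_on \<psi> (ball \<xi> r')"
    using has_complex_derivative_locally_injective[OF h\<psi>, of \<xi>] r by auto
  show thesis
  proof
    fix w
    let ?Z = "{z \<in> ball \<xi> r'. f z = w}"
    let ?R = "{x. x ^ n = w - f \<xi>}"
    have sub: "\<psi> ` ?Z \<subseteq> ?R" using g(2) r'(2) by (auto simp: \<psi>_def)
    have inj: "inj_on \<psi> ?Z" using r'(3) by (rule inj_on_subset) auto
    have fin: "finite ?R" using n(1) by (rule finite_nth_roots)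
    show "finite ?Z" using inj_on_finite[OF inj sub fin] .
    have "card ?Z \<le> card ?R" by (rule card_inj_on_le[OF inj sub fin])
    also have "card ?R \<le> n"
    proof (cases "w - f \<xi> = 0")
      case True
      then have "?R = {0}" using n(1) by auto
      then show ?thesis using n(1) by simp
    next
      case False
      then show ?thesis using card_nth_roots[of "w - f \<xi>" n] n(1) by simp
    qed
    finally show "card ?Z \<le> n" .
  qed (use r' in auto)
qed

text \<open>A nicely meromorphic function vanishes at its poles, so the conditions \<open>\<gamma> z \<noteq> 0\<close> below exclude
  the poles as well.\<close>

lemma nicely_meromorphic_avoids:
  assumes nm: "\<gamma> nicely_meromorphic_on UNIV" and nc: "\<gamma> a \<noteq> \<gamma> b"
  shows "connected {z. \<gamma> z \<noteq> c \<and> \<gamma> z \<noteq> d}" "eventually (\<lambda>z. \<gamma> z \<noteq> c \<and> \<gamma> z \<noteq> d) (at x)"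
proof -
  have 1: "\<forall>\<^sub>\<approx>x\<in>UNIV. \<gamma> x \<noteq> e" for e
    using nicely_meromorphic_imp_constant_or_avoid[OF nm, of e] nc by (metis UNIV_I connected_UNIV open_UNIV)
  have 2: "\<forall>\<^sub>\<approx>x\<in>UNIV. \<gamma> x \<noteq> c \<and> \<gamma> x \<noteq> d"
    using eventually_conj[OF 1[of c] 1[of d]] .
  then show "eventually (\<lambda>z. \<gamma> z \<noteq> c \<and> \<gamma> z \<noteq> d) (at x)"
    by (rule eventually_cosparse_imp_eventually_at) auto
  have "{x. \<not> (\<gamma> x \<noteq> c \<and> \<gamma> x \<noteq> d)} sparse_in UNIV"
    using 2 by (simp only: eventually_cosparse)
  then have "connected (UNIV - {x. \<not> (\<gamma> x \<noteq> c \<and> \<gamma> x \<noteq> d)})"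
    by (intro sparse_imp_connected) auto
  also have "UNIV - {x. \<not> (\<gamma> x \<noteq> c \<and> \<gamma> x \<noteq> d)} = {z. \<gamma> z \<noteq> c \<and> \<gamma> z \<noteq> d}" by auto
  finally show "connected {z. \<gamma> z \<noteq> c \<and> \<gamma> z \<noteq> d}" .
qed

lemma nicely_meromorphic_analytic_nz:
  assumes "\<gamma> nicely_meromorphic_on UNIV" "\<gamma> z \<noteq> 0"
  shows "\<gamma> analytic_on {z}"
proof (rule meromorphic_at_isCont_imp_analytic)
  have "\<gamma> meromorphic_on UNIV" "\<gamma> \<midarrow>z\<rightarrow> \<gamma> z"
    using assms unfolding nicely_meromorphic_on_def by auto
  then show "\<gamma> meromorphic_on {z}" "isCont \<gamma> z"
    by (auto simp: isCont_def intro: meromorphic_on_subset)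
qed

text \<open>Poles carry the value 0, so the equation does not tell poles from zeros. This is
  harmless: it is exploited only at points where \<open>\<gamma>\<close> is nonzero, over the twice
  punctured plane and at the preimages of 1.\<close>

definition symmetry_over :: "(complex \<Rightarrow> complex) \<Rightarrow> (complex \<Rightarrow> complex) \<Rightarrow> (complex \<Rightarrow> complex) \<Rightarrow> bool" where
  "symmetry_over \<gamma> \<eta> h \<longleftrightarrow> (\<exists>h' \<eta>'. homeomorphism UNIV UNIV h h' \<and> homeomorphism UNIV UNIV \<eta> \<eta>') \<and>
     \<eta> 0 = 0 \<and> \<eta> 1 = 1 \<and> (\<forall>z. \<gamma> (h z) = \<eta> (\<gamma> z))"

text \<open>For homeomorphisms fixing 0 and 1 this says that the orientation is preserved: otherwise
  \<open>\<eta> w = cnj w * exp (u w)\<close>.\<close>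

definition log_positive :: "(complex \<Rightarrow> complex) \<Rightarrow> bool" where
  "log_positive \<eta> \<longleftrightarrow> (\<exists>u. continuous_on (-{0}) u \<and> u 1 = 0 \<and> (\<forall>w. w \<noteq> 0 \<longrightarrow> \<eta> w = w * exp (u w)))"

text \<open>For \<open>z\<close> near a preimage \<open>d\<close> of 1, a track of the lifted
  homotopy joins \<open>h z\<close> to \<open>k z\<close> over a small disc around 1. On a small
  circle around \<open>h d\<close> the distance of \<open>\<gamma>\<close> from 1 is bounded below,
  so the track cannot cross this circle, and \<open>k z\<close> stays close to
  \<open>h d\<close>.\<close>

lemma deck_map_of_symmetry:
  assumes nm: "\<gamma> nicely_meromorphic_on UNIV"
    and cov: "covering_space {z. \<gamma> z \<noteq> 0 \<and> \<gamma> z \<noteq> 1} \<gamma> (-{0,1})"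
    and sym: "symmetry_over \<gamma> \<eta> h" "log_positive \<eta>"
  shows "\<exists>k. continuous_on {z. \<gamma> z \<noteq> 0 \<and> \<gamma> z \<noteq> 1} k \<and>
    (\<forall>z. \<gamma> z \<noteq> 0 \<longrightarrow> \<gamma> z \<noteq> 1 \<longrightarrow> \<gamma> (k z) = \<gamma> z) \<and> (\<forall>d. \<gamma> d = 1 \<longrightarrow> (k \<longlongrightarrow> h d) (at d))"
proof -
  let ?Y = "{z. \<gamma> z \<noteq> 0 \<and> \<gamma> z \<noteq> 1}"
  obtain h' \<eta>' where hom: "homeomorphism UNIV UNIV h h'" "homeomorphism UNIV UNIV \<eta> \<eta>'"
    and \<eta>: "\<eta> 0 = 0" "\<eta> 1 = 1" and eq: "\<And>z. \<gamma> (h z) = \<eta> (\<gamma> z)"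
    using sym by (auto simp: symmetry_over_def)
  have ch: "continuous_on UNIV h" and inj: "\<And>x y. \<eta> x = \<eta> y \<Longrightarrow> x = y"
    using hom by (auto simp: homeomorphism_def) metis
  obtain u where u: "continuous_on (-{0}) u" "u 1 = 0" "\<And>w. w \<noteq> 0 \<Longrightarrow> \<eta> w = w * exp (u w)"
    using sym(2) by (auto simp: log_positive_def)
  have hY: "h \<in> ?Y \<rightarrow> ?Y" using inj[of _ 0] inj[of _ 1] \<eta> by (auto simp: eq)
  obtain k where k: "continuous_on ?Y k" "k \<in> ?Y \<rightarrow> ?Y" "\<And>z. z \<in> ?Y \<Longrightarrow> \<gamma> (k z) = \<gamma> z"
    "\<And>\<rho>. \<rho> > 0 \<Longrightarrow> \<exists>\<delta>>0. \<forall>z\<in>?Y. norm (\<gamma> z - 1) < \<delta> \<longrightarrow>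
       (\<exists>c. path c \<and> (\<forall>t\<in>{0..1}. norm (\<gamma> (c t) - 1) < \<rho>) \<and> pathstart c = h z \<and> pathfinish c = k z)"
    using deck_map_of_lift[OF cov hom(2) \<eta> u continuous_on_subset[OF ch] hY] eq by auto
  have nc: "\<exists>a. \<gamma> a \<noteq> 1"
  proof -
    have "2 \<in> \<gamma> ` ?Y" using cov by (auto simp: covering_space_def)
    then obtain a where "\<gamma> a = 2" by auto
    then show ?thesis by (intro exI[of _ a]) auto
  qed
  have "(k \<longlongrightarrow> h d) (at d)" if d: "\<gamma> d = 1" for d
  proof (rule tendstoI)
    fix e :: real assume e: "e > 0"
    have hd: "\<gamma> (h d) = 1" using eq[of d] d \<eta> by simp
    obtain a where "\<gamma> a \<noteq> \<gamma> d" using nc d by auto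
    note avoid = nicely_meromorphic_avoids(2)[OF nm this]
    obtain e1 where e1: "e1 > 0" "\<And>z. z \<noteq> h d \<Longrightarrow> dist z (h d) < e1 \<Longrightarrow> \<gamma> z \<noteq> 0 \<and> \<gamma> z \<noteq> 1"
      using avoid[of 0 1 "h d"] by (auto simp: eventually_at)
    define \<epsilon> where "\<epsilon> = min e e1 / 2"
    have \<epsilon>: "\<epsilon> > 0" "\<epsilon> < e" "\<epsilon> < e1" using e e1 by (auto simp: \<epsilon>_def min_def)
    have nz: "\<gamma> z \<noteq> 0" if "z \<in> cball (h d) \<epsilon>" for z
      using e1(2)[of z] that \<epsilon> hd by (cases "z = h d") (auto simp: dist_commute)
    have c\<gamma>: "continuous_on (cball (h d) \<epsilon>) \<gamma>"
      by (intro continuous_at_imp_continuous_on ballI analytic_at_imp_isCont nicely_meromorphic_analytic_nz[OF nm nz])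
    have "\<exists>x\<in>sphere (h d) \<epsilon>. \<forall>y\<in>sphere (h d) \<epsilon>. norm (\<gamma> x - 1) \<le> norm (\<gamma> y - 1)"
      by (intro continuous_attains_inf continuous_intros continuous_on_subset[OF c\<gamma>]) (use \<epsilon> in auto)
    then obtain x where x: "x \<in> sphere (h d) \<epsilon>" "\<And>y. y\<in>sphere (h d) \<epsilon> \<Longrightarrow> norm (\<gamma> x - 1) \<le> norm (\<gamma> y - 1)"
      by blast
    have "norm (\<gamma> x - 1) > 0" using e1(2)[of x] x(1) \<epsilon> by (auto simp: dist_commute)
    then obtain \<delta> where \<delta>: "\<delta> > 0" "\<And>z. z \<in> ?Y \<Longrightarrow> norm (\<gamma> z - 1) < \<delta> \<Longrightarrow>
        \<exists>c. path c \<and> (\<forall>t\<in>{0..1}. norm (\<gamma> (c t) - 1) < norm (\<gamma> x - 1)) \<and> pathstart c = h z \<and> pathfinish c = k z"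
      using k(4) by meson
    have 1: "\<forall>\<^sub>F z in at d. z \<in> ?Y" using avoid[of 0 1 d] by simp
    have "isCont \<gamma> d" using nicely_meromorphic_analytic_nz[OF nm, of d] d by (simp add: analytic_at_imp_isCont)
    then have 2: "\<forall>\<^sub>F z in at d. norm (\<gamma> z - 1) < \<delta>"
      using tendstoD[of \<gamma> 1 "at d" \<delta>] \<delta>(1) d by (simp add: isCont_def dist_norm)
    have "isCont h d" using ch by (simp add: continuous_on_eq_continuous_at)
    then have 3: "\<forall>\<^sub>F z in at d. dist (h z) (h d) < \<epsilon>"
      using tendstoD[of h "h d" "at d" \<epsilon>] \<epsilon>(1) by (simp add: isCont_def)
    show "\<forall>\<^sub>F z in at d. dist (k z) (h d) < e"
      using 1 2 3
    proof eventually_elim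
      case (elim z)
      obtain c where c: "path c" "\<And>t. t\<in>{0..1} \<Longrightarrow> norm (\<gamma> (c t) - 1) < norm (\<gamma> x - 1)"
        "pathstart c = h z" "pathfinish c = k z"
        using \<delta>(2)[OF elim(1,2)] by blast
      have "path_image c \<inter> frontier (ball (h d) \<epsilon>) = {}"
        using c(2) x(2) \<epsilon> by (fastforce simp: path_image_def)
      moreover have "path_image c \<inter> ball (h d) \<epsilon> \<noteq> {}"
        using elim(3) c(3) pathstart_in_path_image[of c] by (auto simp: dist_commute)
      ultimately have "path_image c \<subseteq> ball (h d) \<epsilon>"
        using connected_Int_frontier[of "path_image c" "ball (h d) \<epsilon>"] connected_path_image[OF c(1)] by blast
      then show ?case using c(4) pathfinish_in_path_image[of c] \<epsilon> by (auto simp: dist_commute)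
    qed
  qed
  then show ?thesis using k(1,3) by (intro exI[of _ k]) auto
qed

text \<open>A deck transformation is determined by its value at one point. Near the fixed point \<open>p\<close> the
  number of possible values is bounded by the local valence of \<open>\<gamma>\<close>.\<close>

lemma finite_positive_orbit:
  assumes nm: "\<gamma> nicely_meromorphic_on UNIV"
    and cov: "covering_space {z. \<gamma> z \<noteq> 0 \<and> \<gamma> z \<noteq> 1} \<gamma> (-{0,1})"
    and p: "\<gamma> p = 1" and s: "\<gamma> s = 1"
  shows "finite {h s | h \<eta>. symmetry_over \<gamma> \<eta> h \<and> log_positive \<eta> \<and> h p = p}" (is "finite ?O")
proof (rule ccontr)
  let ?Y = "{z. \<gamma> z \<noteq> 0 \<and> \<gamma> z \<noteq> 1}"
  assume inf: "infinite ?O"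
  have "2 \<in> \<gamma> ` ?Y" using cov by (auto simp: covering_space_def)
  then obtain a where a: "\<gamma> a = 2" by auto
  have nc: "\<gamma> a \<noteq> \<gamma> p" using a p by simp
  note avoid = nicely_meromorphic_avoids[OF nm nc]
  have conY: "connected ?Y" using avoid(1) .
  have evp: "eventually (\<lambda>z. \<gamma> z \<noteq> 0 \<and> \<gamma> z \<noteq> 1) (at x)" for x using avoid(2) .
  define U where "U = {z. \<gamma> z \<noteq> 0}"
  have "\<gamma> analytic_on U"
    unfolding U_def by (subst analytic_on_analytic_at) (auto intro: nicely_meromorphic_analytic_nz[OF nm])
  then have hU: "\<gamma> holomorphic_on U" by (rule analytic_imp_holomorphic)
  have coU: "connected U" using avoid(1)[of 0 0] by (simp add: U_def)
  have opU: "open U"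
  proof -
    have "\<exists>e>0. ball z e \<subseteq> U" if "z \<in> U" for z
    proof -
      have "isCont \<gamma> z" using nicely_meromorphic_analytic_nz[OF nm, of z] that
        by (simp add: analytic_at_imp_isCont U_def)
      then have "eventually (\<lambda>x. \<gamma> x \<noteq> 0) (nhds z)"
        using that by (simp add: isCont_def tendsto_imp_eventually_ne U_def eventually_nhds_conv_at)
      then show ?thesis by (auto simp: eventually_nhds_metric U_def dist_commute subset_iff)
    qed
    then show ?thesis by (simp add: open_contains_ball)
  qed
  have "p \<in> U" "a \<in> U" using p a by (auto simp: U_def)
  then obtain n r where r: "r > 0" "\<And>w. finite {z \<in> ball p r. \<gamma> z = w}" "\<And>w. card {z \<in> ball p r. \<gamma> z = w} \<le> n"
    using local_valence_bound[OF hU opU coU _ _ nc] by metis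
  \<comment> \<open>One more value than the valence allows: at a point \<open>z1\<close> near
    \<open>p\<close> all the corresponding deck maps take values near \<open>p\<close> in one fibre,
    so two of them coincide at \<open>z1\<close>, hence everywhere, and have the same limit at
    \<open>s\<close>.\<close>
  obtain T where T: "T \<subseteq> ?O" "card T = Suc n" "finite T"
    using infinite_arbitrarily_large[OF inf, of "Suc n"] by auto
  define P where "P t k \<longleftrightarrow> continuous_on ?Y k \<and> (\<forall>z\<in>?Y. \<gamma> (k z) = \<gamma> z) \<and> (k \<longlongrightarrow> p) (at p) \<and> (k \<longlongrightarrow> t) (at s)" for t k
  have "\<exists>k. P t k" if "t \<in> T" for t
  proof -
    have "t \<in> ?O" using T(1) that by blast
    then obtain h \<eta> where h: "t = h s" "symmetry_over \<gamma> \<eta> h" "log_positive \<eta>" "h p = p" by blast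
    obtain k where k: "continuous_on ?Y k \<and>
        (\<forall>z. \<gamma> z \<noteq> 0 \<longrightarrow> \<gamma> z \<noteq> 1 \<longrightarrow> \<gamma> (k z) = \<gamma> z) \<and> (\<forall>d. \<gamma> d = 1 \<longrightarrow> (k \<longlongrightarrow> h d) (at d))"
      using deck_map_of_symmetry[OF nm cov h(2,3)] ..
    have "(k \<longlongrightarrow> h p) (at p)" "(k \<longlongrightarrow> h s) (at s)" using k p s by blast+
    then have "P t k" unfolding P_def using k h(1,4) by simp
    then show ?thesis by (rule exI[of _ k])
  qed
  then have "\<forall>t\<in>T. \<exists>k. P t k" ..
  from bchoice[OF this] obtain k where kP: "\<forall>t\<in>T. P t (k t)" ..
  have k: "\<And>t. t \<in> T \<Longrightarrow> continuous_on ?Y (k t)" "\<And>t z. t \<in> T \<Longrightarrow> z \<in> ?Y \<Longrightarrow> \<gamma> (k t z) = \<gamma> z"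
     "\<And>t. t \<in> T \<Longrightarrow> (k t \<longlongrightarrow> p) (at p)" "\<And>t. t \<in> T \<Longrightarrow> (k t \<longlongrightarrow> t) (at s)"
    using kP unfolding P_def by meson+
  have "eventually (\<lambda>z. \<forall>t\<in>T. dist (k t z) p < r) (at p)"
    using T(3) k(3) r(1) by (auto simp: eventually_ball_finite_distrib tendsto_iff)
  then have "eventually (\<lambda>z. z \<in> ?Y \<and> (\<forall>t\<in>T. dist (k t z) p < r)) (at p)"
    using evp[of p] by eventually_elim auto
  from eventually_happens'[OF _ this]
  obtain z1 where z1: "z1 \<in> ?Y" "\<And>t. t \<in> T \<Longrightarrow> dist (k t z1) p < r" by auto
  have "(\<lambda>t. k t z1) ` T \<subseteq> {z \<in> ball p r. \<gamma> z = \<gamma> z1}"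
    using z1 k(2) by (auto simp: dist_commute)
  then have "card ((\<lambda>t. k t z1) ` T) \<le> n"
    using card_mono[OF r(2)] r(3) le_trans by blast
  then have "\<not> inj_on (\<lambda>t. k t z1) T" using T(2) card_image[of "\<lambda>t. k t z1" T] by auto
  then obtain t t' where t: "t \<in> T" "t' \<in> T" "t \<noteq> t'" "k t z1 = k t' z1" by (auto simp: inj_on_def)
  have im: "k t \<in> ?Y \<rightarrow> ?Y" if "t \<in> T" for t using k(2)[OF that] by auto
  have c\<gamma>: "continuous_on ?Y \<gamma>" using cov by (simp add: covering_space_def)
  have "k t z = k t' z" if "z \<in> ?Y" for z
    by (rule covering_space_lift_unique[OF cov t(4) c\<gamma> _ k(1)[OF t(1)] im[OF t(1)] _ k(1)[OF t(2)] im[OF t(2)] _ conY z1(1) that])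
      (use k(2) t in auto)
  then have "eventually (\<lambda>z. k t z = k t' z) (at s)"
    using evp[of s] by (auto elim!: eventually_mono)
  then have "(k t \<longlongrightarrow> t') (at s)" using k(4)[OF t(2)] tendsto_cong by fastforce
  then show False using k(4)[OF t(1)] t(3) tendsto_unique trivial_limit_at by blast
qed

section \<open>Composition of symmetries and their orbits\<close>

lemma symmetry_over_cases:
  assumes "symmetry_over \<gamma> \<eta> h"
  shows "log_positive \<eta> \<or> (\<exists>u. continuous_on (-{0}) u \<and> u 1 = 0 \<and> (\<forall>w. w \<noteq> 0 \<longrightarrow> \<eta> w = cnj w * exp (u w)))"
proof -
  obtain \<eta>' where "homeomorphism UNIV UNIV \<eta> \<eta>'" "\<eta> 0 = 0" "\<eta> 1 = 1"
    using assms by (auto simp: symmetry_over_def)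
  then show ?thesis unfolding log_positive_def by (metis plane_homeomorphism_log)
qed

lemma symmetry_over_id: "symmetry_over \<gamma> id id"
proof -
  have "homeomorphism UNIV UNIV id (id :: complex \<Rightarrow> complex)" by (rule homeomorphismI) simp_all
  then show ?thesis unfolding symmetry_over_def by (metis id_apply)
qed

lemma symmetry_over_comp:
  assumes "symmetry_over \<gamma> \<eta>1 h1" "symmetry_over \<gamma> \<eta>2 h2"
  shows "symmetry_over \<gamma> (\<eta>1 \<circ> \<eta>2) (h1 \<circ> h2)"
proof -
  obtain h1' h2' \<eta>1' \<eta>2' where "homeomorphism UNIV UNIV h1 h1'" "homeomorphism UNIV UNIV h2 h2'"
    "homeomorphism UNIV UNIV \<eta>1 \<eta>1'" "homeomorphism UNIV UNIV \<eta>2 \<eta>2'"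
    using assms unfolding symmetry_over_def by blast
  then have "homeomorphism UNIV UNIV (h1 \<circ> h2) (h2' \<circ> h1')" "homeomorphism UNIV UNIV (\<eta>1 \<circ> \<eta>2) (\<eta>2' \<circ> \<eta>1')"
    by (auto intro: homeomorphism_compose)
  then show ?thesis using assms unfolding symmetry_over_def by auto
qed

lemma symmetry_over_inverse:
  assumes "symmetry_over \<gamma> \<eta> h"
  shows "\<exists>\<eta>' h'. symmetry_over \<gamma> \<eta>' h' \<and> (\<forall>z. h' (h z) = z) \<and> (\<forall>z. \<eta> (\<eta>' z) = z)"
proof -
  obtain h' \<eta>' where hom: "homeomorphism UNIV UNIV h h'" "homeomorphism UNIV UNIV \<eta> \<eta>'"
    and \<eta>: "\<eta> 0 = 0" "\<eta> 1 = 1" and eq: "\<And>z. \<gamma> (h z) = \<eta> (\<gamma> z)"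
    using assms by (auto simp: symmetry_over_def)
  have inv: "h' (h z) = z" "h (h' z) = z" "\<eta>' (\<eta> z) = z" "\<eta> (\<eta>' z) = z" for z
    using hom by (auto simp: homeomorphism_def)
  have "\<gamma> (h' z) = \<eta>' (\<gamma> z)" for z using eq[of "h' z"] inv by metis
  moreover have "\<eta>' 0 = 0" "\<eta>' 1 = 1" using inv(3) \<eta> by metis+
  ultimately have "symmetry_over \<gamma> \<eta>' h'"
    using hom homeomorphism_symD unfolding symmetry_over_def by blast
  then show ?thesis using inv by blast
qed

text \<open>The two conjugations cancel: \<open>cnj (\<eta>2' w)\<close> is \<open>w\<close> divided
  by \<open>exp (u2 (\<eta>2' w))\<close>, and this can be substituted in the formula for
  \<open>\<eta>1\<close>.\<close>

lemma log_positive_of_neg_neg: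
  assumes u1: "continuous_on (-{0}) u1" "u1 1 = 0" "\<And>w. w \<noteq> 0 \<Longrightarrow> \<eta>1 w = cnj w * exp (u1 w)"
    and u2: "continuous_on (-{0}) u2" "u2 1 = 0" "\<And>w. w \<noteq> 0 \<Longrightarrow> \<eta>2 w = cnj w * exp (u2 w)"
    and inv: "\<And>w. \<eta>2 (\<eta>2' w) = w" "\<eta>2' 1 = 1" "\<eta>2 0 = 0" "continuous_on UNIV \<eta>2'"
  shows "log_positive (\<eta>1 \<circ> \<eta>2')"
  unfolding log_positive_def
proof (intro exI conjI allI impI)
  have nz: "\<eta>2' w \<noteq> 0" if "w \<noteq> 0" for w using inv(1)[of w] inv(3) that by metis
  show "continuous_on (-{0}) (\<lambda>w. u1 (\<eta>2' w) - u2 (\<eta>2' w))"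
  proof -
    have c': "continuous_on (-{0}) \<eta>2'" by (rule continuous_on_subset[OF inv(4)]) simp
    have im: "\<eta>2' ` (-{0}) \<subseteq> -{0}"
    proof (rule image_subsetI)
      fix w :: complex assume "w \<in> -{0}"
      then show "\<eta>2' w \<in> -{0}" using nz[of w] by simp
    qed
    show ?thesis
      by (rule continuous_on_diff[OF continuous_on_compose2[OF u1(1) c' im] continuous_on_compose2[OF u2(1) c' im]])
  qed
  show "u1 (\<eta>2' 1) - u2 (\<eta>2' 1) = 0" using inv u1 u2 by simp
  fix w :: complex assume w: "w \<noteq> 0"
  have "w = cnj (\<eta>2' w) * exp (u2 (\<eta>2' w))" using inv(1)[of w] u2(3)[OF nz[OF w]] by simp
  then show "(\<eta>1 \<circ> \<eta>2') w = w * exp (u1 (\<eta>2' w) - u2 (\<eta>2' w))"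
        using u1(3)[OF nz[OF w]]
    by (metis (no_types, opaque_lifting) comp_apply exp_diff exp_not_eq_zero mult.assoc nonzero_mult_div_cancel_left times_divide_eq_right)
qed

text \<open>Fix one orientation-reversing symmetry \<open>h2\<close>. Any other one,
  \<open>h1\<close>, is a preserving symmetry after \<open>h2\<close>, so its value at
  \<open>s\<close> lies in the preserving orbit of \<open>h2 s\<close>, which is finite as
  well.\<close>

lemma finite_symmetry_orbit:
  assumes nm: "\<gamma> nicely_meromorphic_on UNIV"
    and cov: "covering_space {z. \<gamma> z \<noteq> 0 \<and> \<gamma> z \<noteq> 1} \<gamma> (-{0,1})"
    and p: "\<gamma> p = 1" and s: "\<gamma> s = 1"
  shows "finite {h s | h \<eta>. symmetry_over \<gamma> \<eta> h \<and> h p = p}" (is "finite ?O")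
proof -
  define Op where "Op s = {h s | h \<eta>. symmetry_over \<gamma> \<eta> h \<and> log_positive \<eta> \<and> h p = p}" for s
  define Om where "Om = {h s | h \<eta>. symmetry_over \<gamma> \<eta> h \<and> \<not> log_positive \<eta> \<and> h p = p}"
  have "?O \<subseteq> Op s \<union> Om" by (auto simp: Op_def Om_def)
  moreover have "finite (Op s)" unfolding Op_def by (rule finite_positive_orbit[OF nm cov p s])
  moreover have "finite Om"
  proof (cases "Om = {}")
    case False
    then obtain h2 \<eta>2 where h2: "symmetry_over \<gamma> \<eta>2 h2" "\<not> log_positive \<eta>2" "h2 p = p" by (auto simp: Om_def)
    have "\<gamma> (h2 s) = 1" using h2(1) s by (auto simp: symmetry_over_def)
    then have "finite (Op (h2 s))" unfolding Op_def by (rule finite_positive_orbit[OF nm cov p])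
    moreover have "Om \<subseteq> Op (h2 s)"
    proof
      fix x assume "x \<in> Om"
      then obtain h1 \<eta>1 where h1: "x = h1 s" "symmetry_over \<gamma> \<eta>1 h1" "\<not> log_positive \<eta>1" "h1 p = p" by (auto simp: Om_def)
      obtain \<eta>' h' where i: "symmetry_over \<gamma> \<eta>' h'" "\<forall>z. h' (h2 z) = z" "\<forall>z. \<eta>2 (\<eta>' z) = z"
        using symmetry_over_inverse[OF h2(1)] by blast
      obtain u1 where u1: "continuous_on (-{0}) u1" "u1 1 = 0" "\<And>w. w \<noteq> 0 \<Longrightarrow> \<eta>1 w = cnj w * exp (u1 w)"
        using symmetry_over_cases[OF h1(2)] h1(3) by blast
      obtain u2 where u2: "continuous_on (-{0}) u2" "u2 1 = 0" "\<And>w. w \<noteq> 0 \<Longrightarrow> \<eta>2 w = cnj w * exp (u2 w)"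
        using symmetry_over_cases[OF h2(1)] h2(2) by blast
      have "log_positive (\<eta>1 \<circ> \<eta>')"
        by (rule log_positive_of_neg_neg[OF u1 u2 i(3)[rule_format]])
          (use i(1) h2(1) in \<open>auto simp: symmetry_over_def homeomorphism_def\<close>)
      moreover have "symmetry_over \<gamma> (\<eta>1 \<circ> \<eta>') (h1 \<circ> h')" by (rule symmetry_over_comp[OF h1(2) i(1)])
      moreover have "(h1 \<circ> h') p = p" using i(2)[rule_format, of p] h1 h2 by simp
      moreover have "(h1 \<circ> h') (h2 s) = x" using i(2) h1 by simp
      ultimately show "x \<in> Op (h2 s)" unfolding Op_def by blast
    qed
    ultimately show ?thesis by (rule finite_subset[rotated])
  qed auto
  ultimately show ?thesis by (meson finite_Un finite_subset)
qed

text \<open>The symmetries fixing \<open>p\<close> form a group, so their orbits are disjoint or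
  equal. Finite orbits can cover an infinite set only if there are infinitely many of them;
  \<open>B\<close> takes one representative of each orbit that meets \<open>A\<close>.\<close>

lemma infinite_inequivalent_subset:
  assumes nm: "\<gamma> nicely_meromorphic_on UNIV"
    and cov: "covering_space {z. \<gamma> z \<noteq> 0 \<and> \<gamma> z \<noteq> 1} \<gamma> (-{0,1})"
    and p: "\<gamma> p = 1" and A: "infinite A" "\<And>s. s \<in> A \<Longrightarrow> \<gamma> s = 1"
  obtains B where "B \<subseteq> A" "infinite B"
    "\<And>s s' h \<eta>. s \<in> B \<Longrightarrow> s' \<in> B \<Longrightarrow> symmetry_over \<gamma> \<eta> h \<Longrightarrow> h p = p \<Longrightarrow> h s = s' \<Longrightarrow> s = s'"
proof -
  define orb where "orb s = {h s | h \<eta>. symmetry_over \<gamma> \<eta> h \<and> h p = p}" for s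
  have fin: "finite (orb s)" if "s \<in> A" for s
    unfolding orb_def by (rule finite_symmetry_orbit[OF nm cov p A(2)[OF that]])
  have self: "s \<in> orb s" for s unfolding orb_def by (intro CollectI exI[of _ id]) (auto simp: symmetry_over_id)
  have sub: "orb (h s) \<subseteq> orb s" if "symmetry_over \<gamma> \<eta> h" "h p = p" for s h \<eta>
  proof
    fix x assume "x \<in> orb (h s)"
    then obtain h1 \<eta>1 where "symmetry_over \<gamma> \<eta>1 h1" "h1 p = p" "x = (h1 \<circ> h) s" by (auto simp: orb_def)
    then show "x \<in> orb s" using symmetry_over_comp[of \<gamma> \<eta>1 h1 \<eta> h] that unfolding orb_def
      by (smt (verit) comp_apply mem_Collect_eq)
  qed
  have orb_eq: "orb (h s) = orb s" if h: "symmetry_over \<gamma> \<eta> h" "h p = p" for s h \<eta>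
  proof -
    obtain \<eta>' h' where i: "symmetry_over \<gamma> \<eta>' h'" "\<forall>z. h' (h z) = z"
      using symmetry_over_inverse[OF h(1)] by blast
    have "h' p = p" using i(2)[rule_format, of p] h by simp
    then have "orb (h' (h s)) \<subseteq> orb (h s)" by (rule sub[OF i(1)])
    then show ?thesis using sub[OF h] i(2) by auto
  qed
  have "infinite (orb ` A)"
  proof
    assume "finite (orb ` A)"
    then obtain s0 where s0: "s0 \<in> A" "infinite {s \<in> A. orb s = orb s0}"
      using pigeonhole_infinite[OF A(1)] by blast
    have "{s \<in> A. orb s = orb s0} \<subseteq> orb s0" using self by auto
    then show False using s0 fin finite_subset by blast
  qed
  moreover obtain B where B: "B \<subseteq> A" "inj_on orb B" "orb ` B = orb ` A"
    by (metis subset_image_inj order_refl)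
  ultimately have "infinite B" by (metis finite_imageI)
  moreover have "s = s'" if "s \<in> B" "s' \<in> B" "symmetry_over \<gamma> \<eta> h" "h p = p" "h s = s'" for s s' h \<eta>
    using orb_eq[OF that(3,4), of s] that B(2) by (auto simp: inj_on_def)
  ultimately show thesis using that B(1) by blast
qed

section \<open>Singular values and coverings\<close>

definition regular_value :: "(complex \<Rightarrow> complex option) \<Rightarrow> complex option \<Rightarrow> bool" where
  "regular_value g q \<longleftrightarrow> (\<exists>V. openin riemann_sphere V \<and> q \<in> V \<and>
     (\<forall>C \<in> components (g -` V). homeomorphic_map (top_of_set C) (subtopology riemann_sphere V) g))"

lemma singular_set_iff: "q \<in> singular_set g \<longleftrightarrow> \<not> regular_value g q"
  by (simp only: singular_set_def regular_value_def mem_Collect_eq)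

lemma regular_value_comp_left:
  assumes \<phi>: "homeomorphic_map riemann_sphere riemann_sphere \<phi>" and q: "regular_value g q"
  shows "regular_value (\<phi> \<circ> g) (\<phi> q)"
proof -
  obtain V where V: "openin riemann_sphere V" "q \<in> V"
    "\<And>C. C \<in> components (g -` V) \<Longrightarrow> homeomorphic_map (top_of_set C) (subtopology riemann_sphere V) g"
    using q by (auto simp: regular_value_def)
  have inj: "inj \<phi>" using homeomorphic_imp_injective_map[OF \<phi>] by simp
  have "openin riemann_sphere (\<phi> ` V)"
    using homeomorphic_imp_open_map[OF \<phi>] V(1) by (simp add: open_map_def)
  moreover have "(\<phi> \<circ> g) -` (\<phi> ` V) = g -` V" by (auto dest: injD[OF inj])
  moreover have "homeomorphic_map (subtopology riemann_sphere V) (subtopology riemann_sphere (\<phi> ` V)) \<phi>"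
    by (rule homeomorphic_map_subtopologies[OF \<phi>]) simp
  then have "homeomorphic_map (top_of_set C) (subtopology riemann_sphere (\<phi> ` V)) (\<phi> \<circ> g)"
    if "C \<in> components (g -` V)" for C
    by (rule homeomorphic_map_compose[OF V(3)[OF that]])
  ultimately show ?thesis
    unfolding regular_value_def using V(2) by (intro exI[of _ "\<phi> ` V"]) auto
qed

lemma singular_set_comp_left:
  assumes \<phi>: "homeomorphic_map riemann_sphere riemann_sphere \<phi>"
  shows "singular_set (\<phi> \<circ> g) = \<phi> ` singular_set g"
proof -
  obtain \<psi> where \<psi>: "homeomorphic_map riemann_sphere riemann_sphere \<psi>" "\<And>x. \<psi> (\<phi> x) = x" "\<And>x. \<phi> (\<psi> x) = x"
    using \<phi> by (auto simp: homeomorphic_map_maps homeomorphic_maps_def)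
  have g: "\<psi> \<circ> (\<phi> \<circ> g) = g" using \<psi> by auto
  have "regular_value (\<phi> \<circ> g) (\<phi> q) \<longleftrightarrow> regular_value g q" for q
    using regular_value_comp_left[OF \<phi>, of g q] regular_value_comp_left[OF \<psi>(1), of "\<phi> \<circ> g" "\<phi> q"]
    by (auto simp: g \<psi>)
  then have "\<phi> q \<in> singular_set (\<phi> \<circ> g) \<longleftrightarrow> q \<in> singular_set g" for q by (simp add: singular_set_iff)
  then show ?thesis using \<psi>(3) by (auto simp: image_iff) metis
qed

lemma regular_value_comp_right:
  assumes h: "homeomorphism UNIV UNIV h h'" and q: "regular_value g q"
  shows "regular_value (g \<circ> h) q"
proof -
  have inv: "h' (h z) = z" "h (h' z) = z" and c: "continuous_on UNIV h" "continuous_on UNIV h'" for z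
    using h by (auto simp: homeomorphism_def)
  obtain V where V: "openin riemann_sphere V" "q \<in> V"
    "\<And>C. C \<in> components (g -` V) \<Longrightarrow> homeomorphic_map (top_of_set C) (subtopology riemann_sphere V) g"
    using q by (auto simp: regular_value_def)
  have "homeomorphic_map (top_of_set C) (subtopology riemann_sphere V) (g \<circ> h)"
    if C: "C \<in> components ((g \<circ> h) -` V)" for C
  proof -
    have conn: "connected (h ` D)" "connected (h' ` D)" if "connected D" for D
      using that c by (auto intro: connected_continuous_image continuous_on_subset)
    have C1: "C \<noteq> {}" "C \<subseteq> (g \<circ> h) -` V" "connected C"
      and C2: "\<And>D. D \<noteq> {} \<Longrightarrow> C \<subseteq> D \<Longrightarrow> D \<subseteq> (g \<circ> h) -` V \<Longrightarrow> connected D \<Longrightarrow> D = C"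
      using C unfolding in_components_maximal by auto
    have "h ` C \<in> components (g -` V)"
      unfolding in_components_maximal
    proof (intro conjI allI impI)
      show "h ` C \<noteq> {}" "h ` C \<subseteq> g -` V" "connected (h ` C)"
        using C1 conn(1) by auto
      fix D assume D: "D \<noteq> {} \<and> h ` C \<subseteq> D \<and> D \<subseteq> g -` V \<and> connected D"
      have "h' ` D = C"
      proof (rule C2)
        show "C \<subseteq> h' ` D"
        proof
          fix x assume "x \<in> C"
          then have "h x \<in> D" using D by blast
          then show "x \<in> h' ` D" using inv(1)[of x] by (metis imageI)
        qed
        show "h' ` D \<subseteq> (g \<circ> h) -` V" using D by (auto simp: inv)
      qed (use D conn(2) in auto)
      then have "h ` h' ` D = h ` C" by simp
      then show "D = h ` C" by (simp add: image_image inv)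
    qed
    then have "homeomorphic_map (top_of_set (h ` C)) (subtopology riemann_sphere V) g" by (rule V(3))
    moreover have "homeomorphic_map (top_of_set C) (top_of_set (h ` C)) h"
    proof -
      have "homeomorphic_map euclidean euclidean h"
        using h by (auto simp: homeomorphic_map_maps homeomorphic_maps_def homeomorphism_def)
      then show ?thesis by (rule homeomorphic_map_subtopologies) simp
    qed
    ultimately show ?thesis by (rule homeomorphic_map_compose[rotated])
  qed
  then show ?thesis using V unfolding regular_value_def by blast
qed

lemma singular_set_comp_right:
  assumes h: "homeomorphism UNIV UNIV h h'"
  shows "singular_set (g \<circ> h) = singular_set g"
proof -
  have "g \<circ> h \<circ> h' = g" using h by (auto simp: homeomorphism_def)
  then show ?thesis
    using regular_value_comp_right[OF h, of g] regular_value_comp_right[OF homeomorphism_symD[OF h], of "g \<circ> h"]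
    by (auto simp: singular_set_iff)
qed

text \<open>The set \<open>S\<close> may exceed the singular set, because 1 is needed as a puncture
  even when it is a regular value.\<close>

lemma covering_space_off_singular_set:
  assumes f: "f nicely_meromorphic_on UNIV" and t: "transcendental_meromorphic (sphere_map f)"
    and S: "singular_set (sphere_map f) \<subseteq> S" "None \<in> S" "finite S"
  shows "covering_space {z. \<not> is_pole f z \<and> Some (f z) \<notin> S} f {w. Some w \<notin> S}" (is "covering_space ?Y f ?X")
proof
  let ?g = "sphere_map f"
  have cg: "continuous_map euclidean riemann_sphere ?g" by (rule continuous_map_sphere_map[OF f])
  have an: "f analytic_on {z}" if "z \<in> ?Y" for z
    using nicely_meromorphic_on_imp_analytic_at[OF f] that by simp
  then show cf: "continuous_on ?Y f"
    by (intro continuous_at_imp_continuous_on ballI analytic_at_imp_isCont)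
  have openg: "open (?g -` V)" if "openin riemann_sphere V" for V
    using openin_continuous_map_preimage[OF cg that] by (simp add: vimage_def)
  have gY: "?g z = Some (f z)" if "z \<in> ?Y" for z using that by (simp add: sphere_map_def)
  have reg: "\<exists>V. openin riemann_sphere V \<and> Some w \<in> V \<and>
     (\<forall>C \<in> components (?g -` V). homeomorphic_map (top_of_set C) (subtopology riemann_sphere V) ?g)" if "w \<in> ?X" for w
    using that S(1) singular_set_iff[of "Some w" ?g] by (auto simp: regular_value_def)
  show "f ` ?Y = ?X"
  proof (intro equalityI subsetI)
    fix w assume w: "w \<in> ?X"
    then obtain V where V: "openin riemann_sphere V" "Some w \<in> V"
     "\<forall>C \<in> components (?g -` V). homeomorphic_map (top_of_set C) (subtopology riemann_sphere V) ?g"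
      using reg[of w] by blast
    \<comment> \<open>A set \<open>V\<close> without preimages satisfies the condition for regular
      values vacuously. Surjectivity needs Picard's theorem: the omitted values are finite in number
      and cannot fill a nonempty open set.\<close>
    have "?g -` V \<noteq> {}"
    proof
      assume "?g -` V = {}"
      then have "V \<subseteq> {v. finite (?g -` {v})}" by (auto simp: vimage_def) (metis (mono_tags, lifting) Collect_empty_eq finite.emptyI)
      then have "finite V" using finite_exceptional_values[OF t] finite_subset by blast
      then have "finite (Some -` V)" by (intro finite_vimageI) auto
      moreover have "open (Some -` V)" "Some -` V \<noteq> {}" using V by (auto simp: openin_riemann_sphere)
      ultimately show False using finite_imp_not_open by blast
    qed
    then obtain C where C: "C \<in> components (?g -` V)" using components_eq_empty by blast
    then have "?g ` C = V"
      using homeomorphic_imp_surjective_map[OF bspec[OF V(3) C]] openin_subset[OF V(1)] by simp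
    then obtain z where "?g z = Some w" using V(2) by (metis imageE)
    then show "w \<in> f ` ?Y" using w by (auto simp: sphere_map_def image_iff split: if_splits)
  qed auto
  fix w assume w: "w \<in> ?X"
  then obtain V where V: "openin riemann_sphere V" "Some w \<in> V"
     "\<forall>C \<in> components (?g -` V). homeomorphic_map (top_of_set C) (subtopology riemann_sphere V) ?g"
    using reg[of w] by blast
  define T where "T = {x \<in> ?X. Some x \<in> V}"
  have opX: "open ?X"
  proof -
    have "?X = - (Some -` S)" by auto
    moreover have "finite (Some -` S)" using S(3) by (intro finite_vimageI) auto
    ultimately show ?thesis by (simp add: finite_imp_closed open_Compl)
  qed
  have opT: "open T"
  proof -
    have "T = ?X \<inter> Some -` V" by (auto simp: T_def)
    then show ?thesis using opX V(1) by (simp add: openin_riemann_sphere open_Int)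
  qed
  \<comment> \<open>Since \<open>V\<close> may contain \<infinity> or points of \<open>S\<close>,
    the sheets over the smaller set \<open>T\<close> are cut out of the components over
    \<open>V\<close>; they need not be components themselves.\<close>
  define v where "v = (\<lambda>C. C \<inter> ?g -` (Some ` T)) ` components (?g -` V)"
  have opT': "openin riemann_sphere (Some ` T)" using opT by (simp add: riemann_sphere_def)
  have TY: "z \<in> ?Y \<and> f z \<in> T \<longleftrightarrow> ?g z \<in> Some ` T" for z
    by (auto simp: sphere_map_def T_def)
  show "\<exists>T. w \<in> T \<and> openin (top_of_set ?X) T \<and> (\<exists>v. \<Union>v = ?Y \<inter> f -` T \<and>
      (\<forall>u\<in>v. openin (top_of_set ?Y) u) \<and> pairwise disjnt v \<and> (\<forall>u\<in>v. \<exists>q. homeomorphism u T f q))"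
  proof (intro exI[of _ T] conjI exI[of _ v])
    show "w \<in> T" using w V by (simp add: T_def)
    show "openin (top_of_set ?X) T" using opT by (auto simp: openin_open T_def intro!: exI[of _ T])
    have "\<Union>v = ?g -` V \<inter> ?g -` (Some ` T)"
      unfolding v_def by (simp flip: Int_Union2)
    also have "\<dots> = ?g -` (Some ` T)" by (auto simp: T_def)
    also have "\<dots> = ?Y \<inter> f -` T" using TY by auto
    finally show Uv: "\<Union>v = ?Y \<inter> f -` T" .
    have opu: "open u" if u: "u \<in> v" for u
    proof -
      obtain C where C: "C \<in> components (?g -` V)" "u = C \<inter> ?g -` (Some ` T)"
        using u unfolding v_def by (rule imageE) (rule that)
      then show ?thesis using open_components[OF openg[OF V(1)] C(1)] openg[OF opT'] by (simp add: open_Int)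
    qed
    have uY: "u \<subseteq> ?Y" if "u \<in> v" for u
    proof -
      have "u \<subseteq> \<Union>v" using that by (rule Union_upper)
      then show ?thesis unfolding Uv by simp
    qed
    show "\<forall>u\<in>v. openin (top_of_set ?Y) u" using opu uY by (auto simp: openin_open)
    show "pairwise disjnt v"
    proof (rule pairwiseI)
      fix u u' assume u: "u \<in> v" "u' \<in> v" "u \<noteq> u'"
      obtain C where C: "C \<in> components (?g -` V)" "u = C \<inter> ?g -` (Some ` T)"
        using u(1) unfolding v_def by blast
      obtain C' where C': "C' \<in> components (?g -` V)" "u' = C' \<inter> ?g -` (Some ` T)"
        using u(2) unfolding v_def by blast
      have "C \<inter> C' = {}" using components_nonoverlap[OF C(1) C'(1)] u(3) C(2) C'(2) by auto
      then show "disjnt u u'" using C(2) C'(2) by (auto simp: disjnt_def)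
    qed
    show "\<forall>u\<in>v. \<exists>q. homeomorphism u T f q"
    proof
      fix u assume u: "u \<in> v"
      then obtain C where C: "C \<in> components (?g -` V)" "u = C \<inter> ?g -` (Some ` T)"
        unfolding v_def by blast
      obtain k where k: "homeomorphic_maps (top_of_set C) (subtopology riemann_sphere V) ?g k"
        using bspec[OF V(3) C(1)] homeomorphic_map_maps by blast
      have k1: "continuous_map (subtopology riemann_sphere V) (top_of_set C) k"
        and k2: "\<And>z. z \<in> C \<Longrightarrow> k (?g z) = z" and k3: "\<And>x. x \<in> V \<Longrightarrow> ?g (k x) = x"
        using k by (auto simp: homeomorphic_maps_def)
      have TV: "Some x \<in> V" if "x \<in> T" for x using that by (simp add: T_def)
      have "continuous_map (top_of_set T) (subtopology riemann_sphere V) Some"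
        unfolding continuous_map_in_subtopology
      proof
        show "continuous_map (top_of_set T) riemann_sphere Some"
          unfolding riemann_sphere_def by (rule continuous_map_from_subtopology[OF continuous_map_Some])
      qed (use TV in auto)
      then have kS: "continuous_map (top_of_set T) (top_of_set C) (k \<circ> Some)" by (rule continuous_map_compose[OF _ k1])
      then have ck: "continuous_on T (k \<circ> Some)"
        using continuous_map_into_fulltopology continuous_map_iff_continuous by blast
      have kC: "k (Some x) \<in> C" if "x \<in> T" for x
        using kS that by (auto simp: continuous_map_def)
      have gk: "?g (k (Some x)) = Some x" if "x \<in> T" for x using k3 TV that by blast
      have ku: "k (Some x) \<in> u" if "x \<in> T" for x
        using gk[OF that] kC[OF that] that by (auto simp: C(2))
      have uT: "f z \<in> T" if "z \<in> u" for z using that C(2) TY[of z] by auto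
      have "homeomorphism u T f (k \<circ> Some)"
      proof (rule homeomorphismI)
        show "continuous_on u f" using cf uY[OF u] continuous_on_subset by blast
        show "f ((k \<circ> Some) x) = x" if "x \<in> T" for x
          using gk[OF that] gY[of "k (Some x)"] uY[OF u] ku[OF that] by auto
        show "(k \<circ> Some) (f z) = z" if "z \<in> u" for z
          using k2[of z] gY[of z] uY[OF u] that C(2) by auto
      qed (use ck ku uT in auto)
      then show "\<exists>q. homeomorphism u T f q" by blast
    qed
  qed
qed

text \<open>Off one point the sphere is simply connected, so a covering of it is injective.\<close>

lemma transcendental_two_singular_values:
  assumes t: "transcendental_meromorphic g"
  shows "\<not> singular_set g \<subseteq> {c}"
proof
  assume sub: "singular_set g \<subseteq> {c}"
  obtain a b where ab: "a \<noteq> b" "a \<noteq> c" "b \<noteq> c"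
  proof (cases c)
    case None then show thesis using that[of "Some 0" "Some 1"] by simp
  next
    case (Some w) then show thesis using that[of None "Some (w + 1)"] by simp
  qed
  obtain \<phi> where \<phi>: "\<phi> \<in> conformal_maps" "\<phi> c = None" using conformal_map_triple[OF ab] by metis
  then have h: "homeomorphic_map riemann_sphere riemann_sphere \<phi>" and t': "transcendental_meromorphic (\<phi> \<circ> g)"
    using t by (auto simp: conformal_maps_def)
  then obtain f where f: "f nicely_meromorphic_on UNIV" "\<phi> \<circ> g = sphere_map f"
    by (auto simp: transcendental_iff meromorphic_map_iff)
  have s: "singular_set (sphere_map f) \<subseteq> {None}"
    using singular_set_comp_left[OF h, of g] sub \<phi>(2) f(2) by auto
  let ?Y = "{z. \<not> is_pole f z}"
  have cov: "covering_space ?Y f UNIV"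
    using covering_space_off_singular_set[OF f(1) _ s] t' f(2) by simp
  have conY: "connected ?Y"
  proof -
    have "f meromorphic_on UNIV" using f(1) by (simp add: nicely_meromorphic_on_def)
    then have "{x. \<not> \<not> is_pole f x} sparse_in UNIV"
      using meromorphic_on_imp_not_pole_cosparse[of f UNIV] by (simp only: eventually_cosparse)
    then have "connected (UNIV - {x. \<not> \<not> is_pole f x})" by (intro sparse_imp_connected) auto
    moreover have "UNIV - {x. \<not> \<not> is_pole f x} = ?Y" by auto
    ultimately show ?thesis by simp
  qed
  \<comment> \<open>The plane is simply connected, so \<open>f\<close> has a section
    \<open>\<sigma>\<close> through \<open>z1\<close>. Both \<open>\<sigma> \<circ> f\<close> and
    the identity are lifts of \<open>f\<close> and agree at \<open>z1\<close>, hence on the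
    connected set of all non-poles.\<close>
  have inj: "z = z1" if z: "z \<in> ?Y" "z1 \<in> ?Y" "f z = f z1" for z z1
  proof -
    obtain \<sigma> where \<sigma>: "continuous_on UNIV \<sigma>" "\<sigma> \<in> UNIV \<rightarrow> ?Y" "\<sigma> (f z1) = z1" "\<And>y. y \<in> UNIV \<Longrightarrow> f (\<sigma> y) = y"
      by (rule covering_space_lift_strong[OF cov z(2), of "f z1" UNIV "\<lambda>x. x"])
        (auto intro!: convex_imp_simply_connected convex_imp_locally_path_connected)
    have c: "continuous_on ?Y f" using cov by (simp add: covering_space_def)
    have "(\<sigma> \<circ> f) z = id z"
    proof (rule covering_space_lift_unique[OF cov, where ?g1.0 = "\<sigma> \<circ> f" and ?g2.0 = id and T = ?Y and f = f and a = z1])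
      show "continuous_on ?Y (\<sigma> \<circ> f)"
        by (rule continuous_on_compose[OF c continuous_on_subset[OF \<sigma>(1)]]) simp
      show "\<sigma> \<circ> f \<in> ?Y \<rightarrow> ?Y" using \<sigma>(2) by auto
      show "f x = f ((\<sigma> \<circ> f) x)" for x using \<sigma>(4) by simp
    qed (use c z conY \<sigma>(3) in auto)
    then show ?thesis using z \<sigma>(3) by simp
  qed
  have fin: "finite (sphere_map f -` {Some w})" for w
  proof -
    have "sphere_map f -` {Some w} \<subseteq> {THE z. z \<in> ?Y \<and> f z = w}"
    proof
      fix z assume "z \<in> sphere_map f -` {Some w}"
      then have "z \<in> ?Y \<and> f z = w" by (auto simp: sphere_map_def split: if_splits)
      then have "(THE z. z \<in> ?Y \<and> f z = w) = z" using inj by (intro the_equality) auto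
      then show "z \<in> {THE z. z \<in> ?Y \<and> f z = w}" by simp
    qed
    then show ?thesis using finite_subset by blast
  qed
  then show False
    using transcendental_infinite_preimage[of "sphere_map f" "Some 0" "Some 1" "Some 2"] t' f(2) by simp
qed

section \<open>Construction of the maps\<close>

lemma Homeo_plus_plane_id: "id \<in> Homeo_plus_plane"
  unfolding Homeo_plus_plane_def by (auto intro!: Homeo_plus_sphereI simp: option.map_id0 sphere_degree_id)

lemma Par_conformal:
  assumes "transcendental_meromorphic g" "\<phi> \<in> conformal_maps"
  shows "\<phi> \<circ> g \<in> Par g"
proof -
  have "\<phi> \<in> Homeo_plus_sphere" "transcendental_meromorphic (\<phi> \<circ> g)"
    using assms by (auto simp: conformal_maps_def intro: Homeo_plus_sphereI)
  then show ?thesis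
    unfolding Par_def transcendental_iff using Homeo_plus_plane_id
    by (intro CollectI exI[of _ \<phi>] exI[of _ id]) auto
qed

section \<open>Conjugacies and the choice of singular values\<close>

lemma topologically_conjugate_refl: "topologically_conjugate f f"
  unfolding topologically_conjugate_def by (intro exI[of _ id]) (simp add: option.map_id0)

lemma conformally_conjugate_imp_topologically:
  assumes "conformally_conjugate f g" shows "topologically_conjugate f g"
proof -
  obtain h k where hk: "h holomorphic_on UNIV" "k holomorphic_on UNIV" "k \<circ> h = id" "h \<circ> k = id"
      "map_option h \<circ> f = g \<circ> h"
    using assms unfolding conformally_conjugate_def by blast
  then have "homeomorphic_map euclidean euclidean h"
    unfolding homeomorphic_map_maps homeomorphic_maps_def
    by (intro exI[of _ k]) (auto simp: holomorphic_on_imp_continuous_on fun_eq_iff)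
  then show ?thesis using hk(5) unfolding topologically_conjugate_def by blast
qed

lemma homeomorphic_map_euclidean_iff:
  "homeomorphic_map euclidean euclidean h \<longleftrightarrow> (\<exists>h'. homeomorphism UNIV UNIV h h')"
proof
  assume "homeomorphic_map euclidean euclidean h"
  then obtain h' where "continuous_on UNIV h" "continuous_on UNIV h'" "\<forall>x. h' (h x) = x" "\<forall>y. h (h' y) = y"
    unfolding homeomorphic_map_maps homeomorphic_maps_def by auto
  then have "homeomorphism UNIV UNIV h h'" by (intro homeomorphismI) auto
  then show "\<exists>h'. homeomorphism UNIV UNIV h h'" by blast
next
  assume "\<exists>h'. homeomorphism UNIV UNIV h h'"
  then show "homeomorphic_map euclidean euclidean h"
    unfolding homeomorphic_map_maps homeomorphic_maps_def homeomorphism_def by auto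
qed

text \<open>The point \<open>a\<close> will become 1: it needs an infinite fibre, but it need not be
  singular. If there are three singular values, Picard's theorem provides \<open>a\<close> among
  them; if there are two, \<open>a\<close> can be any other value outside the finitely many
  exceptional ones.\<close>

lemma normalized_singular_values:
  assumes g: "transcendental_meromorphic g" and fin: "finite (singular_set g)" "card (singular_set g) \<le> 3"
  obtains a b c where "a \<noteq> b" "a \<noteq> c" "b \<noteq> c" "singular_set g \<subseteq> {a, b, c}" "{b, c} \<subseteq> singular_set g"
    "infinite (g -` {a})"
proof -
  let ?S = "singular_set g"
  have two: "\<not> ?S \<subseteq> {c}" for c by (rule transcendental_two_singular_values[OF g])
  then have "?S \<noteq> {}" "card ?S \<noteq> 1" by (auto simp: card_1_singleton_iff)
  then have "card ?S \<noteq> 0" using fin(1) by simp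
  then consider "card ?S = 2" | "card ?S = 3" using \<open>card ?S \<noteq> 1\<close> fin(2) by linarith
  then show thesis
  proof cases
    case 1
    then obtain b c where S: "?S = {b, c}" "b \<noteq> c" by (auto simp: card_2_iff)
    have "infinite (UNIV :: complex option set)"
      using infinite_UNIV_char_0[where 'a = complex] by (simp add: finite_option_UNIV)
    then have "infinite (- (?S \<union> {v. finite (g -` {v})}))"
      using finite_exceptional_values[OF g] fin(1) by (simp add: Compl_eq_Diff_UNIV)
    then obtain a where "a \<notin> ?S" "infinite (g -` {a})" by (metis (mono_tags, lifting) Collect_mem_eq ComplD UnI1 UnI2 ex_in_conv finite.emptyI mem_Collect_eq)
    then show thesis using that[of a b c] S by auto
  next
    case 2
    then obtain x y z where S: "?S = {x, y, z}" "x \<noteq> y" "y \<noteq> z" "x \<noteq> z" by (auto simp: card_3_iff)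
    then have "infinite (g -` {x}) \<or> infinite (g -` {y}) \<or> infinite (g -` {z})"
      by (intro transcendental_infinite_preimage[OF g])
    then show thesis
    proof (elim disjE)
      assume "infinite (g -` {x})" then show thesis using S by (intro that[of x y z]) auto
    next
      assume "infinite (g -` {y})" then show thesis using S by (intro that[of y x z]) auto
    next
      assume "infinite (g -` {z})" then show thesis using S by (intro that[of z x y]) auto
    qed
  qed
qed

text \<open>Whether or not \<open>q\<close> is a singular value, the orbit of \<open>p\<close> runs
  into the cycle of \<open>q\<close> and \<open>s\<close>, and the orbit of \<infinity> stops at
  once.\<close>

lemma postsingular_set_cycle:
  assumes S: "singular_set f \<subseteq> {Some p, Some q, None}" "Some p \<in> singular_set f" "None \<in> singular_set f"
    and f: "f p = Some q" "f q = Some s" "f s = Some q"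
  shows "postsingular_set f = {Some p, Some q, Some s, None}"
proof (intro equalityI subsetI)
  fix x assume "x \<in> postsingular_set f"
  then show "x \<in> {Some p, Some q, Some s, None}"
    by induction (use S f in auto)
next
  have p: "Some p \<in> postsingular_set f" "None \<in> postsingular_set f" using S by (auto intro: postsingular_set.singular)
  have q: "Some q \<in> postsingular_set f" using postsingular_set.step[OF p(1)] f by simp
  have s: "Some s \<in> postsingular_set f" using postsingular_set.step[OF q] f by simp
  fix x assume "x \<in> {Some p, Some q, Some s, None}"
  then show "x \<in> postsingular_set f" using p q s by auto
qed

text \<open>The conjugacy respects the singular values and their orbits, hence fixes \<open>p\<close> and moves
  \<open>s1\<close> to \<open>s2\<close>; removing the affine factors turns it into a symmetry of the common factor \<open>f\<close>.\<close>

lemma symmetry_of_conjugacy: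
  assumes f: "f nicely_meromorphic_on UNIV" and p: "f p = 1"
    and S: "singular_set (sphere_map f) \<subseteq> {None, Some 0, Some 1}" "Some 0 \<in> singular_set (sphere_map f)"
    and q1: "q1 \<noteq> p" "\<not> is_pole f q1" "(q1 - p) * f q1 = s1 - p"
    and q2: "q2 \<noteq> p" "\<not> is_pole f q2" "(q2 - p) * f q2 = s2 - p" and s2: "s2 \<noteq> p"
    and conj: "topologically_conjugate (affine_map (q1 - p) p \<circ> sphere_map f) (affine_map (q2 - p) p \<circ> sphere_map f)"
  shows "\<exists>\<eta> h. symmetry_over f \<eta> h \<and> h p = p \<and> h s1 = s2"
proof -
  define F where "F q = affine_map (q - p) p \<circ> sphere_map f" for q
  obtain h where h: "homeomorphic_map euclidean euclidean h" and eq: "map_option h \<circ> F q1 = F q2 \<circ> h"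
    using conj unfolding topologically_conjugate_def F_def by blast
  obtain h' where hom: "homeomorphism UNIV UNIV h h'" using h unfolding homeomorphic_map_euclidean_iff ..
  have eq: "map_option h (F q1 z) = F q2 (h z)" for z using fun_cong[OF eq, of z] by simp
  have inv: "h' (h z) = z" "h (h' z) = z" for z using hom by (auto simp: homeomorphism_def)
  have Fs: "singular_set (F q) = affine_map (q - p) p ` singular_set (sphere_map f)" if "q \<noteq> p" for q
    unfolding F_def by (rule singular_set_comp_left[OF homeomorphic_affine_map]) (use that in simp)
  have FS: "singular_set (F q) \<subseteq> {None, Some p, Some q}" "Some p \<in> singular_set (F q)" if "q \<noteq> p" for q
    using S unfolding Fs[OF that] by (auto simp: affine_map_def image_iff) force+
  have np: "\<not> is_pole f p" using nicely_meromorphic_pole_0[OF f, of p] p by auto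
  have Fp: "F q p = Some q" for q using p np by (simp add: F_def sphere_map_def affine_map_def)
  have Fq1: "F q1 q1 = Some s1" using q1 by (simp add: F_def sphere_map_def affine_map_def)
  have Fq2: "F q2 q2 = Some s2" using q2 by (simp add: F_def sphere_map_def affine_map_def)
  have hS: "map_option h ` singular_set (F q1) = singular_set (F q2)"
  proof -
    have "map_option h \<circ> F q1 = F q2 \<circ> h" using eq by auto
    then show ?thesis
      using singular_set_comp_left[OF homeomorphic_map_option[OF hom], of "F q1"]
        singular_set_comp_right[OF hom, of "F q2"] by simp
  qed
  have "Some (h p) \<in> singular_set (F q2)" using hS FS(2)[OF q1(1)] by force
  then have hp: "h p = p \<or> h p = q2" using FS(1)[OF q2(1)] by auto
  have hp: "h p = p"
  \<comment> \<open>A conjugacy might interchange the two finite singular values, so that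
    \<open>h p = q2\<close> and \<open>h q1 = p\<close>. But \<open>q1\<close> is the image of
    \<open>p\<close>, so \<open>h q1\<close> is the image of \<open>q2\<close>, which is
    \<open>s2\<close> and not \<open>p\<close>.\<close>
  proof (rule ccontr)
    assume "h p \<noteq> p"
    then have hp2: "h p = q2" using hp by simp
    obtain x where x: "x \<in> singular_set (F q1)" "map_option h x = Some p"
      using hS FS(2)[OF q2(1)] by (metis imageE)
    then have "h q1 = p" using FS(1)[OF q1(1)] \<open>h p \<noteq> p\<close> by auto
    moreover have "Some (h q1) = Some s2" using eq[of p] Fp[of q1] hp2 Fq2 by simp
    ultimately show False using s2 by simp
  qed
  have hq: "h q1 = q2" using eq[of p] Fp hp by simp
  have hs: "h s1 = s2" using eq[of q1] Fq1 Fq2 hq by simp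
  \<comment> \<open>The conjugacy \<open>h\<close> read in affine coordinates that put
    \<open>p\<close> at 0, and \<open>q1\<close> respectively \<open>q2\<close> at 1.\<close>
  define \<eta> where "\<eta> = (\<lambda>z. (z - p) / (q2 - p)) \<circ> h \<circ> (\<lambda>w. (q1 - p) * w + p)"
  have "\<exists>\<eta>'. homeomorphism UNIV UNIV \<eta> \<eta>'"
    unfolding \<eta>_def
    using homeomorphism_compose[OF homeomorphism_affine[of "q1 - p" p] homeomorphism_compose[OF hom homeomorphism_symD[OF homeomorphism_affine[of "q2 - p" p]]]] q1(1) q2(1)
    by (auto simp: comp_assoc)
  moreover have "\<eta> 0 = 0" "\<eta> 1 = 1" using hp hq q2(1) by (auto simp: \<eta>_def)
  moreover have "f (h z) = \<eta> (f z)" for z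
  proof (cases "is_pole f z")
    case True
    then have "F q1 z = None" by (simp add: F_def sphere_map_def affine_map_def)
    then have "F q2 (h z) = None" using eq[of z] by simp
    then have "is_pole f (h z)" by (simp add: F_def sphere_map_def affine_map_def split: if_splits)
    then show ?thesis using True nicely_meromorphic_pole_0[OF f] \<open>\<eta> 0 = 0\<close> by simp
  next
    case False
    then have "F q2 (h z) = Some (h ((q1 - p) * f z + p))"
      using eq[of z] by (simp add: F_def sphere_map_def affine_map_def)
    then have "(q2 - p) * f (h z) + p = h ((q1 - p) * f z + p)"
      by (auto simp: F_def sphere_map_def affine_map_def split: if_splits)
    then have "h ((q1 - p) * f z + p) - p = (q2 - p) * f (h z)" by (metis add_diff_cancel_right')
    then show ?thesis using q2(1) by (simp add: \<eta>_def)
  qed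
  ultimately have "symmetry_over f \<eta> h" using hom unfolding symmetry_over_def by blast
  then show ?thesis using hp hs by blast
qed

theorem corollary1p1:
  fixes g :: "complex \<Rightarrow> complex option"
  assumes "transcendental_meromorphic g"
    and "finite (singular_set g)" and "card (singular_set g) \<le> 3"
  shows "\<exists>F. F \<subseteq> Par g \<and> infinite F \<and>
    (\<forall>f\<in>F. postsingularly_finite f \<and> card (postsingular_set f) = 4) \<and>
    pairwise (\<lambda>f1 f2. \<not> topologically_conjugate f1 f2 \<and> \<not> conformally_conjugate f1 f2) F"
proof -
  obtain a b c where abc: "a \<noteq> b" "a \<noteq> c" "b \<noteq> c" and S: "singular_set g \<subseteq> {a, b, c}" "{b, c} \<subseteq> singular_set g"
    and inf: "infinite (g -` {a})"
    using normalized_singular_values[OF assms] by metis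
  obtain \<phi> where \<phi>: "\<phi> \<in> conformal_maps" "\<phi> a = Some 1" "\<phi> b = Some 0" "\<phi> c = None"
    using conformal_map_triple[OF abc] by metis
  have h\<phi>: "homeomorphic_map riemann_sphere riemann_sphere \<phi>" and t: "transcendental_meromorphic (\<phi> \<circ> g)"
    using \<phi>(1) assms(1) by (auto simp: conformal_maps_def)
  then obtain f where f: "f nicely_meromorphic_on UNIV" "\<phi> \<circ> g = sphere_map f"
    by (auto simp: transcendental_iff meromorphic_map_iff)
  have t: "transcendental_meromorphic (sphere_map f)" using t f(2) by simp
  have "singular_set (sphere_map f) = \<phi> ` singular_set g"
    using singular_set_comp_left[OF h\<phi>, of g] f(2) by simp
  then have SG: "singular_set (sphere_map f) \<subseteq> {None, Some 0, Some 1}" "Some 0 \<in> singular_set (sphere_map f)"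
      "None \<in> singular_set (sphere_map f)"
    using S \<phi> by (auto simp: image_iff) metis+
  have D: "infinite {z. f z = 1}"
  proof
    assume fin: "finite {z. f z = 1}"
    have "g -` {a} \<subseteq> {z. f z = 1}"
    proof
      fix z assume "z \<in> g -` {a}"
      then have "sphere_map f z = Some 1" using fun_cong[OF f(2), of z] \<phi>(2) by simp
      then show "z \<in> {z. f z = 1}" by (simp add: sphere_map_def split: if_splits)
    qed
    then show False using inf fin finite_subset by blast
  qed
  have cov: "covering_space {z. f z \<noteq> 0 \<and> f z \<noteq> 1} f (-{0,1})"
  proof -
    have "{z. \<not> is_pole f z \<and> Some (f z) \<notin> {None, Some 0, Some 1}} = {z. f z \<noteq> 0 \<and> f z \<noteq> 1}"
      using nicely_meromorphic_pole_0[OF f(1)] by auto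
    moreover have "{w::complex. Some w \<notin> {None, Some 0, Some 1}} = -{0,1}" by auto
    ultimately show ?thesis using covering_space_off_singular_set[OF f(1) t SG(1)] by simp
  qed
  obtain p where p: "f p = 1" using D by (metis (mono_tags, lifting) Collect_empty_eq finite.emptyI)
  have np: "\<not> is_pole f z" if "f z = 1" for z using nicely_meromorphic_pole_0[OF f(1), of z] that by auto
  obtain H where H: "transcendental_meromorphic (sphere_map H)"
    "\<And>z v. z \<noteq> p \<Longrightarrow> sphere_map H z = Some v \<Longrightarrow> \<not> is_pole f z \<and> (z - p) * f z = v"
    using transcendental_mult_linear[OF f(1) t, of p] by metis
  \<comment> \<open>The points \<open>s\<close> for which Picard's theorem fails to provide
    infinitely many candidates for \<open>q\<close>.\<close>
  define E where "E = {s. finite (sphere_map H -` {Some (s - p)})}"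
  have "finite E"
  proof -
    have "E = (\<lambda>s. Some (s - p)) -` {v. finite (sphere_map H -` {v})}" by (auto simp: E_def)
    moreover have "finite \<dots>"
      by (rule finite_vimageI[OF finite_exceptional_values[OF H(1)]]) (simp add: inj_def)
    ultimately show ?thesis by simp
  qed
  define A where "A = {z. f z = 1} - (E \<union> {p})"
  have A: "infinite A" unfolding A_def using D \<open>finite E\<close> by simp
  have "f s = 1" if "s \<in> A" for s using that by (simp add: A_def)
  then obtain B where B: "B \<subseteq> A" "infinite B"
    "\<And>s s' h \<eta>. s \<in> B \<Longrightarrow> s' \<in> B \<Longrightarrow> symmetry_over f \<eta> h \<Longrightarrow> h p = p \<Longrightarrow> h s = s' \<Longrightarrow> s = s'"
    using infinite_inequivalent_subset[OF f(1) cov p A] by metis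
  \<comment> \<open>The equation always has the solution \<open>q = s\<close>, because
    \<open>f s = 1\<close>, but this would collapse the cycle to a fixed point. Among infinitely
    many solutions there is one different from \<open>s\<close> and \<open>p\<close>.\<close>
  have "\<exists>q. q \<noteq> p \<and> q \<noteq> s \<and> \<not> is_pole f q \<and> (q - p) * f q = s - p" if "s \<in> B" for s
  proof -
    have "infinite (sphere_map H -` {Some (s - p)} - {p, s})"
      using that B(1) by (auto simp: A_def E_def)
    then obtain q where "q \<in> sphere_map H -` {Some (s - p)} - {p, s}" by (metis ex_in_conv finite.emptyI)
    then show ?thesis using H(2)[of q "s - p"] by auto
  qed
  then obtain q where q: "\<And>s. s \<in> B \<Longrightarrow> q s \<noteq> p" "\<And>s. s \<in> B \<Longrightarrow> q s \<noteq> s" "\<And>s. s \<in> B \<Longrightarrow> \<not> is_pole f (q s)"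
      "\<And>s. s \<in> B \<Longrightarrow> (q s - p) * f (q s) = s - p"
    by metis
  define F where "F s = affine_map (q s - p) p \<circ> sphere_map f" for s
  have Bs: "f s = 1" "s \<noteq> p" if "s \<in> B" for s using that B(1) by (auto simp: A_def)
  have FPar: "F s \<in> Par g" if "s \<in> B" for s
  proof -
    have "affine_map (q s - p) p \<circ> \<phi> \<in> conformal_maps"
      using \<phi>(1) q(1)[OF that] by (intro conformal_maps_comp affine_map_conformal) auto
    then have "affine_map (q s - p) p \<circ> \<phi> \<circ> g \<in> Par g" by (rule Par_conformal[OF assms(1)])
    then show ?thesis using f(2) by (simp add: F_def comp_assoc)
  qed
  have Fps: "postsingular_set (F s) = {Some p, Some (q s), Some s, None}" if s: "s \<in> B" for s
  proof (rule postsingular_set_cycle)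
    have e: "singular_set (F s) = affine_map (q s - p) p ` singular_set (sphere_map f)"
      unfolding F_def by (rule singular_set_comp_left[OF homeomorphic_affine_map]) (use q(1)[OF s] in simp)
    show "singular_set (F s) \<subseteq> {Some p, Some (q s), None}"
      unfolding e using SG(1) by (auto simp: affine_map_def)
    show "Some p \<in> singular_set (F s)" "None \<in> singular_set (F s)"
      unfolding e using imageI[OF SG(2), of "affine_map (q s - p) p"] imageI[OF SG(3), of "affine_map (q s - p) p"]
      by (auto simp: affine_map_def)
    show "F s p = Some (q s)" "F s s = Some (q s)"
      using p np Bs[OF s] by (auto simp: F_def sphere_map_def affine_map_def)
    show "F s (q s) = Some s"
      using q(3,4)[OF s] by (simp add: F_def sphere_map_def affine_map_def)
  qed
  have inj: "s1 = s2" if s: "s1 \<in> B" "s2 \<in> B" and conj: "topologically_conjugate (F s1) (F s2)" for s1 s2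
  proof -
    obtain \<eta> h where h: "symmetry_over f \<eta> h" "h p = p" "h s1 = s2"
      using symmetry_of_conjugacy[OF f(1) p SG(1,2) q(1,3,4)[OF s(1)] q(1,3,4)[OF s(2)] Bs(2)[OF s(2)] conj[unfolded F_def]]
      by blast
    then show ?thesis using B(3)[OF s h] by simp
  qed
  show ?thesis
  proof (intro exI[of _ "F ` B"] conjI)
    show "F ` B \<subseteq> Par g" using FPar by blast
    \<comment> \<open>Equal maps are conjugate, so the same argument shows that different
      \<open>s\<close> give different maps.\<close>
    have "inj_on F B"
    proof (rule inj_onI)
      fix s1 s2 assume "s1 \<in> B" "s2 \<in> B" "F s1 = F s2"
      then show "s1 = s2" using inj[of s1 s2] topologically_conjugate_refl by simp
    qed
    then show "infinite (F ` B)" using B(2) finite_imageD by blast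
    show "\<forall>f\<in>F ` B. postsingularly_finite f \<and> card (postsingular_set f) = 4"
    proof (rule ballI, elim imageE)
      fix x s assume s: "x = F s" "s \<in> B"
      have "Some s \<noteq> Some p" "Some (q s) \<noteq> Some p" "Some (q s) \<noteq> Some s" using q(1,2) Bs(2) s(2) by auto
      then show "postsingularly_finite x \<and> card (postsingular_set x) = 4"
        using Fps[OF s(2)] s(1) by (simp add: postsingularly_finite_def card_insert_if)
    qed
    show "pairwise (\<lambda>f1 f2. \<not> topologically_conjugate f1 f2 \<and> \<not> conformally_conjugate f1 f2) (F ` B)"
      using inj conformally_conjugate_imp_topologically by (fastforce simp: pairwise_def)
  qed
qed

end
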